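(* Let $n \geq 3$ and $k \geq 1$ be integers and let $\alpha \in (1, n/2)$. Assume that $u:\mathbb{R}^n \to \mathbb{R}^k$ is bounded and differentiable, and solves the integral equation $$u(x)=\int_{\mathbb{R}^n}\frac{u(y)\,(1-|u(y)|^2)}{|x-y|^{n-\alpha}}\,dy \qquad \text{for every } x \in \mathbb{R}^n.$$ If $u \in L^2(\mathbb{R}^n)$, then $u(x) = 0$ for every $x \in \mathbb{R}^n$.
   Context: Here $|\cdot|$ denotes the Euclidean norm (on $\mathbb{R}^k$ for $|u(y)|$, on $\mathbb{R}^n$ for $|x-y|$). The integral of the $\mathbb{R}^k$-valued function is taken with respect to Lebesgue measure, componentwise. $u \in L^2(\mathbb{R}^n)$ means $\int_{\mathbb{R}^n}|u(x)|^2\,dx<\infty$. *)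

theory Defs
  imports "HOL-Analysis.Analysis"
begin

end

theory Submission
  imports Defs "HOL-Probability.Distributions"
begin

text \<open>
  Put \<open>\<beta> = \<alpha>/2\<close> and \<open>g = (1 - |u|\<^sup>2) u\<close>; up to a constant the equation reads \<open>(-\<Delta>)\<^sup>\<beta> u = g\<close>.
  Testing it with \<open>x \<bullet> \<nabla>u\<close> gives the Pohozaev identity
  \<open>\<alpha> \<integral>|u|\<^sup>2 + (n/2 - \<alpha>) \<integral>|u|\<^sup>4 = 0\<close>, which forces \<open>u = 0\<close>. The difficulty is that \<open>u\<close> is only
  in \<open>L\<^sup>2\<close>: neither \<open>x \<bullet> \<nabla>u\<close> nor the double integral of \<open>|g(x)| |g(y)| |x-y|\<close> to the power \<open>\<alpha>-n\<close>
  needs to be under control. So \<open>x\<close> is replaced by the field \<open>X(x) = x exp (-d|x|\<^sup>2)\<close> and the Riesz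
  potential by integrable mixtures of heat operators \<open>P\<^sub>t\<close>: for suitable integrable \<open>b, c, k\<close> on
  the half line, \<open>u = \<integral>b(t) P\<^sub>t u + \<integral>k(t) P\<^sub>t g\<close> and \<open>\<integral>b(t) P\<^sub>t g = \<integral>c(t) P\<^sub>t u\<close>. In the resulting
  terms the derivatives can be antisymmetrised, which leaves only \<open>X(x) - X(y)\<close> and gives bounds
  uniform in \<open>d\<close> and \<open>t\<close>. The limit \<open>d \<longrightarrow> 0\<close> is evaluated by dilating \<open>t\<close> and using that the Riesz
  potential is homogeneous.
\<close>

text \<open>\<open>frac_kernel \<beta>\<close> is not integrable at infinity, so the Riesz potential
  is not itself a mixture of heat operators with integrable weight. The summand with
  \<open>b\<close> carries off the low frequencies and leaves an integrable \<open>k\<close>. Its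
  price is a cross term pairing \<open>g\<close> with the gradient of P_t u. That term
  antisymmetrises only together with \<open>u\<close> against the gradient of P_t g, and the second
  relation turns the latter into a pairing of \<open>u\<close> with itself, which antisymmetrises
  alone, as does the \<open>k\<close>-term in \<open>g\<close>.

  The bound \<alpha> > 1 makes t^(\<beta>-1) t^(-1/2) integrable at 0, where t^(-1/2) is the cost of
  a gradient. Hence \<open>u\<close>, and with it \<open>g\<close>, is Lipschitz, and the gradients
  of P_t u and P_t g stay bounded as t tends to 0. The bound \<alpha> < n/2 makes t^(\<beta>-1)
  t^(-n/4) integrable at infinity, where t^(-n/4) is the decay of the heat flow of a square
  integrable function; the same bound gives the quartic term of the final identity its sign.\<close>

lemma integrable_boundI:
  fixes f g :: "'a \<Rightarrow> real"
  assumes "integrable M g" "\<And>x. \<bar>f x\<bar> \<le> \<bar>g x\<bar>" "f \<in> borel_measurable M"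
  shows "integrable M f"
  by (rule Bochner_Integration.integrable_bound[OF assms(1,3)]) (simp add: assms(2))

section \<open>Affine substitution, convolution integrals and derivatives of parameter
  integrals\<close>

lemma lborel_integral_affine:
  fixes f :: "'a::euclidean_space \<Rightarrow> real"
  assumes [measurable]: "f \<in> borel_measurable borel" and c: "c \<noteq> 0"
  shows "integrable lborel (\<lambda>x. f (t + c *\<^sub>R x)) \<longleftrightarrow> integrable lborel f"
    and "integral\<^sup>L lborel (\<lambda>x. f (t + c *\<^sub>R x)) = integral\<^sup>L lborel f / \<bar>c\<bar> ^ DIM('a)"
proof -
  let ?D = "distr lborel borel (\<lambda>x::'a. t + c *\<^sub>R x)"
  have eq: "(lborel :: 'a measure) = density ?D (\<lambda>_. ennreal (\<bar>c\<bar> ^ DIM('a)))"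
    using lborel_affine[OF c, of t] by simp
  have "integrable lborel f \<longleftrightarrow> integrable ?D (\<lambda>x. \<bar>c\<bar> ^ DIM('a) *\<^sub>R f x)"
    by (subst eq, subst integrable_density) auto
  also have "\<dots> \<longleftrightarrow> integrable lborel (\<lambda>x. f (t + c *\<^sub>R x))"
    using c by (subst integrable_distr_eq) auto
  finally show "integrable lborel (\<lambda>x. f (t + c *\<^sub>R x)) \<longleftrightarrow> integrable lborel f" ..
  have "integral\<^sup>L lborel f = integral\<^sup>L ?D (\<lambda>x. \<bar>c\<bar> ^ DIM('a) *\<^sub>R f x)"
    by (subst eq, subst integral_density) auto
  also have "\<dots> = \<bar>c\<bar> ^ DIM('a) * integral\<^sup>L lborel (\<lambda>x. f (t + c *\<^sub>R x))"
    by (subst integral_distr) auto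
  finally show "integral\<^sup>L lborel (\<lambda>x. f (t + c *\<^sub>R x)) = integral\<^sup>L lborel f / \<bar>c\<bar> ^ DIM('a)"
    using c by simp
qed

lemma
  fixes f :: "'a::euclidean_space \<Rightarrow> real"
  assumes "f \<in> borel_measurable borel"
  shows lborel_integrable_translate_iff: "integrable lborel (\<lambda>x. f (x + t)) \<longleftrightarrow> integrable lborel f"
    and lborel_integral_translate: "integral\<^sup>L lborel (\<lambda>x. f (x + t)) = integral\<^sup>L lborel f"
    and lborel_integrable_reflect_iff: "integrable lborel (\<lambda>x. f (t - x)) \<longleftrightarrow> integrable lborel f"
    and lborel_integral_reflect: "integral\<^sup>L lborel (\<lambda>x. f (t - x)) = integral\<^sup>L lborel f"
  using lborel_integral_affine[OF assms, of 1 t] lborel_integral_affine[OF assms, of "-1" t]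
  by (simp_all add: add.commute)

lemma
  fixes f g :: "'a::euclidean_space \<Rightarrow> real"
  assumes f: "integrable lborel f" and g: "integrable lborel g"
  shows convolution_integrable_pair: "integrable (lborel \<Otimes>\<^sub>M lborel) (\<lambda>(x, y). f y * g (x - y))"
    and convolution_integrable_pair': "integrable (lborel \<Otimes>\<^sub>M lborel) (\<lambda>(x, y). f x * g (x - y))"
proof -
  have [measurable]: "f \<in> borel_measurable borel" "g \<in> borel_measurable borel"
    using f g by auto
  show 2: "integrable (lborel \<Otimes>\<^sub>M lborel) (\<lambda>(x, y). f x * g (x - y))"
  proof (rule lborel_pair.Fubini_integrable)
    have "(\<lambda>x. LBINT y. norm (case (x, y) of (x, y) \<Rightarrow> f x * g (x - y)))
      = (\<lambda>x. \<bar>f x\<bar> * (LBINT z. \<bar>g z\<bar>))"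
      by (simp add: abs_mult lborel_integral_reflect[of "\<lambda>z. \<bar>g z\<bar>"])
    then show "integrable lborel (\<lambda>x. LBINT y. norm (case (x, y) of (x, y) \<Rightarrow> f x * g (x - y)))"
      using f by simp
  qed (use g in \<open>auto simp: lborel_integrable_reflect_iff\<close>)
  show "integrable (lborel \<Otimes>\<^sub>M lborel) (\<lambda>(x, y). f y * g (x - y))"
  proof -
    have "integrable (lborel \<Otimes>\<^sub>M lborel) (\<lambda>(y, x). f y * g (x - y))"
    proof (rule lborel_pair.Fubini_integrable)
      have "(\<lambda>y. LBINT x. norm (case (y, x) of (y, x) \<Rightarrow> f y * g (x - y)))
        = (\<lambda>x. \<bar>f x\<bar> * (LBINT z. \<bar>g z\<bar>))"
        using lborel_integral_translate[of "\<lambda>z. \<bar>g z\<bar>"]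
        by (simp add: abs_mult diff_conv_add_uminus del: add_uminus_conv_diff)
      then show "integrable lborel (\<lambda>y. LBINT x. norm (case (y, x) of (y, x) \<Rightarrow> f y * g (x - y)))"
        using f by simp
    qed (use g lborel_integrable_translate_iff[of g] in
        \<open>auto simp: diff_conv_add_uminus simp del: add_uminus_conv_diff\<close>)
    from lborel_pair.integrable_product_swap[OF this] show ?thesis by simp
  qed
qed

text \<open>The pointwise bound |a b| <= a^2 + b^2 takes the place of Cauchy-Schwarz: each square
  integrates against |g| by translation invariance. A sum of energies is weaker than a product of
  norms, but later only the dependence on \<open>g\<close> through its L1 norm matters, which for a
  heat kernel means no dependence on t.\<close>

lemma young_integrable:
  fixes a b g :: "'a::euclidean_space \<Rightarrow> real"
  assumes [measurable]: "a \<in> borel_measurable borel" "b \<in> borel_measurable borel"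
    and a: "integrable lborel (\<lambda>x. (a x)\<^sup>2)" and b: "integrable lborel (\<lambda>x. (b x)\<^sup>2)"
    and g: "integrable lborel g"
  shows "integrable (lborel \<Otimes>\<^sub>M lborel) (\<lambda>(x, y). a x * b y * g (x - y))"
    and "(\<integral>p. \<bar>case p of (x, y) \<Rightarrow> a x * b y * g (x - y)\<bar> \<partial>(lborel \<Otimes>\<^sub>M lborel)) \<le>
      ((LBINT x. (a x)\<^sup>2) + (LBINT x. (b x)\<^sup>2)) * (LBINT x. \<bar>g x\<bar>)"
proof -
  have [measurable]: "g \<in> borel_measurable borel" using g by auto
  have g': "integrable lborel (\<lambda>z. \<bar>g z\<bar>)" using g by simp
  let ?A = "\<lambda>(x, y). (a x)\<^sup>2 * \<bar>g (x - y)\<bar>" and ?B = "\<lambda>(x, y). (b y)\<^sup>2 * \<bar>g (x - y)\<bar>"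
  have A: "integrable (lborel \<Otimes>\<^sub>M lborel) ?A"
    using convolution_integrable_pair'[OF a g'] by simp
  have B: "integrable (lborel \<Otimes>\<^sub>M lborel) ?B"
    using convolution_integrable_pair[OF b g'] by simp
  have AB: "integrable (lborel \<Otimes>\<^sub>M lborel) (\<lambda>p. ?A p + ?B p)" using A B by simp
  have ineq: "\<bar>a x * b y * g (x - y)\<bar> \<le> (a x)\<^sup>2 * \<bar>g (x - y)\<bar> + (b y)\<^sup>2 * \<bar>g (x - y)\<bar>" for x y
  proof -
    have "0 \<le> (\<bar>a x\<bar> - \<bar>b y\<bar>)\<^sup>2" by simp
    then have "2 * (\<bar>a x\<bar> * \<bar>b y\<bar>) \<le> (a x)\<^sup>2 + (b y)\<^sup>2"
      by (simp add: power2_diff algebra_simps)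
    moreover have "0 \<le> \<bar>a x\<bar> * \<bar>b y\<bar>" by simp
    ultimately have "\<bar>a x * b y\<bar> \<le> (a x)\<^sup>2 + (b y)\<^sup>2"
      unfolding abs_mult by linarith
    from mult_right_mono[OF this abs_ge_zero[of "g (x - y)"]] show ?thesis
      by (simp add: abs_mult algebra_simps)
  qed
  show I: "integrable (lborel \<Otimes>\<^sub>M lborel) (\<lambda>(x, y). a x * b y * g (x - y))"
    by (rule Bochner_Integration.integrable_bound[OF AB])
      (use ineq in \<open>auto intro!: AE_I2 simp: abs_mult intro: order_trans\<close>)
  have "(\<integral>p. ?A p \<partial>(lborel \<Otimes>\<^sub>M lborel)) = (LBINT x. (a x)\<^sup>2) * (LBINT x. \<bar>g x\<bar>)"
    using A by (simp add: lborel_pair.integral_fst[symmetric] lborel_integral_reflect[of "\<lambda>z. \<bar>g z\<bar>"])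
  moreover have "(\<integral>p. ?B p \<partial>(lborel \<Otimes>\<^sub>M lborel)) = (LBINT x. (b x)\<^sup>2) * (LBINT x. \<bar>g x\<bar>)"
    using B lborel_integral_translate[of "\<lambda>z. \<bar>g z\<bar>"]
    by (simp add: lborel_pair.integral_snd[symmetric] diff_conv_add_uminus del: add_uminus_conv_diff)
  moreover have "(\<integral>p. \<bar>case p of (x, y) \<Rightarrow> a x * b y * g (x - y)\<bar> \<partial>(lborel \<Otimes>\<^sub>M lborel))
    \<le> (\<integral>p. ?A p + ?B p \<partial>(lborel \<Otimes>\<^sub>M lborel))"
    by (rule integral_mono[OF _ AB]) (use I ineq in auto)
  ultimately show "(\<integral>p. \<bar>case p of (x, y) \<Rightarrow> a x * b y * g (x - y)\<bar> \<partial>(lborel \<Otimes>\<^sub>M lborel)) \<le>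
      ((LBINT x. (a x)\<^sup>2) + (LBINT x. (b x)\<^sup>2)) * (LBINT x. \<bar>g x\<bar>)"
    using A B by (simp add: algebra_simps)
qed

text \<open>Domination is asked of the difference quotients at 0, not of derivatives nearby.
  Lipschitz bounds supply it, and differentiability is then needed at a single point only, which
  suits a \<open>u\<close> whose derivative may be discontinuous.\<close>

lemma has_field_derivative_integral:
  fixes f :: "real \<Rightarrow> 'b \<Rightarrow> real"
  assumes r: "r > 0"
    and f: "\<And>h. \<bar>h\<bar> < r \<Longrightarrow> integrable M (f h)"
    and f': "f' \<in> borel_measurable M"
    and w: "integrable M w"
    and der: "\<And>y. y \<in> space M \<Longrightarrow> ((\<lambda>h. f h y) has_field_derivative f' y) (at 0)"
    and bound: "\<And>h y. \<bar>h\<bar> < r \<Longrightarrow> y \<in> space M \<Longrightarrow> \<bar>f h y - f 0 y\<bar> \<le> \<bar>h\<bar> * w y"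
  shows "((\<lambda>h. \<integral>y. f h y \<partial>M) has_field_derivative (\<integral>y. f' y \<partial>M)) (at 0)"
proof -
  have "(\<lambda>n. ((\<integral>y. f (X n) y \<partial>M) - (\<integral>y. f 0 y \<partial>M)) / X n) \<longlonglongrightarrow> (\<integral>y. f' y \<partial>M)"
    if X: "\<And>n. X n \<noteq> 0" "X \<longlonglongrightarrow> 0" for X :: "nat \<Rightarrow> real"
  proof -
    have ev: "eventually (\<lambda>n. \<bar>X n\<bar> < r) sequentially"
      using tendstoD[OF X(2) r] by (simp add: dist_real_def)
    \<comment> \<open>Only finitely many terms of \<open>X\<close> leave the radius
      \<open>r\<close>. Replacing them by r/2 makes integrability and domination available for every
      index.\<close>
    define Y where "Y n = (if \<bar>X n\<bar> < r then X n else r / 2)" for n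
    have Y: "\<bar>Y n\<bar> < r" "Y n \<noteq> 0" for n using X(1)[of n] r by (auto simp: Y_def)
    have XY: "eventually (\<lambda>n. X n = Y n) sequentially"
      using ev by eventually_elim (simp add: Y_def)
    have Y0: "Y \<longlonglongrightarrow> 0" using X(2) XY by (rule Lim_transform_eventually)
    have "(\<lambda>n. \<integral>y. (f (Y n) y - f 0 y) / Y n \<partial>M) \<longlonglongrightarrow> (\<integral>y. f' y \<partial>M)"
    proof (rule integral_dominated_convergence[where w = w])
      show "(\<lambda>y. (f (Y n) y - f 0 y) / Y n) \<in> borel_measurable M" for n
        using f[OF Y(1)[of n]] f[of 0] r by (auto simp: integrable_iff_bounded)
      show "AE y in M. (\<lambda>n. (f (Y n) y - f 0 y) / Y n) \<longlonglongrightarrow> f' y"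
      proof (rule AE_I2)
        fix y assume "y \<in> space M"
        from der[OF this] have "((\<lambda>h. (f h y - f 0 y) / h) \<longlongrightarrow> f' y) (at 0)"
          by (simp add: DERIV_def)
        from this[unfolded tendsto_at_iff_sequentially, rule_format, of Y]
        show "(\<lambda>n. (f (Y n) y - f 0 y) / Y n) \<longlonglongrightarrow> f' y" using Y Y0 by (simp add: o_def)
      qed
      show "AE y in M. norm ((f (Y n) y - f 0 y) / Y n) \<le> w y" for n
        using bound[OF Y(1)[of n]] Y(2)[of n] by (auto intro!: AE_I2 simp: divide_simps mult.commute)
    qed (use f' w in auto)
    moreover have "(\<integral>y. (f (Y n) y - f 0 y) / Y n \<partial>M) = ((\<integral>y. f (Y n) y \<partial>M) - (\<integral>y. f 0 y \<partial>M)) / Y n" for n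
      using f[OF Y(1)[of n]] f[of 0] r by simp
    ultimately have "(\<lambda>n. ((\<integral>y. f (Y n) y \<partial>M) - (\<integral>y. f 0 y \<partial>M)) / Y n) \<longlonglongrightarrow> (\<integral>y. f' y \<partial>M)" by (simp only:)
    then show ?thesis
      by (rule Lim_transform_eventually) (use XY in \<open>eventually_elim, simp\<close>)
  qed
  then show ?thesis
    unfolding DERIV_def tendsto_at_iff_sequentially by (auto simp: o_def)
qed

lemma has_bochner_integral_of_has_integral:
  fixes f :: "'a::euclidean_space \<Rightarrow> real"
  assumes "f \<in> borel_measurable borel" "A \<in> sets borel" "\<And>x. x \<in> A \<Longrightarrow> 0 \<le> f x"
    and "(f has_integral I) A"
  shows "has_bochner_integral lborel (\<lambda>x. indicator A x * f x) I"
proof (rule has_bochner_integral_nn_integral)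
  show "(\<integral>\<^sup>+ x. ennreal (indicator A x * f x) \<partial>lborel) = ennreal I"
    using nn_integral_has_integral_lebesgue[OF assms(3,4)] by simp
  show "0 \<le> I" using has_integral_nonneg[OF assms(4,3)] .
qed (use assms in \<open>auto intro!: AE_I2 simp: indicator_def\<close>)

lemma has_bochner_integral_exp_neg:
  assumes a: "(a::real) > 0"
  shows "has_bochner_integral lborel (\<lambda>t. indicator {0<..} t * exp (- a * t)) (1 / a)"
proof -
  have "has_bochner_integral lborel (\<lambda>t. indicator {0..} t * exp (- a * t)) (1 / a)"
    by (rule has_bochner_integral_of_has_integral)
      (use has_integral_exp_minus_to_infinity[OF a, of 0] in auto)
  moreover have "AE t in lborel. indicator {0..} t * exp (- a * t) = indicator {0<..} t * exp (- a * t)"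
    using AE_lborel_singleton[of "0::real"] by eventually_elim (auto simp: indicator_def)
  ultimately show ?thesis
    by (subst has_bochner_integral_cong_AE[symmetric]) auto
qed

section \<open>Convolution on the half line\<close>

text \<open>Integrability is required on initial segments only, so that \<open>frac_kernel\<close>
  of every positive order qualifies. Vanishing for t <= 0 lets half-line integrals be written over
  the whole line.\<close>

definition causal_kernel :: "(real \<Rightarrow> real) \<Rightarrow> bool" where
  "causal_kernel \<phi> \<longleftrightarrow> \<phi> \<in> borel_measurable borel \<and> (\<forall>t\<le>0. \<phi> t = 0) \<and>
     (\<forall>L. integrable lborel (\<lambda>t. indicator {..L} t * \<phi> t))"

definition L1_kernel :: "(real \<Rightarrow> real) \<Rightarrow> bool" where
  "L1_kernel \<phi> \<longleftrightarrow> integrable lborel \<phi> \<and> (\<forall>t\<le>0. \<phi> t = 0)"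

text \<open>
  With \<open>q(t) = P\<^sub>t v\<close> for a semigroup \<open>P\<close>, \<open>smear \<phi> q 0\<close> is the mixture \<open>\<integral>\<phi>(s) P\<^sub>s v ds\<close>; on
  \<open>q(t) = exp (-\<lambda>t)\<close>, \<open>smear \<phi>\<close> is multiplication by the Laplace transform of \<open>\<phi>\<close> at \<open>\<lambda>\<close>.
\<close>

definition smear :: "(real \<Rightarrow> real) \<Rightarrow> (real \<Rightarrow> real) \<Rightarrow> real \<Rightarrow> real" where
  "smear \<phi> q t = (LBINT s. \<phi> s * q (t + s))"

definition conv :: "(real \<Rightarrow> real) \<Rightarrow> (real \<Rightarrow> real) \<Rightarrow> real \<Rightarrow> real" where
  "conv \<phi> \<psi> t = (LBINT s. \<phi> s * \<psi> (t - s))"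

text \<open>On functions vanishing far to the right, fractional integrals of every order converge.\<close>

definition right_cut :: "(real \<Rightarrow> real) \<Rightarrow> bool" where
  "right_cut q \<longleftrightarrow> q \<in> borel_measurable borel \<and> (\<exists>N. \<forall>t>N. q t = 0) \<and> (\<forall>A. \<exists>C. \<forall>t\<ge>A. \<bar>q t\<bar> \<le> C)"

lemma L1_imp_causal: "L1_kernel \<phi> \<Longrightarrow> causal_kernel \<phi>"
  unfolding L1_kernel_def causal_kernel_def
  using integrable_mult_indicator[of _ lborel \<phi>] by auto

lemma L1_kernel_measurable [measurable_dest]: "L1_kernel \<phi> \<Longrightarrow> \<phi> \<in> borel_measurable borel"
  by (auto simp: L1_kernel_def)

lemma causal_kernel_measurable [measurable_dest]: "causal_kernel \<phi> \<Longrightarrow> \<phi> \<in> borel_measurable borel"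
  by (auto simp: causal_kernel_def)

lemma right_cut_measurable [measurable_dest]: "right_cut q \<Longrightarrow> q \<in> borel_measurable borel"
  by (auto simp: right_cut_def)

lemma causal_kernel_cut: "causal_kernel \<phi> \<Longrightarrow> L1_kernel (\<lambda>t. indicator {..L} t * \<phi> t)"
  by (auto simp: L1_kernel_def causal_kernel_def)

lemma smear_measurable [measurable]:
  assumes [measurable]: "\<phi> \<in> borel_measurable borel" "q \<in> borel_measurable borel"
  shows "smear \<phi> q \<in> borel_measurable borel"
  unfolding smear_def by measurable

lemma conv_measurable [measurable]:
  assumes [measurable]: "\<phi> \<in> borel_measurable borel" "\<psi> \<in> borel_measurable borel"
  shows "conv \<phi> \<psi> \<in> borel_measurable borel"
  unfolding conv_def by measurable

lemma L1_kernel_smear_integrable: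
  assumes \<phi>: "L1_kernel \<phi>" and [measurable]: "q \<in> borel_measurable borel"
    and C: "\<And>s. s > 0 \<Longrightarrow> \<bar>q (t + s)\<bar> \<le> C"
  shows "integrable lborel (\<lambda>s. \<phi> s * q (t + s))"
proof (rule integrable_boundI)
  show "integrable lborel (\<lambda>s. C * \<phi> s)" using \<phi> by (simp add: L1_kernel_def)
  show "\<bar>\<phi> s * q (t + s)\<bar> \<le> \<bar>C * \<phi> s\<bar>" for s
  proof (cases "s > 0")
    case True
    from mult_left_mono[OF order_trans[OF C[OF this] abs_ge_self], of "\<bar>\<phi> s\<bar>"]
    show ?thesis by (simp add: abs_mult mult.commute)
  qed (use \<phi> in \<open>auto simp: L1_kernel_def\<close>)
qed (use \<phi> in measurable)

lemma L1_kernel_conv: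
  assumes \<phi>: "L1_kernel \<phi>" and \<psi>: "L1_kernel \<psi>"
  shows "L1_kernel (conv \<phi> \<psi>)"
proof -
  have "integrable lborel (conv \<phi> \<psi>)"
    using lborel_pair.integrable_fst[OF convolution_integrable_pair[of \<phi> \<psi>]] \<phi> \<psi>
    by (simp add: conv_def[abs_def] L1_kernel_def)
  moreover have "conv \<phi> \<psi> t = 0" if "t \<le> 0" for t
  proof -
    have "\<phi> s * \<psi> (t - s) = 0" for s
      using \<phi> \<psi> that by (cases "s > 0") (auto simp: L1_kernel_def)
    then show ?thesis by (simp only: conv_def Bochner_Integration.integral_zero)
  qed
  ultimately show ?thesis by (simp add: L1_kernel_def)
qed

text \<open>Time shifts add, so after translating the inner variable by s both sides are the same
  double integral. The kernels vanish on the negative axis, which keeps \<open>q\<close> at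
  arguments beyond t, where the bound C is available.\<close>

lemma smear_conv_L1:
  assumes \<phi>: "L1_kernel \<phi>" and \<psi>: "L1_kernel \<psi>" and [measurable]: "q \<in> borel_measurable borel"
    and C: "\<And>s. s > 0 \<Longrightarrow> \<bar>q (t + s)\<bar> \<le> C"
  shows "smear \<phi> (smear \<psi> q) t = smear (conv \<phi> \<psi>) q t"
proof -
  note [measurable] = L1_kernel_measurable[OF \<phi>] L1_kernel_measurable[OF \<psi>]
  have int: "integrable (lborel \<Otimes>\<^sub>M lborel) (\<lambda>(r, s). \<phi> s * \<psi> (r - s) * q (t + r))"
  proof (rule Bochner_Integration.integrable_bound)
    show "integrable (lborel \<Otimes>\<^sub>M lborel) (\<lambda>p. C * (case p of (r, s) \<Rightarrow> \<phi> s * \<psi> (r - s)))"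
      using convolution_integrable_pair[of \<phi> \<psi>] \<phi> \<psi> by (simp add: L1_kernel_def)
    have "\<bar>\<phi> s * \<psi> (r - s) * q (t + r)\<bar> \<le> \<bar>C * (\<phi> s * \<psi> (r - s))\<bar>" for r s
    proof (cases "s > 0 \<and> r - s > 0")
      case True
      then have "r > 0" by simp
      from mult_left_mono[OF order_trans[OF C[OF this] abs_ge_self], of "\<bar>\<phi> s * \<psi> (r - s)\<bar>"]
      show ?thesis by (simp add: abs_mult mult_ac)
    qed (use \<phi> \<psi> in \<open>auto simp: L1_kernel_def\<close>)
    then show "AE p in lborel \<Otimes>\<^sub>M lborel. norm (case p of (r, s) \<Rightarrow> \<phi> s * \<psi> (r - s) * q (t + r))
        \<le> norm (C * (case p of (r, s) \<Rightarrow> \<phi> s * \<psi> (r - s)))" by auto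
  qed measurable
  have "smear \<phi> (smear \<psi> q) t = (LBINT s. (LBINT r. \<phi> s * \<psi> (r - s) * q (t + r)))"
    unfolding smear_def
  proof (rule Bochner_Integration.integral_cong[OF refl])
    fix s
    have "(LBINT r. \<phi> s * \<psi> r * q (t + s + r)) = (LBINT r. \<phi> s * \<psi> (r + (- s)) * q (t + s + (r + (- s))))"
      by (rule lborel_integral_translate[of "\<lambda>r. \<phi> s * \<psi> r * q (t + s + r)", symmetric]) measurable
    then show "\<phi> s * (LBINT r. \<psi> r * q (t + s + r)) = (LBINT r. \<phi> s * \<psi> (r - s) * q (t + r))"
      by (simp add: mult.assoc)
  qed
  also have "\<dots> = (LBINT r. (LBINT s. \<phi> s * \<psi> (r - s) * q (t + r)))"
    by (rule lborel_pair.Fubini_integral[OF int])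
  also have "\<dots> = smear (conv \<phi> \<psi>) q t"
    by (simp add: smear_def conv_def)
  finally show ?thesis .
qed

text \<open>Past s = N - t the argument t + s has left the support of \<open>q\<close>. Results on
  integrable kernels pass to causal ones in this way.\<close>

lemma smear_cut:
  assumes \<phi>: "causal_kernel \<phi>" and N: "\<forall>s>N. q s = 0" and L: "N - t \<le> L"
  shows "smear \<phi> q t = smear (\<lambda>s. indicator {..L} s * \<phi> s) q t"
  unfolding smear_def
  by (rule Bochner_Integration.integral_cong) (use N L in \<open>auto simp: indicator_def\<close>)

lemma right_cut_smear:
  assumes \<phi>: "causal_kernel \<phi>" and q: "right_cut q"
  shows "right_cut (smear \<phi> q)"
proof -
  note [measurable] = causal_kernel_measurable[OF \<phi>] right_cut_measurable[OF q]
  obtain N where N: "\<forall>t>N. q t = 0" using q by (auto simp: right_cut_def)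
  have "smear \<phi> q t = 0" if "t > N" for t
  proof -
    have "\<phi> s * q (t + s) = 0" for s
      using \<phi> N that by (cases "s > 0") (auto simp: causal_kernel_def)
    then show ?thesis by (simp only: smear_def Bochner_Integration.integral_zero)
  qed
  moreover have "\<exists>C. \<forall>t\<ge>A. \<bar>smear \<phi> q t\<bar> \<le> C" for A
  proof -
    obtain C where C: "\<forall>t\<ge>A. \<bar>q t\<bar> \<le> C" using q unfolding right_cut_def by blast
    define \<psi> where "\<psi> = (\<lambda>s. indicator {..N - A} s * \<phi> s)"
    have \<psi>: "L1_kernel \<psi>" unfolding \<psi>_def by (rule causal_kernel_cut[OF \<phi>])
    have "\<bar>smear \<phi> q t\<bar> \<le> (LBINT s. C * \<bar>\<psi> s\<bar>)" if t: "t \<ge> A" for t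
    proof -
      have "smear \<phi> q t = smear \<psi> q t"
        unfolding \<psi>_def by (rule smear_cut[OF \<phi> N]) (use t in simp)
      also have "\<bar>smear \<psi> q t\<bar> \<le> (LBINT s. \<bar>\<psi> s * q (t + s)\<bar>)"
        unfolding smear_def by (rule integral_abs_bound)
      also have "\<dots> \<le> (LBINT s. C * \<bar>\<psi> s\<bar>)"
      proof (rule integral_mono)
        show "integrable lborel (\<lambda>s. \<bar>\<psi> s * q (t + s)\<bar>)"
          using L1_kernel_smear_integrable[OF \<psi>, of q t C] C t by auto
        show "integrable lborel (\<lambda>s. C * \<bar>\<psi> s\<bar>)" using \<psi> by (simp add: L1_kernel_def)
        show "\<bar>\<psi> s * q (t + s)\<bar> \<le> C * \<bar>\<psi> s\<bar>" for s
        proof (cases "s > 0")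
          case True
          then have "\<bar>q (t + s)\<bar> \<le> C" using C t by simp
          from mult_left_mono[OF this abs_ge_zero[of "\<psi> s"]] show ?thesis
            by (simp add: abs_mult mult.commute)
        qed (use \<psi> in \<open>auto simp: L1_kernel_def\<close>)
      qed
      finally show ?thesis .
    qed
    then show ?thesis by blast
  qed
  ultimately show ?thesis by (auto simp: right_cut_def intro!: exI[of _ N])
qed

lemma smear_integrable:
  assumes \<phi>: "causal_kernel \<phi>" and q: "right_cut q"
  shows "integrable lborel (\<lambda>s. \<phi> s * q (t + s))"
proof -
  obtain N where N: "\<forall>t>N. q t = 0" using q by (auto simp: right_cut_def)
  obtain C where C: "\<forall>s\<ge>t. \<bar>q s\<bar> \<le> C" using q unfolding right_cut_def by blast
  have "integrable lborel (\<lambda>s. (indicator {..N - t} s * \<phi> s) * q (t + s))"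
    by (rule L1_kernel_smear_integrable[OF causal_kernel_cut[OF \<phi>], where C = C])
      (use q C in \<open>auto simp: right_cut_def\<close>)
  also have "(\<lambda>s. (indicator {..N - t} s * \<phi> s) * q (t + s)) = (\<lambda>s. \<phi> s * q (t + s))"
    using N by (auto simp: indicator_def fun_eq_iff)
  finally show ?thesis .
qed

lemma conv_cut:
  assumes \<phi>: "causal_kernel \<phi>" and \<psi>: "causal_kernel \<psi>" and "r \<le> L"
  shows "conv \<phi> \<psi> r = conv (\<lambda>s. indicator {..L} s * \<phi> s) (\<lambda>s. indicator {..L} s * \<psi> s) r"
  unfolding conv_def
proof (rule Bochner_Integration.integral_cong[OF refl])
  fix s
  show "\<phi> s * \<psi> (r - s) = (indicator {..L} s * \<phi> s) * (indicator {..L} (r - s) * \<psi> (r - s))"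
    using \<phi> \<psi> \<open>r \<le> L\<close> by (cases "s > 0 \<and> r - s > 0") (auto simp: causal_kernel_def indicator_def)
qed

lemma causal_kernel_conv:
  assumes \<phi>: "causal_kernel \<phi>" and \<psi>: "causal_kernel \<psi>"
  shows "causal_kernel (conv \<phi> \<psi>)"
proof -
  note [measurable] = causal_kernel_measurable[OF \<phi>] causal_kernel_measurable[OF \<psi>]
  have *: "L1_kernel (conv (\<lambda>s. indicator {..L} s * \<phi> s) (\<lambda>s. indicator {..L} s * \<psi> s))" for L
    by (intro L1_kernel_conv causal_kernel_cut \<phi> \<psi>)
  have "integrable lborel (\<lambda>t. indicator {..L} t * conv \<phi> \<psi> t)" for L
  proof -
    have "integrable lborel (\<lambda>t. indicator {..L} t *\<^sub>R
        conv (\<lambda>s. indicator {..L} s * \<phi> s) (\<lambda>s. indicator {..L} s * \<psi> s) t)"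
      by (rule integrable_mult_indicator) (use *[of L] in \<open>auto simp: L1_kernel_def\<close>)
    also have "(\<lambda>t. indicator {..L} t *\<^sub>R
        conv (\<lambda>s. indicator {..L} s * \<phi> s) (\<lambda>s. indicator {..L} s * \<psi> s) t) =
        (\<lambda>t. indicator {..L} t * conv \<phi> \<psi> t)"
      using conv_cut[OF \<phi> \<psi>, of _ L] by (auto simp: indicator_def fun_eq_iff)
    finally show ?thesis .
  qed
  moreover have "conv \<phi> \<psi> t = 0" if "t \<le> 0" for t
    using *[of 0] that by (subst conv_cut[OF \<phi> \<psi>, of t 0]) (auto simp: L1_kernel_def)
  ultimately show ?thesis by (simp add: causal_kernel_def)
qed

lemma smear_smear:
  assumes \<phi>: "causal_kernel \<phi>" and \<psi>: "causal_kernel \<psi>" and q: "right_cut q"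
  shows "smear \<phi> (smear \<psi> q) = smear (conv \<phi> \<psi>) q"
proof
  fix t
  obtain N where N: "\<forall>t>N. q t = 0" using q by (auto simp: right_cut_def)
  obtain C where C: "\<forall>s\<ge>t. \<bar>q s\<bar> \<le> C" using q unfolding right_cut_def by blast
  \<comment> \<open>One truncation length covers every occurrence: for s >= t the kernel is seen
    only up to N - s, which is at most L.\<close>
  define L where "L = N - t"
  let ?\<phi> = "\<lambda>s. indicator {..L} s * \<phi> s" and ?\<psi> = "\<lambda>s. indicator {..L} s * \<psi> s"
  have \<psi>q: "smear \<psi> q s = smear ?\<psi> q s" if "s \<ge> t" for s
    by (rule smear_cut[OF \<psi> N]) (use that in \<open>simp add: L_def\<close>)
  have "\<forall>s>N. smear \<psi> q s = 0"
  proof (intro allI impI)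
    fix s assume "s > N"
    then have "\<psi> r * q (s + r) = 0" for r
      using \<psi> N by (cases "r > 0") (auto simp: causal_kernel_def)
    then show "smear \<psi> q s = 0" by (simp only: smear_def Bochner_Integration.integral_zero)
  qed
  then have "smear \<phi> (smear \<psi> q) t = smear ?\<phi> (smear \<psi> q) t"
    by (rule smear_cut[OF \<phi>]) (simp add: L_def)
  also have "\<dots> = smear ?\<phi> (smear ?\<psi> q) t"
    unfolding smear_def[of ?\<phi>]
  proof (rule Bochner_Integration.integral_cong[OF refl])
    fix s
    show "?\<phi> s * smear \<psi> q (t + s) = ?\<phi> s * smear ?\<psi> q (t + s)"
      using \<phi> \<psi>q[of "t + s"] by (cases "s > 0") (auto simp: causal_kernel_def)
  qed
  also have "\<dots> = smear (conv ?\<phi> ?\<psi>) q t"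
    by (rule smear_conv_L1[OF causal_kernel_cut[OF \<phi>] causal_kernel_cut[OF \<psi>], where C = C])
      (use q C in \<open>auto simp: right_cut_def\<close>)
  also have "\<dots> = smear (conv \<phi> \<psi>) q t"
    unfolding smear_def
  proof (rule Bochner_Integration.integral_cong[OF refl])
    fix r
    show "conv ?\<phi> ?\<psi> r * q (t + r) = conv \<phi> \<psi> r * q (t + r)"
      using conv_cut[OF \<phi> \<psi>, of r L] N by (cases "r \<le> L") (auto simp: L_def)
  qed
  finally show "smear \<phi> (smear \<psi> q) t = smear (conv \<phi> \<psi>) q t" .
qed

section \<open>Splitting fractional integrals into integrable kernels\<close>

text \<open>The Riemann-Liouville kernel: smearing with it is the fractional integral of order
  \<open>a\<close> over the half line to the right of t.\<close>

definition frac_kernel :: "real \<Rightarrow> real \<Rightarrow> real" where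
  "frac_kernel a t = (if t > 0 then t powr (a - 1) / Gamma a else 0)"

definition exp_kernel :: "real \<Rightarrow> real" where
  "exp_kernel t = (if t > 0 then exp (- t) else 0)"

lemma frac_kernel_measurable [measurable]: "frac_kernel a \<in> borel_measurable borel"
  unfolding frac_kernel_def[abs_def] by measurable

lemma exp_kernel_measurable [measurable]: "exp_kernel \<in> borel_measurable borel"
  unfolding exp_kernel_def[abs_def] by measurable

lemma frac_kernel_nonneg: "a > 0 \<Longrightarrow> 0 \<le> frac_kernel a t"
  by (simp add: frac_kernel_def Gamma_real_pos less_imp_le)

lemma has_bochner_integral_exp_kernel: "has_bochner_integral lborel exp_kernel 1"
proof -
  have "exp_kernel = (\<lambda>t. indicator {0<..} t * exp (- 1 * t))"
    by (auto simp: exp_kernel_def fun_eq_iff)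
  then show ?thesis using has_bochner_integral_exp_neg[of 1] by simp
qed

lemma L1_exp_kernel: "L1_kernel exp_kernel"
  using has_bochner_integral_exp_kernel
  by (auto simp: L1_kernel_def exp_kernel_def has_bochner_integral_iff)

lemma has_bochner_integral_frac_kernel:
  assumes a: "a > 0" and L: "L \<ge> 0"
  shows "has_bochner_integral lborel (\<lambda>t. indicator {..L} t * frac_kernel a t) (L powr a / a / Gamma a)"
proof -
  have "has_bochner_integral lborel (\<lambda>t. indicator {0..L} t * t powr (a - 1)) (L powr a / a)"
    by (rule has_bochner_integral_of_has_integral)
      (use has_integral_powr_from_0[of "a - 1" L] a L in auto)
  then have "has_bochner_integral lborel (\<lambda>t. (indicator {0..L} t * t powr (a - 1)) / Gamma a) (L powr a / a / Gamma a)"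
    by (rule has_bochner_integral_divide_zero)
  also have "(\<lambda>t. (indicator {0..L} t * t powr (a - 1)) / Gamma a) = (\<lambda>t. indicator {..L} t * frac_kernel a t)"
    by (auto simp: frac_kernel_def indicator_def fun_eq_iff)
  finally show ?thesis .
qed

lemma causal_frac_kernel:
  assumes a: "a > 0"
  shows "causal_kernel (frac_kernel a)"
proof -
  have "integrable lborel (\<lambda>t. indicator {..L} t * frac_kernel a t)" for L
  proof (cases "L \<ge> 0")
    case True
    then show ?thesis using has_bochner_integral_frac_kernel[OF a] by (auto simp: has_bochner_integral_iff)
  next
    case False
    then have "(\<lambda>t. indicator {..L} t * frac_kernel a t) = (\<lambda>t. 0)"
      by (auto simp: frac_kernel_def indicator_def fun_eq_iff)
    then show ?thesis by simp
  qed
  then show ?thesis by (auto simp: causal_kernel_def frac_kernel_def)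
qed

text \<open>The substitution s = t x turns the convolution into Euler's Beta integral; the Gamma
  factors in the kernels are chosen to cancel Beta (a, b).\<close>

lemma conv_frac_kernel:
  assumes a: "a > 0" and b: "b > 0"
  shows "conv (frac_kernel a) (frac_kernel b) = frac_kernel (a + b)"
proof
  fix t :: real
  show "conv (frac_kernel a) (frac_kernel b) t = frac_kernel (a + b) t"
  proof (cases "t > 0")
    case False
    then show ?thesis
      using causal_kernel_conv[OF causal_frac_kernel[OF a] causal_frac_kernel[OF b]]
      by (auto simp: causal_kernel_def frac_kernel_def)
  next
    case t: True
    let ?c = "t powr (a - 1) * t powr (b - 1) / (Gamma a * Gamma b)"
    have "has_bochner_integral lborel
        (\<lambda>x. indicator {0..1} x * (x powr (a - 1) * (1 - x) powr (b - 1))) (Beta a b)"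
      by (rule has_bochner_integral_of_has_integral) (use has_integral_Beta_real[OF a b] in auto)
    then have B: "(LBINT x. indicator {0..1} x * (x powr (a - 1) * (1 - x) powr (b - 1))) = Beta a b"
      by (simp add: has_bochner_integral_iff)
    have "conv (frac_kernel a) (frac_kernel b) t =
        t * (LBINT x. frac_kernel a (t * x) * frac_kernel b (t - t * x))"
      unfolding conv_def using t by (subst lborel_integral_real_affine[where c = t and t = 0]) auto
    also have "(\<lambda>x. frac_kernel a (t * x) * frac_kernel b (t - t * x)) =
        (\<lambda>x. ?c * (indicator {0..1} x * (x powr (a - 1) * (1 - x) powr (b - 1))))"
    proof
      fix x :: real
      have tx: "t - t * x = t * (1 - x)" by (simp add: algebra_simps)
      \<comment> \<open>At x = 0 and x = 1 both sides vanish, because \<open>0 powr y\<close> is 0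
        and the kernels are 0 at 0; so the closed interval of the Beta integral fits.\<close>
      consider "x \<le> 0" | "0 < x" "x < 1" | "x \<ge> 1" by linarith
      then show "frac_kernel a (t * x) * frac_kernel b (t - t * x) =
          ?c * (indicator {0..1} x * (x powr (a - 1) * (1 - x) powr (b - 1)))"
      proof cases
        case 1
        then show ?thesis using t by (cases "x = 0") (auto simp: frac_kernel_def zero_less_mult_iff)
      next
        case 2
        then show ?thesis using t unfolding tx by (simp add: frac_kernel_def powr_mult)
      next
        case 3
        then show ?thesis using t unfolding tx by (cases "x = 1") (auto simp: frac_kernel_def zero_less_mult_iff)
      qed
    qed
    also have "(LBINT x. ?c * (indicator {0..1} x * (x powr (a - 1) * (1 - x) powr (b - 1)))) = ?c * Beta a b"
      using B by simp
    also have "t * (?c * Beta a b) = frac_kernel (a + b) t"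
    proof -
      have "t * (t powr (a - 1) * t powr (b - 1)) = t powr 1 * t powr (a - 1) * t powr (b - 1)"
        using t by simp
      also have "\<dots> = t powr (a + b - 1)" unfolding powr_add[symmetric] by (simp add: algebra_simps)
      finally have *: "t * (t powr (a - 1) * t powr (b - 1)) = t powr (a + b - 1)" .
      have "Gamma a \<noteq> 0" "Gamma b \<noteq> 0" using Gamma_real_pos[OF a] Gamma_real_pos[OF b] by auto
      then show ?thesis using t *
        by (simp add: frac_kernel_def Beta_def)
    qed
    finally show ?thesis .
  qed
qed

text \<open>On the Laplace side \<lambda>^(-a) - \<lambda>^(-a) / (1 + \<lambda>) = \<lambda>^(1-a)
  / (1 + \<lambda>). For a <= 1 this has no singularity at \<lambda> = 0, which is why the kernel
  can be integrable although \<open>frac_kernel a\<close> is not.\<close>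

definition damped_kernel :: "real \<Rightarrow> real \<Rightarrow> real" where
  "damped_kernel a t = frac_kernel a t - conv exp_kernel (frac_kernel a) t"

text \<open>At a = 1 the symbol is 1 / (1 + \<lambda>). In the time variable the convolution is the
  integral of exp (-s) over [0, t], that is 1 - exp (-t).\<close>

lemma damped_kernel_1: "damped_kernel 1 = exp_kernel"
proof
  fix t :: real
  show "damped_kernel 1 t = exp_kernel t"
  proof (cases "t > 0")
    case False
    then show ?thesis
      using causal_kernel_conv[OF L1_imp_causal[OF L1_exp_kernel] causal_frac_kernel[of 1]]
      by (auto simp: causal_kernel_def frac_kernel_def damped_kernel_def exp_kernel_def)
  next
    case t: True
    have "((\<lambda>s. exp (- s)) has_integral (- exp (- t)) - (- exp (- 0))) {0..t}"
      by (rule fundamental_theorem_of_calculus)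
        (use t in \<open>auto intro!: derivative_eq_intros simp: has_real_derivative_iff_has_vector_derivative[symmetric]\<close>)
    then have "has_bochner_integral lborel (\<lambda>s. indicator {0..t} s * exp (- s)) (1 - exp (- t))"
      by (intro has_bochner_integral_of_has_integral) auto
    \<comment> \<open>At s = 0 and s = t the right side is 0, since both kernels vanish at 0; the
      equality therefore holds only off these two points.\<close>
    moreover have "AE s in lborel. indicator {0..t} s * exp (- s) = exp_kernel s * frac_kernel 1 (t - s)"
      using AE_lborel_singleton[of "0::real"] AE_lborel_singleton[of t]
      by eventually_elim (auto simp: exp_kernel_def frac_kernel_def indicator_def)
    ultimately have "has_bochner_integral lborel (\<lambda>s. exp_kernel s * frac_kernel 1 (t - s)) (1 - exp (- t))"
      by (subst has_bochner_integral_cong_AE[symmetric]) auto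
    then show ?thesis using t
      by (simp add: damped_kernel_def conv_def has_bochner_integral_iff frac_kernel_def exp_kernel_def)
  qed
qed

text \<open>For a <= 1 the kernel decreases on the positive axis, so beyond s the absolute
  difference is \<open>frac_kernel a (t - s) - frac_kernel a t\<close>. Integrated up to a bound L
  this telescopes to a difference of masses that is at most 0. Only the initial segment [0, s]
  contributes, with twice its mass.\<close>

lemma frac_kernel_translation_integrable:
  assumes a: "0 < a" "a \<le> 1" and s: "s > 0"
  shows "integrable lborel (\<lambda>t. frac_kernel a t - frac_kernel a (t - s))"
    and "(LBINT t. \<bar>frac_kernel a t - frac_kernel a (t - s)\<bar>) \<le> 2 * (s powr a / a / Gamma a)"
proof -
  let ?k = "frac_kernel a" and ?I = "\<lambda>L. LBINT t. indicator {..L} t * frac_kernel a t"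
  let ?h = "\<lambda>t. \<bar>?k t - ?k (t - s)\<bar>"
  have int: "integrable lborel (\<lambda>t. indicator {..L} t * ?k t)" for L
    using causal_frac_kernel[OF a(1)] by (simp add: causal_kernel_def)
  have shift: "integrable lborel (\<lambda>t. indicator {..L} t * ?k (t - s))"
      "(LBINT t. indicator {..L} t * ?k (t - s)) = ?I (L - s)" for L
  proof -
    have eq: "(\<lambda>t. indicator {..L - s} (t + (- s)) * ?k (t + (- s))) = (\<lambda>t. indicator {..L} t * ?k (t - s))"
      by (auto simp: indicator_def fun_eq_iff)
    show "integrable lborel (\<lambda>t. indicator {..L} t * ?k (t - s))"
      using lborel_integrable_translate_iff[of "\<lambda>t. indicator {..L - s} t * ?k t" "- s"] int[of "L - s"]
      unfolding eq by simp
    show "(LBINT t. indicator {..L} t * ?k (t - s)) = ?I (L - s)"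
      using lborel_integral_translate[of "\<lambda>t. indicator {..L - s} t * ?k t" "- s"]
      unfolding eq by simp
  qed
  have mono: "?I L \<le> ?I L'" if "L \<le> L'" for L L'
    by (rule integral_mono[OF int int])
      (use that frac_kernel_nonneg[OF a(1)] in \<open>auto simp: indicator_def\<close>)
  \<comment> \<open>The last summand corrects the sign on t <= s, where the translate is 0 and the
    absolute difference is \<open>?k t\<close> itself.\<close>
  have pw: "?h t \<le> ?k (t - s) - ?k t + 2 * (indicator {..s} t * ?k t)" for t
  proof (cases "t > s")
    case True
    have "?k t \<le> ?k (t - s)"
      using True s a Gamma_real_pos[OF a(1)]
      by (auto simp: frac_kernel_def intro!: divide_right_mono powr_mono2')
    then show ?thesis using True by simp
  next
    case False
    then show ?thesis using frac_kernel_nonneg[OF a(1), of t] by (auto simp: frac_kernel_def)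
  qed
  \<comment> \<open>The two kernels are not integrable separately. Up to n the integral of their
    difference may be split; the resulting bound is free of n, and monotone convergence removes the
    truncation.\<close>
  define H where "H n t = indicator {..real n} t * ?h t" for n :: nat and t
  have Hint: "integrable lborel (H n)" for n
  proof -
    have "integrable lborel (\<lambda>t. \<bar>indicator {..real n} t * ?k t - indicator {..real n} t * ?k (t - s)\<bar>)"
      using int[of n] shift(1)[of n] by simp
    also have "(\<lambda>t. \<bar>indicator {..real n} t * ?k t - indicator {..real n} t * ?k (t - s)\<bar>) = H n"
      by (auto simp: H_def indicator_def fun_eq_iff)
    finally show ?thesis .
  qed
  have Hle: "integral\<^sup>L lborel (H n) \<le> 2 * ?I s" for n
  proof -
    have int2: "integrable lborel (\<lambda>t. indicator {..real n} t * ?k (t - s) - indicator {..real n} t * ?k t + 2 * (indicator {..s} t * ?k t))"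
      using int[of n] int[of s] shift(1)[of n] by simp
    have "integral\<^sup>L lborel (H n) \<le> (LBINT t. indicator {..real n} t * ?k (t - s) - indicator {..real n} t * ?k t + 2 * (indicator {..s} t * ?k t))"
      by (rule integral_mono[OF Hint int2])
        (use pw frac_kernel_nonneg[OF a(1)] in \<open>auto simp: H_def indicator_def\<close>)
    also have "\<dots> = ?I (n - s) - ?I n + 2 * ?I s"
      using int[of n] int[of s] shift[of n] by simp
    also have "\<dots> \<le> 2 * ?I s" using mono[of "n - s" n] s by simp
    finally show ?thesis .
  qed
  have "incseq (\<lambda>n. integral\<^sup>L lborel (H n))"
    unfolding incseq_def
    by (intro allI impI integral_mono[OF Hint Hint]) (auto simp: H_def indicator_def)
  then obtain I where I: "(\<lambda>n. integral\<^sup>L lborel (H n)) \<longlonglongrightarrow> I"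
    using incseq_convergent[of "\<lambda>n. integral\<^sup>L lborel (H n)" "2 * ?I s"] Hle by blast
  have lim: "(\<lambda>n. H n t) \<longlonglongrightarrow> ?h t" for t
  proof (rule tendsto_eventually)
    obtain m :: nat where "t \<le> real m" using real_arch_simple by blast
    then show "\<forall>\<^sub>F n in sequentially. H n t = ?h t"
      by (intro eventually_sequentiallyI[of m]) (auto simp: H_def indicator_def)
  qed
  have inc: "mono (\<lambda>n. H n t)" for t
    by (auto simp: mono_def H_def indicator_def)
  have hb: "integrable lborel ?h" "integral\<^sup>L lborel ?h = I"
    using integrable_monotone_convergence[OF Hint _ _ I, of ?h]
      integral_monotone_convergence[OF Hint _ _ I, of ?h] lim inc by auto
  show "integrable lborel (\<lambda>t. ?k t - ?k (t - s))"
    by (rule Bochner_Integration.integrable_bound[OF hb(1)]) auto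
  have "I \<le> 2 * ?I s" by (rule LIMSEQ_le_const2[OF I]) (use Hle in auto)
  then show "integral\<^sup>L lborel ?h \<le> 2 * (s powr a / a / Gamma a)"
    using hb(2) has_bochner_integral_frac_kernel[OF a(1), of s] s by (simp add: has_bochner_integral_iff)
qed

text \<open>
  Since \<^const>\<open>exp_kernel\<close> has mass 1, \<^const>\<open>damped_kernel\<close> is an average of differences of a
  decreasing function and its translates.
\<close>

lemma L1_damped_kernel:
  assumes a: "0 < a" "a \<le> 1"
  shows "L1_kernel (damped_kernel a)"
proof -
  let ?k = "frac_kernel a"
  let ?F = "\<lambda>(s, t). exp_kernel s * (?k t - ?k (t - s))"
  define c where "c = 4 / (a * Gamma a)"
  have c: "c \<ge> 0" using a Gamma_real_pos[OF a(1)] by (simp add: c_def)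
  have bound: "(LBINT t. norm (?F (s, t))) \<le> c * (indicator {0<..} s * exp (- (1/2) * s))" for s
  proof (cases "s > 0")
    case s: True
    \<comment> \<open>Half of the decay of exp (-s) pays for the growth s^a <= 1 + s <= 2 exp (s/2),
      leaving exp (-s/2). This 2 and the 2 of the translation bound make the 4 in
      \<open>c\<close>.\<close>
    have "s powr a \<le> 1 + s"
    proof (cases "s \<le> 1")
      case True
      then have "s powr a \<le> 1" using s a by (intro powr_le1) auto
      then show ?thesis using s by simp
    next
      case False
      then have "s powr a \<le> s powr 1" using a by (intro powr_mono) auto
      then show ?thesis using s by simp
    qed
    also have "1 + s \<le> 2 * exp (s / 2)" using exp_ge_add_one_self[of "s / 2"] by linarith
    finally have p: "s powr a \<le> 2 * exp (s / 2)" .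
    have "(LBINT t. norm (?F (s, t))) = exp (- s) * (LBINT t. \<bar>?k t - ?k (t - s)\<bar>)"
      using s by (simp add: abs_mult exp_kernel_def)
    also have "\<dots> \<le> exp (- s) * (2 * (2 * exp (s / 2) / a / Gamma a))"
      using frac_kernel_translation_integrable(2)[OF a s] p a Gamma_real_pos[OF a(1)]
      by (intro mult_left_mono order_trans[OF frac_kernel_translation_integrable(2)[OF a s]] divide_right_mono) auto
    also have "\<dots> = c * (exp (- s) * exp (s / 2))" by (simp add: c_def)
    also have "exp (- s) * exp (s / 2) = exp (- (1/2) * s)" by (simp add: exp_add[symmetric])
    finally show ?thesis using s by simp
  qed (simp add: exp_kernel_def)
  have int: "integrable (lborel \<Otimes>\<^sub>M lborel) ?F"
  proof (rule lborel_pair.Fubini_integrable)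
    show "integrable lborel (\<lambda>s. LBINT t. norm (?F (s, t)))"
    proof (rule Bochner_Integration.integrable_bound)
      show "integrable lborel (\<lambda>s::real. c * (indicator {0<..} s * exp (- (1/2) * s)))"
        using has_bochner_integral_exp_neg[of "1/2"] by (auto simp: has_bochner_integral_iff)
      have "norm (LBINT t. norm (?F (s, t))) \<le> norm (c * (indicator {0<..} s * exp (- (1/2) * s)))" for s
      proof -
        have "0 \<le> (LBINT t. norm (?F (s, t)))" by (rule integral_nonneg_AE) simp
        then show ?thesis using bound[of s] by simp
      qed
      then show "AE s in lborel. norm (LBINT t. norm (?F (s, t))) \<le> norm (c * (indicator {0<..} s * exp (- (1/2) * s)))"
        by simp
    qed measurable
    show "AE s in lborel. integrable lborel (\<lambda>t. ?F (s, t))"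
    proof (rule AE_I2)
      fix s show "integrable lborel (\<lambda>t. ?F (s, t))"
        using frac_kernel_translation_integrable(1)[OF a, of s] by (cases "s > 0") (auto simp: exp_kernel_def)
    qed
  qed measurable
  have "integrable lborel (\<lambda>t. LBINT s. exp_kernel s * (?k t - ?k (t - s)))"
    by (rule lborel_pair.integrable_snd) (use int in simp)
  moreover have "AE t in lborel. (LBINT s. exp_kernel s * (?k t - ?k (t - s))) = damped_kernel a t"
    using lborel_pair.AE_integrable_snd[OF int]
  proof eventually_elim
    case (elim t)
    have e: "integrable lborel (\<lambda>s. exp_kernel s * ?k t)" "(LBINT s. exp_kernel s * ?k t) = ?k t"
      using has_bochner_integral_exp_kernel by (auto simp: has_bochner_integral_iff)
    have i: "integrable lborel (\<lambda>s. exp_kernel s * ?k t - exp_kernel s * (?k t - ?k (t - s)))"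
      using e(1) elim by (intro Bochner_Integration.integrable_diff) auto
    have "conv exp_kernel ?k t = (LBINT s. exp_kernel s * ?k t - exp_kernel s * (?k t - ?k (t - s)))"
      unfolding conv_def by (simp add: algebra_simps)
    also have "\<dots> = ?k t - (LBINT s. exp_kernel s * (?k t - ?k (t - s)))"
      using e elim by (subst Bochner_Integration.integral_diff) auto
    finally show ?case by (simp add: damped_kernel_def)
  qed
  ultimately have "integrable lborel (damped_kernel a)"
    by (subst integrable_cong_AE[symmetric]) (auto simp: damped_kernel_def[abs_def])
  moreover have "\<forall>t\<le>0. damped_kernel a t = 0"
    using causal_kernel_conv[OF L1_imp_causal[OF L1_exp_kernel] causal_frac_kernel[OF a(1)]]
    by (auto simp: damped_kernel_def frac_kernel_def causal_kernel_def)
  ultimately show ?thesis by (simp add: L1_kernel_def)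
qed

section \<open>Operational calculus of resolvents and fractional integrals\<close>

lemma right_cut_add:
  assumes q: "right_cut q" and r: "right_cut r"
  shows "right_cut (\<lambda>t. q t + r t)"
proof -
  obtain N N' where N: "\<forall>t>N. q t = 0" "\<forall>t>N'. r t = 0" using q r unfolding right_cut_def by blast
  have "\<exists>C. \<forall>t\<ge>A. \<bar>q t + r t\<bar> \<le> C" for A
  proof -
    obtain C C' where "\<forall>t\<ge>A. \<bar>q t\<bar> \<le> C" "\<forall>t\<ge>A. \<bar>r t\<bar> \<le> C'" using q r unfolding right_cut_def by blast
    then have "\<forall>t\<ge>A. \<bar>q t + r t\<bar> \<le> C + C'" by (meson abs_triangle_ineq add_mono order_trans)
    then show ?thesis by blast
  qed
  moreover have "\<forall>t>max N N'. q t + r t = 0" using N by simp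
  moreover have "(\<lambda>t. q t + r t) \<in> borel_measurable borel"
    using q r by (auto simp: right_cut_def)
  ultimately show ?thesis unfolding right_cut_def by meson
qed

lemma right_cut_uminus: "right_cut q \<Longrightarrow> right_cut (\<lambda>t. - q t)"
  by (auto simp: right_cut_def)

lemma right_cut_diff: "right_cut q \<Longrightarrow> right_cut r \<Longrightarrow> right_cut (\<lambda>t. q t - r t)"
  using right_cut_add[OF _ right_cut_uminus, of q r] by simp

text \<open>
  As functions of the Laplace variable \<open>\<lambda>\<close>: \<open>res\<close> is \<open>r = 1/(1+\<lambda>)\<close>, \<open>cores\<close> is \<open>1 - r = \<lambda>r\<close>, and \<open>frac_int a\<close>
  is \<open>\<lambda>\<close> to the power \<open>-a\<close>.
\<close>

definition res :: "(real \<Rightarrow> real) \<Rightarrow> real \<Rightarrow> real" where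
  "res q = smear exp_kernel q"

definition cores :: "(real \<Rightarrow> real) \<Rightarrow> real \<Rightarrow> real" where
  "cores q t = q t - res q t"

definition frac_int :: "real \<Rightarrow> (real \<Rightarrow> real) \<Rightarrow> real \<Rightarrow> real" where
  "frac_int a q = smear (frac_kernel a) q"

lemma right_cut_res: "right_cut q \<Longrightarrow> right_cut (res q)"
  unfolding res_def by (rule right_cut_smear[OF L1_imp_causal[OF L1_exp_kernel]])

lemma right_cut_cores: "right_cut q \<Longrightarrow> right_cut (cores q)"
  unfolding cores_def[abs_def] by (intro right_cut_diff right_cut_res)

lemma right_cut_frac_int: "0 < a \<Longrightarrow> right_cut q \<Longrightarrow> right_cut (frac_int a q)"
  unfolding frac_int_def by (intro right_cut_smear causal_frac_kernel)

lemma smear_add: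
  assumes "causal_kernel \<phi>" "right_cut q" "right_cut r"
  shows "smear \<phi> (\<lambda>t. q t + r t) = (\<lambda>t. smear \<phi> q t + smear \<phi> r t)"
  using smear_integrable[OF assms(1,2)] smear_integrable[OF assms(1,3)]
  by (simp add: smear_def distrib_left fun_eq_iff)

lemma smear_diff:
  assumes "causal_kernel \<phi>" "right_cut q" "right_cut r"
  shows "smear \<phi> (\<lambda>t. q t - r t) = (\<lambda>t. smear \<phi> q t - smear \<phi> r t)"
  using smear_integrable[OF assms(1,2)] smear_integrable[OF assms(1,3)]
  by (simp add: smear_def right_diff_distrib fun_eq_iff)

lemma smear_kernel_diff:
  assumes "causal_kernel \<phi>" "causal_kernel \<psi>" "right_cut q"
  shows "smear (\<lambda>t. \<phi> t - \<psi> t) q = (\<lambda>t. smear \<phi> q t - smear \<psi> q t)"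
  using smear_integrable[OF assms(1,3)] smear_integrable[OF assms(2,3)]
  by (simp add: smear_def left_diff_distrib fun_eq_iff)

lemma smear_kernel_add:
  assumes "causal_kernel \<phi>" "causal_kernel \<psi>" "right_cut q"
  shows "smear (\<lambda>t. \<phi> t + \<psi> t) q = (\<lambda>t. smear \<phi> q t + smear \<psi> q t)"
  using smear_integrable[OF assms(1,3)] smear_integrable[OF assms(2,3)]
  by (simp add: smear_def distrib_right fun_eq_iff)

lemmas causal_exp_kernel = L1_imp_causal[OF L1_exp_kernel]

lemma frac_int_frac_int:
  "0 < a \<Longrightarrow> 0 < b \<Longrightarrow> right_cut q \<Longrightarrow> frac_int a (frac_int b q) = frac_int (a + b) q"
  unfolding frac_int_def by (subst smear_smear) (auto simp: causal_frac_kernel conv_frac_kernel)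

lemma cores_frac_int:
  assumes "0 < a" "right_cut q"
  shows "cores (frac_int a q) = smear (damped_kernel a) q"
proof -
  note k = causal_frac_kernel[OF assms(1)]
  show ?thesis
    unfolding cores_def[abs_def] frac_int_def res_def damped_kernel_def[abs_def]
      smear_smear[OF causal_exp_kernel k assms(2)]
    by (rule smear_kernel_diff[OF k causal_kernel_conv[OF causal_exp_kernel k] assms(2), symmetric])
qed

lemma cores_frac_int_1: "right_cut q \<Longrightarrow> cores (frac_int 1 q) = res q"
  by (simp add: cores_frac_int damped_kernel_1 res_def)

lemma res_diff:
  "right_cut q \<Longrightarrow> right_cut r \<Longrightarrow> res (\<lambda>t. q t - r t) = (\<lambda>t. res q t - res r t)"
  unfolding res_def by (rule smear_diff[OF causal_exp_kernel])

lemma res_cores: "right_cut q \<Longrightarrow> res (cores q) = cores (res q)"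
  unfolding cores_def[abs_def] using smear_diff[OF causal_exp_kernel _ right_cut_res, of q q]
  by (simp add: res_def fun_eq_iff)

lemma right_cut_funpow: "(\<And>q. right_cut q \<Longrightarrow> right_cut (T q)) \<Longrightarrow> right_cut q \<Longrightarrow> right_cut ((T ^^ n) q)"
  by (induction n) auto

lemma right_cut_res_pow: "right_cut q \<Longrightarrow> right_cut ((res ^^ n) q)"
  by (rule right_cut_funpow[OF right_cut_res])

lemma res_pow_cores: "right_cut q \<Longrightarrow> (res ^^ n) (cores q) = cores ((res ^^ n) q)"
  by (induction n) (auto simp: res_cores right_cut_funpow right_cut_res)

text \<open>Each \<open>cores\<close> cancels one \<open>frac_int 1\<close> and leaves one
  \<open>res\<close>: on symbols (\<lambda> r)^n \<lambda>^(-n) = r^n.\<close>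

lemma cores_pow_frac_int_1:
  "right_cut q \<Longrightarrow> (cores ^^ n) ((frac_int 1 ^^ n) q) = (res ^^ n) q"
proof (induction n arbitrary: q)
  case (Suc n)
  have 1: "right_cut (frac_int 1 q)" using Suc.prems by (simp add: right_cut_frac_int)
  have "(cores ^^ Suc n) ((frac_int 1 ^^ Suc n) q) = cores ((cores ^^ n) ((frac_int 1 ^^ n) (frac_int 1 q)))"
    by (simp add: funpow_swap1)
  also have "\<dots> = cores ((res ^^ n) (frac_int 1 q))" using Suc.IH[OF 1] by simp
  also have "\<dots> = (res ^^ n) (res q)"
    using Suc.prems by (simp add: res_pow_cores[OF 1, symmetric] cores_frac_int_1)
  finally show ?case by (simp add: funpow_swap1)
qed simp

lemma frac_int_1_pow:
  "0 < a \<Longrightarrow> right_cut q \<Longrightarrow> (frac_int 1 ^^ n) (frac_int a q) = frac_int (real n + a) q"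
  by (induction n) (auto simp: frac_int_frac_int add.assoc)

lemma frac_int_1_pow': "right_cut q \<Longrightarrow> (frac_int 1 ^^ Suc n) q = frac_int (real (Suc n)) q"
  using frac_int_1_pow[of 1 q n] by (simp add: funpow_swap1 add.commute)

text \<open>Passing from kernels to operators hides the convolutions: the splitting can be carried
  out as polynomial algebra in r, and the kernels are recovered by existence at the end. Agreement
  is asked on \<open>right_cut\<close> functions only, since there all the fractional integrals
  involved converge.\<close>

definition L1_op :: "((real \<Rightarrow> real) \<Rightarrow> real \<Rightarrow> real) \<Rightarrow> bool" where
  "L1_op T \<longleftrightarrow> (\<exists>\<phi>. L1_kernel \<phi> \<and> (\<forall>q. right_cut q \<longrightarrow> T q = smear \<phi> q))"

lemma L1_opI: "L1_kernel \<phi> \<Longrightarrow> (\<And>q. right_cut q \<Longrightarrow> T q = smear \<phi> q) \<Longrightarrow> L1_op T"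
  unfolding L1_op_def by blast

lemma L1_op_cong:
  assumes "L1_op T" "\<And>q. right_cut q \<Longrightarrow> S q = T q"
  shows "L1_op S"
  using assms unfolding L1_op_def by metis

lemma L1_op_right_cut: "L1_op T \<Longrightarrow> right_cut q \<Longrightarrow> right_cut (T q)"
  unfolding L1_op_def using right_cut_smear[OF L1_imp_causal] by metis

lemma L1_op_res: "L1_op res"
  unfolding L1_op_def res_def using L1_exp_kernel by blast

lemma L1_op_comp:
  assumes "L1_op T" "L1_op S"
  shows "L1_op (\<lambda>q. T (S q))"
proof -
  obtain \<phi> \<psi> where \<phi>: "L1_kernel \<phi>" "\<And>q. right_cut q \<Longrightarrow> T q = smear \<phi> q"
    and \<psi>: "L1_kernel \<psi>" "\<And>q. right_cut q \<Longrightarrow> S q = smear \<psi> q"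
    using assms unfolding L1_op_def by blast
  have "T (S q) = smear (conv \<phi> \<psi>) q" if q: "right_cut q" for q
    using smear_smear[OF L1_imp_causal[OF \<phi>(1)] L1_imp_causal[OF \<psi>(1)] q]
      \<phi>(2)[OF L1_op_right_cut[OF assms(2) q]] \<psi>(2)[OF q] by simp
  then show ?thesis unfolding L1_op_def using L1_kernel_conv[OF \<phi>(1) \<psi>(1)] by blast
qed

lemma
  assumes "L1_op T" "L1_op S"
  shows L1_op_add: "L1_op (\<lambda>q t. T q t + S q t)" and L1_op_diff: "L1_op (\<lambda>q t. T q t - S q t)"
proof -
  obtain \<phi> \<psi> where \<phi>: "L1_kernel \<phi>" "\<And>q. right_cut q \<Longrightarrow> T q = smear \<phi> q"
    and \<psi>: "L1_kernel \<psi>" "\<And>q. right_cut q \<Longrightarrow> S q = smear \<psi> q"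
    using assms unfolding L1_op_def by blast
  have L: "L1_kernel (\<lambda>t. \<phi> t + \<psi> t)" "L1_kernel (\<lambda>t. \<phi> t - \<psi> t)"
    using \<phi>(1) \<psi>(1) by (auto simp: L1_kernel_def)
  show "L1_op (\<lambda>q t. T q t + S q t)"
    by (rule L1_opI[OF L(1)])
      (simp add: \<phi>(2) \<psi>(2) smear_kernel_add[OF L1_imp_causal[OF \<phi>(1)] L1_imp_causal[OF \<psi>(1)]])
  show "L1_op (\<lambda>q t. T q t - S q t)"
    by (rule L1_opI[OF L(2)])
      (simp add: \<phi>(2) \<psi>(2) smear_kernel_diff[OF L1_imp_causal[OF \<phi>(1)] L1_imp_causal[OF \<psi>(1)]])
qed

lemma L1_op_zero: "L1_op (\<lambda>q t. 0)"
  unfolding L1_op_def by (rule exI[of _ "\<lambda>t. 0"]) (simp add: L1_kernel_def smear_def fun_eq_iff)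

lemma L1_op_cores_comp: "L1_op T \<Longrightarrow> L1_op (\<lambda>q. cores (T q))"
  unfolding cores_def[abs_def] by (rule L1_op_diff[OF _ L1_op_comp[OF L1_op_res]])

lemma L1_op_res_pow_comp: "L1_op T \<Longrightarrow> L1_op (\<lambda>q. (res ^^ n) (T q))"
  by (induction n) (auto intro: L1_op_comp[OF L1_op_res])

lemma L1_op_cores_pow_comp: "L1_op T \<Longrightarrow> L1_op (\<lambda>q. (cores ^^ n) (T q))"
  by (induction n) (auto intro: L1_op_cores_comp)

lemma L1_op_res_pow: "0 < n \<Longrightarrow> L1_op (res ^^ n)"
  using L1_op_res_pow_comp[OF L1_op_res, of "n - 1"] by (cases n) (auto simp: funpow_swap1 o_def)

lemma L1_op_cores_frac_int:
  assumes "0 < a" "a \<le> 1"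
  shows "L1_op (\<lambda>q. cores (frac_int a q))"
  unfolding L1_op_def using L1_damped_kernel[OF assms] cores_frac_int[OF assms(1)] by blast

text \<open>\<open>C\<close> has the symbol \<lambda>^b r^M with M = floor b + 1, a derivative of
  order b damped enough at high frequencies to have an integrable kernel. It is the product of
  (\<lambda> r)^m and \<lambda> r \<lambda>^(-s) with s = m + 1 - b; the last factor is
  \<open>damped_kernel s\<close>.\<close>

lemma L1_op_riesz_derivative:
  assumes "0 < b"
  obtains M C where "0 < M" "L1_op C" "\<And>q. right_cut q \<Longrightarrow> C (frac_int b q) = (res ^^ M) q"
proof
  define m where "m = nat \<lfloor>b\<rfloor>"
  define s where "s = real (Suc m) - b"
  have s: "0 < s" "s \<le> 1" using assms unfolding s_def m_def by linarith+
  define C where "C q = (cores ^^ m) (cores (frac_int s q))" for q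
  show "L1_op C" unfolding C_def[abs_def]
    by (rule L1_op_cores_pow_comp[OF L1_op_cores_frac_int[OF s]])
  show "0 < Suc m" by simp
  show "C (frac_int b q) = (res ^^ Suc m) q" if q: "right_cut q" for q
  proof -
    have "C (frac_int b q) = (cores ^^ Suc m) (frac_int (real (Suc m)) q)"
      using frac_int_frac_int[OF s(1) assms q] by (simp add: C_def s_def funpow_swap1)
    then show ?thesis
      using cores_pow_frac_int_1[OF q, of "Suc m"] frac_int_1_pow'[OF q] by simp
  qed
qed

text \<open>Enough factors \<lambda> cancel the singularity of \<lambda>^(-b) at 0: with s = b - m
  one has (\<lambda> r)^(m+1) \<lambda>^(-b) = r^m (\<lambda> r \<lambda>^(-s)), and the bracket is
  \<open>damped_kernel s\<close>.\<close>

lemma L1_op_cores_pow_frac_int: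
  assumes "0 < b"
  obtains m where "L1_op (\<lambda>q. (cores ^^ m) (frac_int b q))"
proof
  \<comment> \<open>Rounding up and subtracting 1 keeps s in (0, 1]; for integer b it gives s = 1,
    where rounding down would give 0.\<close>
  define m where "m = nat \<lceil>b\<rceil> - 1"
  define s where "s = b - real m"
  have s: "0 < s" "s \<le> 1" using assms unfolding s_def m_def by linarith+
  have L: "L1_op (\<lambda>q. (res ^^ m) (cores (frac_int s q)))"
    by (rule L1_op_res_pow_comp[OF L1_op_cores_frac_int[OF s]])
  have eq: "(cores ^^ Suc m) (frac_int b q) = (res ^^ m) (cores (frac_int s q))" if q: "right_cut q" for q
  proof -
    have r: "right_cut (frac_int s q)" using right_cut_frac_int[OF s(1) q] .
    have "frac_int b q = (frac_int 1 ^^ m) (frac_int s q)"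
      by (simp add: frac_int_1_pow[OF s(1) q]) (simp add: s_def)
    then show ?thesis
      using cores_pow_frac_int_1[OF r, of m] res_pow_cores[OF r] by simp
  qed
  show "L1_op (\<lambda>q. (cores ^^ Suc m) (frac_int b q))"
    by (rule L1_op_cong[OF L eq])
qed

text \<open>The geometric sum 1 + r + ... + r^(n-1), that is, the quotient of 1 - r^n by 1 -
  r.\<close>

fun geom_res :: "nat \<Rightarrow> (real \<Rightarrow> real) \<Rightarrow> real \<Rightarrow> real" where
  "geom_res 0 q = (\<lambda>t. 0)"
| "geom_res (Suc n) q = (\<lambda>t. geom_res n q t + (res ^^ n) q t)"

lemma right_cut_geom_res: "right_cut q \<Longrightarrow> right_cut (geom_res n q)"
proof (induction n)
  case 0
  show ?case by (auto simp: right_cut_def)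
qed (simp add: right_cut_add right_cut_funpow right_cut_res)

lemma geom_res_cores: "right_cut q \<Longrightarrow> geom_res n (cores q) = (\<lambda>t. q t - (res ^^ n) q t)"
  by (induction n) (auto simp: fun_eq_iff res_pow_cores cores_def)

lemma cores_geom_res: "right_cut q \<Longrightarrow> cores (geom_res n q) = geom_res n (cores q)"
proof (induction n)
  case 0
  then show ?case by (simp add: cores_def res_def smear_def fun_eq_iff)
next
  case (Suc n)
  have "res (\<lambda>t. geom_res n q t + (res ^^ n) q t) = (\<lambda>t. res (geom_res n q) t + res ((res ^^ n) q) t)"
    unfolding res_def[of "\<lambda>t. geom_res n q t + (res ^^ n) q t"] res_def[of "geom_res n q"]
      res_def[of "(res ^^ n) q"]
    by (rule smear_add[OF causal_exp_kernel])
      (use Suc.prems in \<open>auto intro: right_cut_geom_res right_cut_funpow right_cut_res\<close>)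
  then have "cores (geom_res (Suc n) q) = (\<lambda>t. cores (geom_res n q) t + cores ((res ^^ n) q) t)"
    by (simp add: cores_def[abs_def] fun_eq_iff)
  then show ?case
    using Suc by (simp add: res_pow_cores)
qed

lemma L1_op_geom_res_comp: "L1_op T \<Longrightarrow> L1_op (\<lambda>q. geom_res n (T q))"
  by (induction n) (auto intro: L1_op_zero L1_op_add L1_op_res_pow_comp)

text \<open>
  In terms of \<open>r = 1/(1+\<lambda>)\<close> one takes \<open>b = 1 - (1 - r\<^sup>M)\<^sup>m\<close>: a large \<open>M\<close> compensates the growth of
  \<open>c = \<lambda>\<^sup>\<beta> b\<close> at infinity, a large \<open>m\<close> the singularity of \<open>k = (1 - b)/\<lambda>\<^sup>\<beta>\<close> at 0.
\<close>

lemma riesz_splitting_cut: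
  assumes "0 < \<beta>"
  obtains b c k where "L1_kernel b" "L1_kernel c" "L1_kernel k"
    "\<And>q. right_cut q \<Longrightarrow> frac_int \<beta> q = (\<lambda>t. smear b (frac_int \<beta> q) t + smear k q t)"
    "\<And>q. right_cut q \<Longrightarrow> smear b q = smear c (frac_int \<beta> q)"
proof -
  obtain M C where M: "0 < M" and C: "L1_op C" and CM: "\<And>q. right_cut q \<Longrightarrow> C (frac_int \<beta> q) = (res ^^ M) q"
    using L1_op_riesz_derivative[OF assms] by blast
  obtain m where m: "L1_op (\<lambda>q. (cores ^^ m) (frac_int \<beta> q))"
    using L1_op_cores_pow_frac_int[OF assms] by blast
  \<comment> \<open>The symbol is 1 - r^M, so \<open>b\<close> will be one minus the m-th power of
    \<open>F\<close>.\<close>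
  define F where "F q = (\<lambda>t. q t - (res ^^ M) q t)" for q
  have Frc: "right_cut (F q)" if "right_cut q" for q
    unfolding F_def using that by (intro right_cut_diff right_cut_funpow right_cut_res)
  have F_eq: "F q = geom_res M (cores q)" if "right_cut q" for q
    unfolding F_def using geom_res_cores[OF that] by simp
  have cores_pow_geom: "(cores ^^ j) (geom_res M q) = geom_res M ((cores ^^ j) q)" if "right_cut q" for j q
    by (induction j) (auto simp: cores_geom_res right_cut_funpow right_cut_cores that)
  \<comment> \<open>Factoring 1 - r out of 1 - r^M exhibits \<open>cores ^^ m\<close> inside
    \<open>F ^^ m\<close>. This makes \<open>(F ^^ m) (frac_int \<beta> q)\<close> a smear of
    \<open>q\<close> with an integrable kernel.\<close>
  have F_pow: "right_cut q \<Longrightarrow> (F ^^ j) q = (geom_res M ^^ j) ((cores ^^ j) q)" for j q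
  proof (induction j)
    case (Suc j)
    have geom_pow: "cores ((geom_res M ^^ i) r) = (geom_res M ^^ i) (cores r)" if "right_cut r" for i r
      by (induction i) (auto simp: cores_geom_res right_cut_funpow right_cut_geom_res that)
    have "(F ^^ Suc j) q = F ((geom_res M ^^ j) ((cores ^^ j) q))" using Suc by simp
    also have "\<dots> = geom_res M (cores ((geom_res M ^^ j) ((cores ^^ j) q)))"
      by (rule F_eq) (use Suc.prems in \<open>intro right_cut_funpow right_cut_geom_res right_cut_cores\<close>)
    also have "\<dots> = (geom_res M ^^ Suc j) ((cores ^^ Suc j) q)"
      using Suc.prems by (simp add: geom_pow right_cut_funpow right_cut_cores)
    finally show ?case .
  qed simp
  have geom_pow_L1: "L1_op T \<Longrightarrow> L1_op (\<lambda>q. (geom_res M ^^ j) (T q))" for j T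
    by (induction j) (auto intro: L1_op_geom_res_comp)
  have K: "L1_op (\<lambda>q. (F ^^ m) (frac_int \<beta> q))"
  proof -
    show ?thesis
      by (rule L1_op_cong[OF geom_pow_L1[OF m]]) (rule F_pow[OF right_cut_frac_int[OF assms]])
  qed
  have "\<exists>B C'. L1_op B \<and> L1_op C' \<and> (\<forall>q. right_cut q \<longrightarrow> (\<forall>t. q t = B q t + (F ^^ j) q t) \<and> B q = C' (frac_int \<beta> q))" for j
  proof (induction j)
    case 0
    show ?case
      by (rule exI[of _ "\<lambda>q t. 0"], rule exI[of _ "\<lambda>q t. 0"]) (simp add: L1_op_zero)
  next
    case (Suc j)
    then obtain B C' where B: "L1_op B" and C': "L1_op C'"
      and eq: "\<And>q t. right_cut q \<Longrightarrow> q t = B q t + (F ^^ j) q t" "\<And>q. right_cut q \<Longrightarrow> B q = C' (frac_int \<beta> q)"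
      by blast
    \<comment> \<open>The complement of F^j obeys B_(j+1) = B_j + r^M (1 - B_j). All its terms carry
      a factor r^M, which \<open>C\<close> expresses through \<open>frac_int \<beta>\<close>; hence
      the companion operator satisfies the same recursion with \<open>C\<close> in place of r^M
      alone.\<close>
    let ?B = "\<lambda>q t. (B q t + (res ^^ M) q t) - (res ^^ M) (B q) t"
    let ?C = "\<lambda>q t. (C' q t + C q t) - (res ^^ M) (C' q) t"
    have 1: "L1_op ?B" "L1_op ?C"
      by (intro L1_op_diff L1_op_add B C C' L1_op_res_pow[OF M] L1_op_res_pow_comp)+
    have "q t = ?B q t + (F ^^ Suc j) q t" if q: "right_cut q" for q t
    proof -
      have res_pow_diff: "(res ^^ i) (\<lambda>t. r t - p t) = (\<lambda>t. (res ^^ i) r t - (res ^^ i) p t)"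
        if "right_cut r" "right_cut p" for i r p
      proof (induction i)
        case (Suc i)
        then show ?case by (simp add: res_diff right_cut_res_pow that)
      qed simp
      have "(F ^^ j) q = (\<lambda>t. q t - B q t)" using eq(1)[OF q] by (auto simp: fun_eq_iff)
      then have "(F ^^ Suc j) q t = q t - B q t - ((res ^^ M) q t - (res ^^ M) (B q) t)"
        by (simp add: F_def res_pow_diff[OF q L1_op_right_cut[OF B q]])
      then show ?thesis by simp
    qed
    moreover have "?B q = ?C (frac_int \<beta> q)" if "right_cut q" for q
      using eq(2)[OF that] CM[OF that] by simp
    ultimately show ?case using 1 by blast
  qed
  then obtain B C' where B: "L1_op B" and C': "L1_op C'"
    and eq: "\<And>q t. right_cut q \<Longrightarrow> q t = B q t + (F ^^ m) q t" "\<And>q. right_cut q \<Longrightarrow> B q = C' (frac_int \<beta> q)"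
    by blast
  obtain b where b: "L1_kernel b" "\<And>q. right_cut q \<Longrightarrow> B q = smear b q" using B unfolding L1_op_def by blast
  obtain c where c: "L1_kernel c" "\<And>q. right_cut q \<Longrightarrow> C' q = smear c q" using C' unfolding L1_op_def by blast
  obtain k where k: "L1_kernel k" "\<And>q. right_cut q \<Longrightarrow> (F ^^ m) (frac_int \<beta> q) = smear k q"
    using K unfolding L1_op_def by blast
  show ?thesis
  proof (rule that[OF b(1) c(1) k(1)])
    fix q assume q: "right_cut q"
    note r = right_cut_frac_int[OF assms q]
    show "frac_int \<beta> q = (\<lambda>t. smear b (frac_int \<beta> q) t + smear k q t)"
      using eq(1)[OF r] b(2)[OF r] k(2)[OF q] by (auto simp: fun_eq_iff)
    show "smear b q = smear c (frac_int \<beta> q)"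
      using eq(2)[OF q] b(2)[OF q] c(2)[OF r] by simp
  qed
qed

text \<open>
  The proof of \<open>riesz_splitting_cut\<close> uses fractional integrals of order larger than \<open>\<beta>\<close>, which may
  diverge for the functions \<open>q\<close> considered here; hence the truncation.
\<close>

lemma riesz_splitting:
  assumes \<beta>: "0 < \<beta>"
  obtains b c k where "L1_kernel b" "L1_kernel c" "L1_kernel k"
    "\<And>q w C. q \<in> borel_measurable borel \<Longrightarrow> antimono_on {0<..} w \<Longrightarrow> (\<And>t. t > 0 \<Longrightarrow> \<bar>q t\<bar> \<le> w t) \<Longrightarrow>
       w \<in> borel_measurable borel \<Longrightarrow> (\<And>t. 0 < t \<Longrightarrow> w t \<le> C) \<Longrightarrow>
       integrable lborel (\<lambda>t. frac_kernel \<beta> t * w t) \<Longrightarrow>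
       frac_int \<beta> q 0 = smear b (frac_int \<beta> q) 0 + smear k q 0 \<and>
       smear b q 0 = smear c (frac_int \<beta> q) 0"
proof -
  obtain b c k where b: "L1_kernel b" and c: "L1_kernel c" and k: "L1_kernel k"
    and eq: "\<And>q. right_cut q \<Longrightarrow> frac_int \<beta> q = (\<lambda>t. smear b (frac_int \<beta> q) t + smear k q t)"
    "\<And>q. right_cut q \<Longrightarrow> smear b q = smear c (frac_int \<beta> q)"
    using riesz_splitting_cut[OF \<beta>] by blast
  show ?thesis
  proof (rule that[OF b c k])
    fix q w :: "real \<Rightarrow> real" and C :: real
    assume [measurable]: "q \<in> borel_measurable borel" "w \<in> borel_measurable borel"
      and w: "antimono_on {0<..} w"
      and qw: "\<And>t. t > 0 \<Longrightarrow> \<bar>q t\<bar> \<le> w t" and wC: "\<And>t. 0 < t \<Longrightarrow> w t \<le> C"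
      and int: "integrable lborel (\<lambda>t. frac_kernel \<beta> t * w t)"
    define p where "p n t = indicator {0<..real n} t * q t" for n :: nat and t
    have [measurable]: "p n \<in> borel_measurable borel" for n unfolding p_def[abs_def] by measurable
    have p: "right_cut (p n)" for n
    proof -
      have "\<bar>p n t\<bar> \<le> \<bar>C\<bar>" for t
        using order_trans[OF qw wC, of t] by (cases "t > 0") (auto simp: p_def indicator_def)
      moreover have "\<forall>t>real n. p n t = 0" by (simp add: p_def)
      ultimately show ?thesis unfolding right_cut_def by (intro conjI) (measurable, blast+)
    qed
    have lim_p: "(\<lambda>n. p n t) \<longlonglongrightarrow> q t" if "t > 0" for t
    proof (rule tendsto_eventually)
      obtain m :: nat where "t \<le> real m" using real_arch_simple by blast
      then show "\<forall>\<^sub>F n in sequentially. p n t = q t"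
        using that by (intro eventually_sequentiallyI[of m]) (auto simp: p_def indicator_def)
    qed
    have pq: "\<bar>p n t\<bar> \<le> w t" if "t > 0" for n t
      using qw[OF that] order_trans[OF abs_ge_zero qw[OF that]] by (auto simp: p_def indicator_def)
    \<comment> \<open>Monotonicity of \<open>w\<close> makes its values at s dominate all translates
      by t >= 0. One integrable majorant then serves every t and n, which yields the uniform bound
      \<open>J\<close> needed to pass to the limit under the outer smear.\<close>
    have wmono: "w (t + s) \<le> w s" if "t \<ge> 0" "s > 0" for t s
      using w that by (auto simp: monotone_on_def)
    have wpos: "0 \<le> w t" if "t > 0" for t using qw[OF that] by linarith
    have dom: "\<bar>frac_kernel \<beta> s * p n (t + s)\<bar> \<le> frac_kernel \<beta> s * w s" if "t \<ge> 0" for n t s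
    proof (cases "s > 0")
      case True
      have "\<bar>p n (t + s)\<bar> \<le> w s" using pq[of "t + s" n] wmono[OF that True] that True by simp
      then show ?thesis using frac_kernel_nonneg[OF \<beta>, of s] by (simp add: abs_mult mult_left_mono)
    qed (simp add: frac_kernel_def)
    have lim_J: "(\<lambda>n. frac_int \<beta> (p n) t) \<longlonglongrightarrow> frac_int \<beta> q t" if t: "t \<ge> 0" for t
      unfolding frac_int_def smear_def
    proof (rule integral_dominated_convergence[OF _ _ int])
      show "AE s in lborel. (\<lambda>n. frac_kernel \<beta> s * p n (t + s)) \<longlonglongrightarrow> frac_kernel \<beta> s * q (t + s)"
      proof (rule AE_I2)
        fix s show "(\<lambda>n. frac_kernel \<beta> s * p n (t + s)) \<longlonglongrightarrow> frac_kernel \<beta> s * q (t + s)"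
        proof (cases "s > 0")
          case True
          show ?thesis by (intro tendsto_intros lim_p) (use t True in simp)
        qed (simp add: frac_kernel_def)
      qed
      show "AE s in lborel. norm (frac_kernel \<beta> s * p n (t + s)) \<le> frac_kernel \<beta> s * w s" for n
        using dom[OF t] by simp
    qed measurable
    define J where "J = (LBINT s. frac_kernel \<beta> s * w s)"
    have J: "\<bar>frac_int \<beta> (p n) t\<bar> \<le> J" if t: "t \<ge> 0" for n t
    proof -
      have "\<bar>frac_int \<beta> (p n) t\<bar> \<le> (LBINT s. \<bar>frac_kernel \<beta> s * p n (t + s)\<bar>)"
        unfolding frac_int_def smear_def by (rule integral_abs_bound)
      also have "\<dots> \<le> J" unfolding J_def
      proof (rule integral_mono[OF _ int])
        show "integrable lborel (\<lambda>s. \<bar>frac_kernel \<beta> s * p n (t + s)\<bar>)"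
          by (rule Bochner_Integration.integrable_bound[OF int])
            (use order_trans[OF dom[OF t] abs_ge_self] in auto)
      qed (use dom[OF t] in auto)
      finally show ?thesis .
    qed
    have lim_smear: "(\<lambda>n. smear \<phi> (r n) 0) \<longlonglongrightarrow> smear \<phi> r' 0"
      if \<phi>: "L1_kernel \<phi>" and [measurable]: "\<And>n. r n \<in> borel_measurable borel" "r' \<in> borel_measurable borel"
        and lim: "\<And>t. t > 0 \<Longrightarrow> (\<lambda>n. r n t) \<longlonglongrightarrow> r' t" and D: "\<And>n t. t > 0 \<Longrightarrow> \<bar>r n t\<bar> \<le> D" for \<phi> r r' D
      unfolding smear_def
    proof (rule integral_dominated_convergence[where w = "\<lambda>s. \<bar>\<phi> s\<bar> * D"])
      note [measurable] = L1_kernel_measurable[OF \<phi>]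
      show "(\<lambda>s. \<phi> s * r n (0 + s)) \<in> borel_measurable lborel" for n by measurable
      show "(\<lambda>s. \<phi> s * r' (0 + s)) \<in> borel_measurable lborel" by measurable
      show "integrable lborel (\<lambda>s. \<bar>\<phi> s\<bar> * D)" using \<phi> by (simp add: L1_kernel_def)
      show "AE s in lborel. (\<lambda>n. \<phi> s * r n (0 + s)) \<longlonglongrightarrow> \<phi> s * r' (0 + s)"
      proof (rule AE_I2)
        fix s show "(\<lambda>n. \<phi> s * r n (0 + s)) \<longlonglongrightarrow> \<phi> s * r' (0 + s)"
        proof (cases "s > 0")
          case True
          show ?thesis by (intro tendsto_intros lim) (use True in simp)
        qed (use \<phi> in \<open>simp add: L1_kernel_def\<close>)
      qed
      show "AE s in lborel. norm (\<phi> s * r n (0 + s)) \<le> \<bar>\<phi> s\<bar> * D" for n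
      proof (rule AE_I2)
        fix s show "norm (\<phi> s * r n (0 + s)) \<le> \<bar>\<phi> s\<bar> * D"
          using \<phi> D[of s n] by (cases "s > 0") (auto simp: L1_kernel_def abs_mult intro: mult_left_mono)
      qed
    qed
    have [measurable]: "frac_int \<beta> r \<in> borel_measurable borel" if [measurable]: "r \<in> borel_measurable borel" for r
      unfolding frac_int_def by measurable
    have pC: "\<bar>p n t\<bar> \<le> C" if "t > 0" for n t
      using order_trans[OF pq wC] that by blast
    have l1: "(\<lambda>n. smear b (frac_int \<beta> (p n)) 0) \<longlonglongrightarrow> smear b (frac_int \<beta> q) 0"
      and l2: "(\<lambda>n. smear c (frac_int \<beta> (p n)) 0) \<longlonglongrightarrow> smear c (frac_int \<beta> q) 0"
      by (rule lim_smear[OF b _ _ lim_J J] lim_smear[OF c _ _ lim_J J]; simp)+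
    have l3: "(\<lambda>n. smear k (p n) 0) \<longlonglongrightarrow> smear k q 0" and l4: "(\<lambda>n. smear b (p n) 0) \<longlonglongrightarrow> smear b q 0"
      by (rule lim_smear[OF k _ _ lim_p pC] lim_smear[OF b _ _ lim_p pC]; simp)+
    have "(\<lambda>n. frac_int \<beta> (p n) 0) \<longlonglongrightarrow> smear b (frac_int \<beta> q) 0 + smear k q 0"
      using tendsto_add[OF l1 l3] eq(1)[OF p, THEN fun_cong, of _ 0] by simp
    then have 1: "frac_int \<beta> q 0 = smear b (frac_int \<beta> q) 0 + smear k q 0"
      using LIMSEQ_unique[OF lim_J[of 0]] by simp
    have "smear b q 0 = smear c (frac_int \<beta> q) 0"
      using l2 LIMSEQ_unique[OF l4] eq(2)[OF p] by simp
    with 1 show "frac_int \<beta> q 0 = smear b (frac_int \<beta> q) 0 + smear k q 0 \<and>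
       smear b q 0 = smear c (frac_int \<beta> q) 0" by blast
  qed
qed

section \<open>The heat kernel\<close>

text \<open>With the normalising constant left as an integral, total mass 1 of the heat kernel is a
  matter of scaling; the value (4 pi)^(n/2) is never computed.\<close>

definition gauss_mass :: "'a::euclidean_space itself \<Rightarrow> real" where
  "gauss_mass _ = integral\<^sup>L lborel (\<lambda>z::'a. exp (- (norm z)\<^sup>2 / 4))"

definition heat :: "real \<Rightarrow> 'a::euclidean_space \<Rightarrow> real" where
  "heat t z = (if t > 0 then t powr (- (real DIM('a) / 2)) * exp (- (norm z)\<^sup>2 / (4 * t)) / gauss_mass TYPE('a) else 0)"

lemma gaussian_integrable:
  assumes c: "(c::real) > 0"
  shows "integrable lborel (\<lambda>z::'a::euclidean_space. exp (- c * (norm z)\<^sup>2))"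
proof -
  \<comment> \<open>The standard deviation whose normal density is a multiple of exp (-c
    x^2).\<close>
  define \<sigma> where "\<sigma> = sqrt (1 / (2 * c))"
  have \<sigma>: "\<sigma> > 0" "2 * \<sigma>\<^sup>2 = 1 / c" using c by (auto simp: \<sigma>_def field_simps)
  have "integrable lborel (\<lambda>x. sqrt (2 * pi * \<sigma>\<^sup>2) * normal_density 0 \<sigma> x)"
    using \<sigma> by (intro integrable_mult_right integrable_normal_density) auto
  also have "(\<lambda>x. sqrt (2 * pi * \<sigma>\<^sup>2) * normal_density 0 \<sigma> x) = (\<lambda>x. exp (- c * x\<^sup>2))"
    using \<sigma> c by (auto simp: normal_density_def fun_eq_iff)
  finally have 1: "integrable lborel (\<lambda>x::real. exp (- c * x\<^sup>2))" .
  have eq: "exp (- c * (norm z)\<^sup>2) = (\<Prod>b\<in>Basis. exp (- c * (z \<bullet> b)\<^sup>2))" for z :: 'a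
  proof -
    have "(norm z)\<^sup>2 = (\<Sum>b\<in>Basis. (z \<bullet> b)\<^sup>2)"
      by (subst power2_norm_eq_inner, subst euclidean_inner, simp add: power2_eq_square)
    then show ?thesis by (simp only: sum_distrib_left exp_sum[OF finite_Basis, symmetric])
  qed
  have "(\<integral>\<^sup>+(z::'a). ennreal (exp (- c * (norm z)\<^sup>2)) \<partial>lborel) = (\<integral>\<^sup>+(z::'a). (\<Prod>b\<in>Basis. ennreal (exp (- c * (z \<bullet> b)\<^sup>2))) \<partial>lborel)"
    unfolding eq by (simp add: prod_ennreal)
  also have "\<dots> = (\<Prod>b\<in>(Basis::'a set). \<integral>\<^sup>+x. ennreal (exp (- c * x\<^sup>2)) \<partial>lborel)"
    by (rule nn_integral_lborel_prod) auto
  also have "\<dots> < \<infinity>"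
    using 1 by (auto simp: integrable_iff_bounded power_less_top_ennreal)
  finally show ?thesis
    by (intro integrableI_bounded) auto
qed

lemma gauss_mass_pos: "gauss_mass TYPE('a::euclidean_space) > 0"
proof -
  have int: "integrable lborel (\<lambda>z::'a. exp (- (norm z)\<^sup>2 / 4))"
    using gaussian_integrable[of "1/4", where 'a = 'a] by simp
  have "gauss_mass TYPE('a) \<noteq> 0"
  proof
    assume "gauss_mass TYPE('a) = 0"
    then have "AE z::'a in lborel. exp (- (norm z)\<^sup>2 / 4) = 0"
      using integral_nonneg_eq_0_iff_AE[OF int] by (simp add: gauss_mass_def)
    then have "AE z::'a in lborel. False" by simp
    then show False by (subst (asm) AE_iff_measurable[of UNIV]) (auto simp: emeasure_lborel_UNIV)
  qed
  moreover have "gauss_mass TYPE('a) \<ge> 0"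
    unfolding gauss_mass_def by (rule integral_nonneg_AE) simp
  ultimately show ?thesis by simp
qed

lemma heat_measurable [measurable (raw)]:
  assumes [measurable]: "f \<in> borel_measurable M" "g \<in> borel_measurable M"
  shows "(\<lambda>x. heat (f x) (g x)) \<in> borel_measurable M"
  unfolding heat_def by measurable


lemma heat_nonneg: "0 \<le> heat t (z :: 'a::euclidean_space)"
  using gauss_mass_pos[where 'a = 'a] by (auto simp: heat_def)

lemma heat_nonpos_time [simp]: "t \<le> 0 \<Longrightarrow> heat t z = 0"
  by (simp add: heat_def)

lemma heat_minus: "heat t (- z) = heat t z"
  by (simp add: heat_def)

lemma heat_commute: "heat t (x - y) = heat t (y - x)"
  by (simp add: heat_def norm_minus_commute)

lemma heat_le: "heat t (z :: 'a::euclidean_space) \<le> t powr (- (real DIM('a) / 2)) / gauss_mass TYPE('a)"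
  using gauss_mass_pos[where 'a = 'a]
  by (auto simp: heat_def divide_le_cancel mult_le_cancel_left1 intro!: divide_right_mono)

lemma has_bochner_integral_heat:
  assumes t: "t > 0"
  shows "has_bochner_integral lborel (\<lambda>z::'a::euclidean_space. heat t z) 1"
proof -
  let ?n = "real DIM('a)"
  let ?f = "\<lambda>z::'a. exp (- (norm z)\<^sup>2 / 4)"
  define c where "c = 1 / sqrt t"
  have c: "c > 0" "c\<^sup>2 = 1 / t" using t by (auto simp: c_def power_divide)
  have f: "integrable lborel ?f" using gaussian_integrable[of "1/4", where 'a = 'a] by simp
  have eq: "heat t z = t powr (- (?n / 2)) / gauss_mass TYPE('a) * ?f (0 + c *\<^sub>R z)" for z
    using t c by (simp add: heat_def power_mult_distrib field_simps)
  have "c ^ DIM('a) = t powr (- (?n / 2))"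
    using t c(1) by (simp add: c_def powr_half_sqrt[symmetric] powr_minus_divide[symmetric] powr_realpow[symmetric] powr_powr)
  then have "(LBINT z. ?f (0 + c *\<^sub>R z)) = gauss_mass TYPE('a) / t powr (- (?n / 2))"
    using lborel_integral_affine(2)[of ?f c 0] c by (simp add: gauss_mass_def)
  moreover have "integrable lborel (\<lambda>z. ?f (0 + c *\<^sub>R z))"
    using lborel_integral_affine(1)[of ?f c 0] c f by simp
  ultimately have "has_bochner_integral lborel (\<lambda>z. ?f (0 + c *\<^sub>R z)) (gauss_mass TYPE('a) / t powr (- (?n / 2)))"
    by (simp add: has_bochner_integral_iff)
  from has_bochner_integral_mult_right[OF this, of "t powr (- (?n / 2)) / gauss_mass TYPE('a)"]
  show ?thesis unfolding eq using t gauss_mass_pos[where 'a = 'a] by simp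
qed

lemma heat_integrable: "integrable lborel (heat t :: 'a::euclidean_space \<Rightarrow> real)"
proof (cases "t > 0")
  case True
  then show ?thesis using has_bochner_integral_heat[of t, where 'a = 'a] by (simp add: has_bochner_integral_iff)
next
  case False
  then have "(heat t :: 'a \<Rightarrow> real) = (\<lambda>z. 0)" by (simp add: fun_eq_iff)
  then show ?thesis by simp
qed

lemma heat_integral: "t > 0 \<Longrightarrow> (LBINT z. heat t (z :: 'a::euclidean_space)) = 1"
  using has_bochner_integral_heat[of t, where 'a = 'a] by (auto simp: has_bochner_integral_iff)

text \<open>Completing the square: Gaussians centred at x and 0, with times s and t, multiply to a
  Gaussian in y centred at the weighted mean \<open>m\<close>, with time r = s t / (s + t), times
  \<open>heat (s + t) x\<close>. The Gaussian in y has mass 1.\<close>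

lemma heat_semigroup:
  assumes s: "s > 0" and t: "t > 0"
  shows "(LBINT y. heat s (x - y) * heat t y) = heat (s + t) (x :: 'a::euclidean_space)"
proof -
  let ?n = "real DIM('a)" and ?Z = "gauss_mass TYPE('a)"
  define r where "r = s * t / (s + t)"
  define m where "m = (t / (s + t)) *\<^sub>R x"
  have r: "r > 0" using s t by (simp add: r_def)
  have sq: "(norm (x - y))\<^sup>2 / (4 * s) + (norm y)\<^sup>2 / (4 * t) = (norm x)\<^sup>2 / (4 * (s + t)) + (norm (y - m))\<^sup>2 / (4 * r)" for y
  proof -
    define a b d where "a = x \<bullet> x" and "b = x \<bullet> y" and "d = y \<bullet> y"
    have n1: "(norm (x - y))\<^sup>2 = a - 2 * b + d"
      unfolding power2_norm_eq_inner a_def b_def d_def by (simp add: inner_diff inner_commute)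
    have n2: "(norm (y - m))\<^sup>2 = d - 2 * (t / (s + t)) * b + (t / (s + t))\<^sup>2 * a"
      unfolding power2_norm_eq_inner a_def b_def d_def m_def
      by (simp add: inner_diff inner_commute power2_eq_square)
    have n3: "(norm x)\<^sup>2 = a" "(norm y)\<^sup>2 = d" by (simp_all add: a_def d_def power2_norm_eq_inner)
    have [simp]: "s \<noteq> 0" "t \<noteq> 0" "s + t \<noteq> 0" "s * 4 + t * 4 \<noteq> 0" using s t by auto
    show ?thesis unfolding n1 n2 n3 r_def
      by (simp add: divide_simps) (simp add: algebra_simps power2_eq_square)
  qed
  have "heat s (x - y) * heat t y = heat (s + t) x * heat r (y - m)" for y
  proof -
    have p: "s powr (- (?n / 2)) * t powr (- (?n / 2)) = (s + t) powr (- (?n / 2)) * r powr (- (?n / 2))"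
      using s t by (simp add: r_def powr_mult[symmetric])
    have e: "exp (- (norm (x - y))\<^sup>2 / (4 * s)) * exp (- (norm y)\<^sup>2 / (4 * t)) =
      exp (- (norm x)\<^sup>2 / (4 * (s + t))) * exp (- (norm (y - m))\<^sup>2 / (4 * r))"
      unfolding exp_add[symmetric] using sq[of y] by simp
    have "heat s (x - y) * heat t y = (s powr (- (?n / 2)) * t powr (- (?n / 2))) *
        (exp (- (norm (x - y))\<^sup>2 / (4 * s)) * exp (- (norm y)\<^sup>2 / (4 * t))) / (?Z * ?Z)"
      using s t by (simp add: heat_def)
    also have "\<dots> = heat (s + t) x * heat r (y - m)"
      unfolding p e using s t r by (simp add: heat_def)
    finally show ?thesis .
  qed
  then have "(LBINT y. heat s (x - y) * heat t y) = heat (s + t) x * (LBINT y. heat r (y + (- m)))"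
    by simp
  also have "(LBINT y. heat r (y + (- m))) = (LBINT y. heat r (y :: 'a))"
    by (rule lborel_integral_translate) measurable
  finally show ?thesis using heat_integral[OF r, where 'a = 'a] by simp
qed

text \<open>The exponential grows with time and the power prefactor is compensated explicitly. A
  later heat kernel can thus dominate the kernels of a whole range of earlier times.\<close>

lemma heat_mono_time:
  assumes "0 < s" "s \<le> t"
  shows "heat s (z :: 'a::euclidean_space) \<le> (t / s) powr (real DIM('a) / 2) * heat t z"
proof -
  have "(norm z)\<^sup>2 / (4 * t) \<le> (norm z)\<^sup>2 / (4 * s)"
    using assms by (intro divide_left_mono) auto
  then have "exp (- (norm z)\<^sup>2 / (4 * s)) \<le> exp (- (norm z)\<^sup>2 / (4 * t))" by simp
  moreover have "(t / s) powr (real DIM('a) / 2) * t powr (- (real DIM('a) / 2)) = s powr (- (real DIM('a) / 2))"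
    using assms by (simp add: powr_divide powr_minus field_simps)
  ultimately show ?thesis
    using assms gauss_mass_pos[where 'a = 'a]
    by (simp add: heat_def mult.assoc[symmetric] divide_right_mono mult_left_mono)
qed

text \<open>Half of the Gaussian exponent absorbs the factor \<open>f\<close>, the other half is the
  exponent at time 2t; 2^(n/2) restores the prefactor.\<close>

lemma heat_poly_bound:
  assumes t: "t > 0" and f: "f ((norm z)\<^sup>2 / (4 * t)) \<le> exp ((norm z)\<^sup>2 / (4 * t) / 2)"
  shows "f ((norm z)\<^sup>2 / (4 * t)) * heat t (z :: 'a::euclidean_space) \<le> 2 powr (real DIM('a) / 2) * heat (2 * t) z"
proof -
  let ?X = "(norm z)\<^sup>2 / (4 * t)" and ?n = "real DIM('a) / 2"
  have "f ?X * exp (- ?X) \<le> exp (?X / 2) * exp (- ?X)" using f by (intro mult_right_mono) auto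
  also have "\<dots> = exp (- (norm z)\<^sup>2 / (4 * (2 * t)))"
    unfolding exp_add[symmetric] using t by (simp add: field_simps)
  finally have e: "f ?X * exp (- (norm z)\<^sup>2 / (4 * t)) \<le> exp (- (norm z)\<^sup>2 / (4 * (2 * t)))" by simp
  have p: "2 powr ?n * (2 * t) powr (- ?n) = t powr (- ?n)"
    using t by (simp add: powr_mult powr_minus)
  have "f ?X * heat t z = t powr (- ?n) / gauss_mass TYPE('a) * (f ?X * exp (- (norm z)\<^sup>2 / (4 * t)))"
    using t by (simp add: heat_def)
  also have "\<dots> \<le> t powr (- ?n) / gauss_mass TYPE('a) * exp (- (norm z)\<^sup>2 / (4 * (2 * t)))"
    using e gauss_mass_pos[where 'a = 'a] by (intro mult_left_mono) auto
  also have "\<dots> = 2 powr ?n * heat (2 * t) z"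
    using t by (simp add: heat_def p[symmetric])
  finally show ?thesis .
qed

lemma heat_moment_bound:
  assumes t: "t > 0"
  shows "(norm z)\<^sup>2 / (4 * t) * heat t (z :: 'a::euclidean_space) \<le> 2 powr (real DIM('a) / 2) * heat (2 * t) z"
proof (rule heat_poly_bound[OF t, where f = "\<lambda>X. X"])
  let ?X = "(norm z)\<^sup>2 / (4 * t)"
  have "exp (?X / 2) \<ge> 1 + ?X / 2 + (?X / 2)\<^sup>2 / 2"
    using t by (intro exp_lower_Taylor_quadratic) auto
  moreover have "0 \<le> (?X - 2)\<^sup>2" by simp
  ultimately show "?X \<le> exp (?X / 2)" by (simp add: power2_eq_square algebra_simps)
qed

text \<open>In terms of X = |z|^2 / (4t) the factor |z| / (2t) equals sqrt X / sqrt t. The loss of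
  t^(-1/2) is what \<beta> > 1/2 has to absorb later.\<close>

lemma heat_gradient_bound:
  assumes t: "t > 0" and i: "i \<in> Basis"
  shows "\<bar>z \<bullet> i\<bar> / (2 * t) * heat t (z :: 'a::euclidean_space) \<le> 2 powr (real DIM('a) / 2) * heat (2 * t) z / sqrt t"
proof -
  let ?X = "(norm z)\<^sup>2 / (4 * t)"
  have X: "?X \<ge> 0" using t by simp
  have "sqrt ?X \<le> (1 + ?X) / 2"
    using arith_geo_mean_sqrt[of 1 ?X] X by simp
  also have "\<dots> \<le> exp (?X / 2)"
  proof -
    have "(1 + Y) / 2 \<le> exp (Y / 2)" if "Y \<ge> 0" for Y :: real
    proof -
      have "(1 + Y) / 2 = 1 / 2 + Y / 2" by (simp add: add_divide_distrib)
      moreover note exp_ge_add_one_self[of "Y / 2"]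
      ultimately show ?thesis by linarith
    qed
    then show ?thesis using X .
  qed
  finally have b: "sqrt ?X * heat t z \<le> 2 powr (real DIM('a) / 2) * heat (2 * t) z"
    by (rule heat_poly_bound[OF t, where f = sqrt])
  have "\<bar>z \<bullet> i\<bar> / (2 * t) \<le> norm z / (2 * t)"
    using Basis_le_norm[OF i, of z] t by (intro divide_right_mono) auto
  also have "\<dots> = sqrt ?X / sqrt t"
    using t by (simp add: real_sqrt_divide real_sqrt_mult field_simps)
  finally have "\<bar>z \<bullet> i\<bar> / (2 * t) * heat t z \<le> sqrt ?X / sqrt t * heat t z"
    by (intro mult_right_mono heat_nonneg)
  also have "\<dots> \<le> 2 powr (real DIM('a) / 2) * heat (2 * t) z / sqrt t"
    using b t by (simp add: divide_right_mono)
  finally show ?thesis .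
qed

lemma heat_space_derivative:
  assumes t: "t > 0" and i: "i \<in> Basis"
  shows "((\<lambda>h. heat t (z + h *\<^sub>R i)) has_field_derivative
    - ((z + h *\<^sub>R i) \<bullet> i) / (2 * t) * heat t (z + h *\<^sub>R i :: 'a::euclidean_space)) (at h)"
proof -
  have sq: "(norm (z + h *\<^sub>R i))\<^sup>2 = (norm z)\<^sup>2 + 2 * h * (z \<bullet> i) + h\<^sup>2" for h
    unfolding power2_norm_eq_inner using i by (simp add: inner_add inner_commute power2_eq_square)
  have eq: "(\<lambda>h. heat t (z + h *\<^sub>R i)) = (\<lambda>h. t powr (- (real DIM('a) / 2)) *
      exp (- ((norm z)\<^sup>2 + 2 * h * (z \<bullet> i) + h\<^sup>2) / (4 * t)) / gauss_mass TYPE('a))"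
    using t by (simp add: heat_def sq fun_eq_iff)
  have zi: "(z + h *\<^sub>R i) \<bullet> i = z \<bullet> i + h" using i by (simp add: inner_add_left)
  have "((\<lambda>h. exp (- ((norm z)\<^sup>2 + 2 * h * (z \<bullet> i) + h\<^sup>2) / (4 * t))) has_field_derivative
      exp (- ((norm z)\<^sup>2 + 2 * h * (z \<bullet> i) + h\<^sup>2) / (4 * t)) * (- (2 * (z \<bullet> i) + 2 * h) / (4 * t))) (at h)"
  proof -
    have "((\<lambda>h. - ((norm z)\<^sup>2 + 2 * h * (z \<bullet> i) + h\<^sup>2)) has_field_derivative - (2 * (z \<bullet> i) + 2 * h)) (at h)"
      by (auto intro!: derivative_eq_intros)
    from DERIV_fun_exp[OF DERIV_cdivide[OF this, of "4 * t"]] show ?thesis .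
  qed
  from DERIV_cdivide[OF DERIV_cmult[OF this, of "t powr (- (real DIM('a) / 2))"], of "gauss_mass TYPE('a)"]
  have "((\<lambda>h. heat t (z + h *\<^sub>R i)) has_field_derivative t powr (- (real DIM('a) / 2)) *
      (exp (- ((norm z)\<^sup>2 + 2 * h * (z \<bullet> i) + h\<^sup>2) / (4 * t)) * (- (2 * (z \<bullet> i) + 2 * h) / (4 * t))) / gauss_mass TYPE('a)) (at h)"
    unfolding eq .
  also have "t powr (- (real DIM('a) / 2)) *
      (exp (- ((norm z)\<^sup>2 + 2 * h * (z \<bullet> i) + h\<^sup>2) / (4 * t)) * (- (2 * (z \<bullet> i) + 2 * h) / (4 * t))) / gauss_mass TYPE('a) =
      (- (2 * (z \<bullet> i) + 2 * h) / (4 * t)) * heat t (z + h *\<^sub>R i)"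
    using t by (simp add: heat_def sq)
  also have "- (2 * (z \<bullet> i) + 2 * h) / (4 * t) = - ((z + h *\<^sub>R i) \<bullet> i) / (2 * t)"
    unfolding zi using t by (simp add: field_simps)
  finally show ?thesis .
qed

lemma heat_time_derivative:
  assumes t: "t > 0"
  shows "((\<lambda>s. heat s z) has_field_derivative
    ((norm z)\<^sup>2 / (4 * t) - real DIM('a) / 2) / t * heat t (z :: 'a::euclidean_space)) (at t)"
proof -
  let ?n = "real DIM('a) / 2" and ?Z = "gauss_mass TYPE('a)"
  let ?E = "exp (- (norm z)\<^sup>2 / (4 * t))"
  have 1: "((\<lambda>s. s powr (- ?n)) has_field_derivative (- ?n) * t powr (- ?n - 1)) (at t)"
    by (rule has_real_derivative_powr[OF t])
  have 2: "((\<lambda>s. exp (- (norm z)\<^sup>2 / (4 * s))) has_field_derivative ?E * ((norm z)\<^sup>2 / (4 * t) / t)) (at t)"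
    using t by (auto intro!: derivative_eq_intros simp: power2_eq_square)
  have 3: "t powr (- ?n - 1) = t powr (- ?n) / t" using t by (simp add: powr_diff)
  have "((\<lambda>s. s powr (- ?n) * exp (- (norm z)\<^sup>2 / (4 * s)) / ?Z) has_field_derivative
    ((- ?n) * t powr (- ?n - 1) * ?E + ?E * ((norm z)\<^sup>2 / (4 * t) / t) * t powr (- ?n)) / ?Z) (at t)"
    by (intro DERIV_cdivide DERIV_mult 1 2)
  also have "((- ?n) * t powr (- ?n - 1) * ?E + ?E * ((norm z)\<^sup>2 / (4 * t) / t) * t powr (- ?n)) / ?Z =
    ((norm z)\<^sup>2 / (4 * t) - ?n) / t * heat t z"
    using t unfolding 3 by (simp add: heat_def diff_divide_distrib add_divide_distrib algebra_simps)
  finally have "((\<lambda>s. s powr (- ?n) * exp (- (norm z)\<^sup>2 / (4 * s)) / ?Z) has_field_derivative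
    ((norm z)\<^sup>2 / (4 * t) - ?n) / t * heat t z) (at t)" .
  then show ?thesis
    by (rule has_field_derivative_transform_within_open[where S = "{0<..}"]) (use t in \<open>auto simp: heat_def\<close>)
qed

text \<open>Increments of t are relative, so the constant is free of t. On [t/2, 3t/2] the moment
  bound moves s to 2s <= 3t, still below 4t. The 8 is 4t divided by t/2, the largest ratio
  occurring, and the leading 2 comes from 1/s <= 2/t.\<close>

lemma heat_time_bound:
  assumes t: "t > 0" and h: "\<bar>h\<bar> \<le> 1 / 2"
  shows "\<bar>heat (t * (1 + h)) z - heat t z\<bar> \<le>
    \<bar>h\<bar> * (2 * (1 + real DIM('a) / 2) * 8 powr (real DIM('a) / 2) * heat (4 * t) (z :: 'a::euclidean_space))"
proof -
  let ?n = "real DIM('a) / 2"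
  define D where "D = 2 * (1 + ?n) * 8 powr ?n * heat (4 * t) z / t"
  have "norm (heat (t * (1 + h)) z - heat t z) \<le> D * norm (t * (1 + h) - t)"
  proof (rule field_differentiable_bound[of "{t/2..3*t/2}"])
    show "convex {t/2..3*t/2}" by (rule convex_real_interval)
    fix s assume s: "s \<in> {t/2..3*t/2}"
    then have s0: "s > 0" using t by auto
    show "((\<lambda>s. heat s z) has_field_derivative ((norm z)\<^sup>2 / (4 * s) - ?n) / s * heat s z) (at s within {t/2..3*t/2})"
      by (rule has_field_derivative_at_within[OF heat_time_derivative[OF s0]])
    have 1: "heat s z \<le> 8 powr ?n * heat (4 * t) z"
    proof -
      have "heat s z \<le> (4 * t / s) powr ?n * heat (4 * t) z"
        by (rule heat_mono_time) (use s s0 in auto)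
      also have "\<dots> \<le> 8 powr ?n * heat (4 * t) z"
        by (intro mult_right_mono powr_mono2 heat_nonneg) (use s s0 t in \<open>auto simp: field_simps\<close>)
      finally show ?thesis .
    qed
    have 2: "(norm z)\<^sup>2 / (4 * s) * heat s z \<le> 8 powr ?n * heat (4 * t) z"
    proof -
      have "(norm z)\<^sup>2 / (4 * s) * heat s z \<le> 2 powr ?n * heat (2 * s) z" by (rule heat_moment_bound[OF s0])
      also have "\<dots> \<le> 2 powr ?n * ((4 * t / (2 * s)) powr ?n * heat (4 * t) z)"
        by (intro mult_left_mono heat_mono_time) (use s s0 in auto)
      also have "\<dots> \<le> 2 powr ?n * (4 powr ?n * heat (4 * t) z)"
        by (intro mult_left_mono mult_right_mono powr_mono2 heat_nonneg) (use s s0 t in \<open>auto simp: field_simps\<close>)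
      also have "\<dots> = 8 powr ?n * heat (4 * t) z"
        using powr_mult[of 2 4 ?n] by simp
      finally show ?thesis .
    qed
    have "norm (((norm z)\<^sup>2 / (4 * s) - ?n) / s * heat s z) = \<bar>(norm z)\<^sup>2 / (4 * s) * heat s z - ?n * heat s z\<bar> / s"
    proof -
      have "((norm z)\<^sup>2 / (4 * s) - ?n) / s * heat s z = ((norm z)\<^sup>2 / (4 * s) * heat s z - ?n * heat s z) / s"
        by (simp only: left_diff_distrib times_divide_eq_left)
      then show ?thesis using s0 by (simp only: real_norm_def abs_divide abs_of_pos)
    qed
    also have "\<dots> \<le> (8 powr ?n * heat (4 * t) z + ?n * (8 powr ?n * heat (4 * t) z)) / s"
    proof (rule divide_right_mono)
      have "0 \<le> (norm z)\<^sup>2 / (4 * s) * heat s z" using s0 heat_nonneg[of s z] by simp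
      moreover have "?n * heat s z \<le> ?n * (8 powr ?n * heat (4 * t) z)" using 1 by (intro mult_left_mono) auto
      moreover have "0 \<le> ?n * heat s z" using heat_nonneg[of s z] by simp
      ultimately show "\<bar>(norm z)\<^sup>2 / (4 * s) * heat s z - ?n * heat s z\<bar> \<le>
          8 powr ?n * heat (4 * t) z + ?n * (8 powr ?n * heat (4 * t) z)"
        using 2 by linarith
    qed (use s0 in simp)
    also have "\<dots> = ((1 + ?n) * 8 powr ?n * heat (4 * t) z) * (1 / s)" by (simp add: distrib_right)
    also have "\<dots> \<le> ((1 + ?n) * 8 powr ?n * heat (4 * t) z) * (2 / t)"
      using s s0 t heat_nonneg[of "4 * t" z] by (intro mult_left_mono) (auto simp: field_simps)
    also have "\<dots> = D" by (simp add: D_def)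
    finally show "norm (((norm z)\<^sup>2 / (4 * s) - ?n) / s * heat s z) \<le> D" .
  next
    show "t * (1 + h) \<in> {t/2..3*t/2}"
      using mult_left_mono[of "1/2" "1 + h" t] mult_left_mono[of "1 + h" "3/2" t] t h by (auto simp: abs_le_iff)
  qed (use t in auto)
  moreover have "norm (t * (1 + h) - t) = t * \<bar>h\<bar>" using t by (simp add: algebra_simps abs_mult)
  moreover have "D * (t * \<bar>h\<bar>) = \<bar>h\<bar> * (D * t)" by simp
  moreover have "D * t = 2 * (1 + ?n) * 8 powr ?n * heat (4 * t) z" using t by (simp add: D_def)
  ultimately show ?thesis by (simp only: real_norm_def)
qed

text \<open>By |z|^2 <= 2 |z + r i|^2 + 2 the shifted kernel at time 2t lies below the unshifted one
  at time 4t, at the cost of exp (1 / (8t)). The constant explodes as t tends to 0; the bound serves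
  to differentiate \<open>heat_flow\<close> at a fixed time.\<close>

lemma heat_space_bound:
  assumes t: "t > 0" and i: "i \<in> Basis" and h: "\<bar>h\<bar> \<le> 1"
  shows "\<bar>heat t (z + h *\<^sub>R i) - heat t z\<bar> \<le>
    \<bar>h\<bar> * (2 powr (real DIM('a) / 2) / sqrt t * exp (1 / (8 * t)) * 2 powr (real DIM('a) / 2) * heat (4 * t) (z :: 'a::euclidean_space))"
proof -
  let ?n = "real DIM('a) / 2"
  define D where "D = 2 powr ?n / sqrt t * exp (1 / (8 * t)) * 2 powr ?n * heat (4 * t) z"
  have "norm (heat t (z + h *\<^sub>R i) - heat t (z + 0 *\<^sub>R i)) \<le> D * norm (h - 0)"
  proof (rule field_differentiable_bound[of "{-1..1}"])
    fix r :: real assume r: "r \<in> {-1..1}"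
    show "((\<lambda>h. heat t (z + h *\<^sub>R i)) has_field_derivative - ((z + r *\<^sub>R i) \<bullet> i) / (2 * t) * heat t (z + r *\<^sub>R i)) (at r within {-1..1})"
      by (rule has_field_derivative_at_within[OF heat_space_derivative[OF t i]])
    have "norm (- ((z + r *\<^sub>R i) \<bullet> i) / (2 * t) * heat t (z + r *\<^sub>R i)) =
        \<bar>(z + r *\<^sub>R i) \<bullet> i\<bar> / (2 * t) * heat t (z + r *\<^sub>R i)"
      using t by (simp add: abs_mult heat_nonneg)
    also have "\<dots> \<le> 2 powr ?n * heat (2 * t) (z + r *\<^sub>R i) / sqrt t"
      by (rule heat_gradient_bound[OF t i])
    also have "heat (2 * t) (z + r *\<^sub>R i) \<le> exp (1 / (8 * t)) * (2 powr ?n * heat (4 * t) z)"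
    proof -
      have "norm z \<le> norm (z + r *\<^sub>R i) + norm (r *\<^sub>R i)" using norm_triangle_ineq4[of "z + r *\<^sub>R i" "r *\<^sub>R i"] by simp
      also have "norm (r *\<^sub>R i) \<le> 1" using r i by (auto simp: abs_le_iff)
      finally have "(norm z)\<^sup>2 \<le> (norm (z + r *\<^sub>R i) + 1)\<^sup>2" by (intro power_mono) auto
      moreover have "0 \<le> (norm (z + r *\<^sub>R i) - 1)\<^sup>2" by simp
      ultimately have "(norm z)\<^sup>2 \<le> 2 * (norm (z + r *\<^sub>R i))\<^sup>2 + 2"
        by (simp add: power2_eq_square algebra_simps)
      then have "- (norm (z + r *\<^sub>R i))\<^sup>2 / (4 * (2 * t)) \<le> 1 / (8 * t) + - (norm z)\<^sup>2 / (4 * (4 * t))"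
        using t by (simp add: field_simps)
      then have e: "exp (- (norm (z + r *\<^sub>R i))\<^sup>2 / (4 * (2 * t))) \<le> exp (1 / (8 * t)) * exp (- (norm z)\<^sup>2 / (4 * (4 * t)))"
        unfolding exp_add[symmetric] by simp
      have p: "(2 * t) powr (- ?n) = 2 powr ?n * (4 * t) powr (- ?n)"
        using t powr_mult[of 2 "2 * t" "- ?n"] by (simp add: powr_minus)
      have "heat (2 * t) (z + r *\<^sub>R i) = (2 * t) powr (- ?n) / gauss_mass TYPE('a) * exp (- (norm (z + r *\<^sub>R i))\<^sup>2 / (4 * (2 * t)))"
        using t by (simp add: heat_def)
      also have "\<dots> \<le> (2 * t) powr (- ?n) / gauss_mass TYPE('a) * (exp (1 / (8 * t)) * exp (- (norm z)\<^sup>2 / (4 * (4 * t))))"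
        using e gauss_mass_pos[where 'a = 'a] by (intro mult_left_mono) auto
      also have "\<dots> = exp (1 / (8 * t)) * (2 powr ?n * heat (4 * t) z)"
        using t unfolding p by (simp add: heat_def)
      finally show ?thesis .
    qed
    finally show "norm (- ((z + r *\<^sub>R i) \<bullet> i) / (2 * t) * heat t (z + r *\<^sub>R i)) \<le> D"
      using t by (simp add: D_def divide_right_mono field_simps)
  qed (use h in \<open>auto simp: abs_le_iff\<close>)
  then show ?thesis by (simp add: D_def mult.commute)
qed

section \<open>Heat flow and its gradient on bounded square integrable functions\<close>

definition heat_flow :: "real \<Rightarrow> ('a::euclidean_space \<Rightarrow> real) \<Rightarrow> 'a \<Rightarrow> real" where
  "heat_flow t v x = (LBINT y. heat t (x - y) * v y)"

definition heat_grad :: "'a::euclidean_space \<Rightarrow> real \<Rightarrow> ('a \<Rightarrow> real) \<Rightarrow> 'a \<Rightarrow> real" where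
  "heat_grad i t v x = (LBINT y. - ((x - y) \<bullet> i) / (2 * t) * heat t (x - y) * v y)"

definition bounded_L2 :: "('a::euclidean_space \<Rightarrow> real) \<Rightarrow> bool" where
  "bounded_L2 v \<longleftrightarrow> v \<in> borel_measurable borel \<and> (\<exists>M. \<forall>x. \<bar>v x\<bar> \<le> M) \<and> integrable lborel (\<lambda>x. (v x)\<^sup>2)"

lemma bounded_L2_measurable [measurable_dest]: "bounded_L2 v \<Longrightarrow> v \<in> borel_measurable borel"
  by (simp add: bounded_L2_def)

lemma bounded_L2_abs: "bounded_L2 v \<Longrightarrow> bounded_L2 (\<lambda>x. \<bar>v x\<bar>)"
  by (auto simp: bounded_L2_def)

lemma bounded_L2_cmult: "bounded_L2 v \<Longrightarrow> bounded_L2 (\<lambda>x. c * v x)"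
proof -
  assume v: "bounded_L2 v"
  then obtain M where M: "\<And>x. \<bar>v x\<bar> \<le> M" by (auto simp: bounded_L2_def)
  have "\<bar>c * v x\<bar> \<le> \<bar>c\<bar> * M" for x using M[of x] by (simp add: abs_mult mult_left_mono)
  then show ?thesis using v unfolding bounded_L2_def by (auto simp: power_mult_distrib)
qed

lemma bounded_L2_bound:
  assumes "bounded_L2 v"
  obtains M where "M \<ge> 0" "\<And>x. \<bar>v x\<bar> \<le> M"
  using assms unfolding bounded_L2_def by (metis abs_ge_zero order_trans)

lemma heat_flow_measurable [measurable (raw)]:
  assumes [measurable]: "v \<in> borel_measurable borel" "f \<in> borel_measurable M" "g \<in> borel_measurable M"
  shows "(\<lambda>x. heat_flow (f x) v (g x)) \<in> borel_measurable M"
  unfolding heat_flow_def by measurable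

lemma heat_grad_measurable [measurable (raw)]:
  assumes [measurable]: "v \<in> borel_measurable borel" "f \<in> borel_measurable M" "g \<in> borel_measurable M"
  shows "(\<lambda>x. heat_grad i (f x) v (g x)) \<in> borel_measurable M"
  unfolding heat_grad_def by measurable

lemma heat_translate_integrable: "integrable lborel (\<lambda>y. heat t (x - y))"
  by (subst lborel_integrable_reflect_iff) (auto intro: heat_integrable)

lemma heat_translate_integral: "t > 0 \<Longrightarrow> (LBINT y. heat t (x - y)) = 1"
  by (subst lborel_integral_reflect) (auto simp: heat_integral)

lemma heat_flow_integrable:
  assumes "bounded_L2 v"
  shows "integrable lborel (\<lambda>y. heat t (x - y) * v y)"
proof -
  note [measurable] = bounded_L2_measurable[OF assms]
  obtain M where M: "M \<ge> 0" "\<And>x. \<bar>v x\<bar> \<le> M" by (rule bounded_L2_bound[OF assms]) blast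
  show ?thesis
  proof (rule integrable_boundI)
    show "integrable lborel (\<lambda>y. M * heat t (x - y))" by (intro integrable_mult_right heat_translate_integrable)
    show "\<bar>heat t (x - y) * v y\<bar> \<le> \<bar>M * heat t (x - y)\<bar>" for y
      using mult_right_mono[OF M(2)[of y] heat_nonneg[of t "x - y"]] M(1) heat_nonneg[of t "x - y"]
      by (simp add: abs_mult mult.commute)
  qed measurable
qed

lemma heat_flow_abs_le:
  shows "\<bar>heat_flow t v x\<bar> \<le> heat_flow t (\<lambda>y. \<bar>v y\<bar>) x"
proof -
  have "\<bar>heat_flow t v x\<bar> \<le> (LBINT y. \<bar>heat t (x - y) * v y\<bar>)"
    unfolding heat_flow_def by (rule integral_abs_bound)
  also have "\<dots> = heat_flow t (\<lambda>y. \<bar>v y\<bar>) x"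
    unfolding heat_flow_def by (simp add: abs_mult heat_nonneg)
  finally show ?thesis .
qed

lemma heat_flow_bounded:
  assumes v: "bounded_L2 v" and M: "\<And>x. \<bar>v x\<bar> \<le> M"
  shows "\<bar>heat_flow t v x\<bar> \<le> M"
proof (cases "t > 0")
  case True
  have "\<bar>heat_flow t v x\<bar> \<le> heat_flow t (\<lambda>y. \<bar>v y\<bar>) x" by (rule heat_flow_abs_le)
  also have "\<dots> \<le> (LBINT y. heat t (x - y) * M)"
    unfolding heat_flow_def
    by (rule integral_mono[OF heat_flow_integrable[OF bounded_L2_abs[OF v]]])
      (auto intro!: heat_translate_integrable mult_left_mono M heat_nonneg)
  also have "\<dots> = M" using True by (simp add: heat_translate_integral)
  finally show ?thesis .
next
  case False
  then show ?thesis using order_trans[OF abs_ge_zero M] by (simp add: heat_flow_def)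
qed

text \<open>Weighted arithmetic-geometric mean: p |v| <= s p^2 + v^2 / s for the kernel p, of which
  one factor is bounded by a multiple of t^(-n/2). The choice s = t^(n/4) balances the two terms at
  t^(-n/4).\<close>

lemma heat_flow_decay:
  assumes v: "bounded_L2 (v :: 'a::euclidean_space \<Rightarrow> real)" and t: "t > 0"
  shows "\<bar>heat_flow t v x\<bar> \<le> (1 / gauss_mass TYPE('a) + (LBINT x. (v x)\<^sup>2)) * t powr (- (real DIM('a) / 4))"
proof -
  let ?n = "real DIM('a)" and ?Z = "gauss_mass TYPE('a)"
  note [measurable] = bounded_L2_measurable[OF v]
  define s where "s = t powr (?n / 4)"
  have s: "s > 0" using t by (simp add: s_def)
  have v2: "integrable lborel (\<lambda>y. (v y)\<^sup>2)" using v by (simp add: bounded_L2_def)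
  have pw: "heat t (x - y) * \<bar>v y\<bar> \<le> t powr (- (?n / 2)) / ?Z * s * heat t (x - y) + (v y)\<^sup>2 / s" for y
  proof -
    let ?p = "heat t (x - y)"
    have "0 \<le> (s * ?p - \<bar>v y\<bar>)\<^sup>2" by simp
    then have "2 * (?p * \<bar>v y\<bar>) * s \<le> s * s * ?p * ?p + (v y)\<^sup>2"
      by (simp add: power2_eq_square algebra_simps)
    then have "2 * (?p * \<bar>v y\<bar>) \<le> s * ?p * ?p + (v y)\<^sup>2 / s" using s by (simp add: field_simps)
    moreover have "?p * \<bar>v y\<bar> \<ge> 0" by (simp add: heat_nonneg)
    moreover have "s * ?p * ?p \<le> s * ?p * (t powr (- (?n / 2)) / ?Z)"
      using s by (intro mult_left_mono heat_le) (auto simp: heat_nonneg)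
    ultimately show ?thesis by (simp add: mult_ac)
  qed
  have "\<bar>heat_flow t v x\<bar> \<le> heat_flow t (\<lambda>y. \<bar>v y\<bar>) x" by (rule heat_flow_abs_le)
  also have "\<dots> \<le> (LBINT y. t powr (- (?n / 2)) / ?Z * s * heat t (x - y) + (v y)\<^sup>2 / s)"
    unfolding heat_flow_def
    by (rule integral_mono[OF heat_flow_integrable[OF bounded_L2_abs[OF v]]])
      (use pw v2 in \<open>auto intro!: Bochner_Integration.integrable_add integrable_mult_right heat_translate_integrable\<close>)
  also have "\<dots> = t powr (- (?n / 2)) / ?Z * s + (LBINT y. (v y)\<^sup>2) / s"
    using v2 t heat_translate_integral[OF t, of x]
      integrable_mult_right[OF heat_translate_integrable[of t x], of "t powr (- (?n / 2)) / ?Z * s"]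
    by (subst Bochner_Integration.integral_add) auto
  also have "t powr (- (?n / 2)) * s = t powr (- (?n / 4))"
    using t by (simp add: s_def powr_add[symmetric])
  then have "t powr (- (?n / 2)) / ?Z * s + (LBINT y. (v y)\<^sup>2) / s =
      (1 / ?Z + (LBINT x. (v x)\<^sup>2)) * t powr (- (?n / 4))"
    using t by (simp add: s_def powr_minus field_simps)
  finally show ?thesis .
qed

text \<open>The common profile of heat flows: bounded at small times because the data are bounded, a
  power at large times because they are square integrable.\<close>

definition decay :: "real \<Rightarrow> real \<Rightarrow> real" where
  "decay e t = min 1 (t powr - e)"

lemma decay_measurable [measurable]: "decay e \<in> borel_measurable borel"
  unfolding decay_def[abs_def] by measurable

lemma decay_bounds: "0 \<le> decay e t" "decay e t \<le> 1"
  by (auto simp: decay_def)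

lemma decay_antimono: "0 \<le> e \<Longrightarrow> antimono_on {0<..} (decay e)"
  by (rule monotone_onI) (auto simp: decay_def intro!: min.coboundedI2 powr_mono2')

text \<open>Positivity of \<open>a\<close> settles t near 0, and a < e settles t near infinity. With
  e = n/4 the second condition is where \<alpha> < n/2 enters the convergence of all time
  integrals.\<close>

lemma frac_kernel_decay_integrable:
  assumes a: "0 < a" "a < e"
  shows "integrable lborel (\<lambda>t. frac_kernel a t * decay e t)"
proof (rule integrable_boundI)
  have 1: "integrable lborel (\<lambda>t. indicator {..1} t * frac_kernel a t)"
    using causal_frac_kernel[OF a(1)] by (simp add: causal_kernel_def)
  have "has_bochner_integral lborel (\<lambda>t. indicator {1..} t * t powr (a - 1 - e)) (- (1 powr (a - 1 - e + 1)) / (a - 1 - e + 1))"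
    by (rule has_bochner_integral_of_has_integral) (use has_integral_powr_to_inf[of "a - 1 - e" 1] a in auto)
  then have 2: "integrable lborel (\<lambda>t. indicator {1..} t * t powr (a - 1 - e) / Gamma a)"
    by (auto simp: has_bochner_integral_iff)
  show "integrable lborel (\<lambda>t. indicator {..1} t * frac_kernel a t + indicator {1..} t * t powr (a - 1 - e) / Gamma a)"
    using 1 2 by simp
  show "\<bar>frac_kernel a t * decay e t\<bar> \<le> \<bar>indicator {..1} t * frac_kernel a t + indicator {1..} t * t powr (a - 1 - e) / Gamma a\<bar>" for t
  proof -
    have G: "Gamma a > 0" using a Gamma_real_pos by simp
    have k: "0 \<le> frac_kernel a t" using frac_kernel_nonneg[OF a(1)] .
    consider "t \<le> 0" | "0 < t" "t \<le> 1" | "t > 1" by linarith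
    then have "frac_kernel a t * decay e t \<le> indicator {..1} t * frac_kernel a t + indicator {1..} t * t powr (a - 1 - e) / Gamma a"
    proof cases
      case 1
      then show ?thesis by (simp add: frac_kernel_def)
    next
      case 2
      have "frac_kernel a t * decay e t \<le> frac_kernel a t"
        using k decay_bounds[of e t] by (intro mult_left_le) auto
      moreover have "0 \<le> indicator {1..} t * t powr (a - 1 - e) / Gamma a" using G by simp
      ultimately show ?thesis using 2 by simp
    next
      case 3
      have "frac_kernel a t * decay e t \<le> frac_kernel a t * t powr (- e)"
        using k by (intro mult_left_mono) (auto simp: decay_def)
      also have "\<dots> = t powr (a - 1 - e) / Gamma a"
        using 3 by (simp add: frac_kernel_def powr_add[symmetric])
      finally show ?thesis using 3 by simp
    qed
    then show ?thesis using k decay_bounds[of e t] by simp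
  qed
qed measurable

lemma heat_flow_le_decay:
  assumes v: "bounded_L2 (v :: 'a::euclidean_space \<Rightarrow> real)"
  obtains C where "C \<ge> 0" "\<And>t x. t > 0 \<Longrightarrow> heat_flow t (\<lambda>y. \<bar>v y\<bar>) x \<le> C * decay (real DIM('a) / 4) t"
proof -
  obtain M where M: "M \<ge> 0" "\<And>x. \<bar>v x\<bar> \<le> M" by (rule bounded_L2_bound[OF v]) blast
  define D where "D = 1 / gauss_mass TYPE('a) + (LBINT x. (v x)\<^sup>2)"
  have "heat_flow t (\<lambda>y. \<bar>v y\<bar>) x \<le> max M D * decay (real DIM('a) / 4) t" if t: "t > 0" for t x
  proof -
    have 1: "heat_flow t (\<lambda>y. \<bar>v y\<bar>) x \<le> M"
      using heat_flow_bounded[OF bounded_L2_abs[OF v], of M t x] M by simp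
    have 2: "heat_flow t (\<lambda>y. \<bar>v y\<bar>) x \<le> D * t powr (- (real DIM('a) / 4))"
      using heat_flow_decay[OF bounded_L2_abs[OF v] t, of x] by (simp add: D_def)
    have "M \<le> max M D * 1" "D * t powr (- (real DIM('a) / 4)) \<le> max M D * t powr (- (real DIM('a) / 4))"
      by (auto intro: mult_right_mono)
    then show ?thesis using 1 2 by (auto simp: decay_def min_def)
  qed
  moreover have "max M D \<ge> 0" using M by simp
  ultimately show ?thesis using that by blast
qed

lemma heat_flow_heat_flow:
  assumes v: "bounded_L2 v" and s: "s > 0" and t: "t > 0"
  shows "heat_flow s (heat_flow t v) x = heat_flow (s + t) v x"
proof -
  note [measurable] = bounded_L2_measurable[OF v]
  obtain M where M: "M \<ge> 0" "\<And>x. \<bar>v x\<bar> \<le> M" by (rule bounded_L2_bound[OF v]) blast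
  have int: "integrable (lborel \<Otimes>\<^sub>M lborel) (\<lambda>(y, z). heat s (x - y) * heat t (y - z) * v z)"
  proof (rule Bochner_Integration.integrable_bound)
    show "integrable (lborel \<Otimes>\<^sub>M lborel) (\<lambda>p. M * (case p of (y, z) \<Rightarrow> heat s (x - y) * heat t (y - z)))"
      by (intro integrable_mult_right convolution_integrable_pair' heat_translate_integrable heat_integrable)
    have "\<bar>heat s (x - y) * heat t (y - z) * v z\<bar> \<le> \<bar>M * (heat s (x - y) * heat t (y - z))\<bar>" for y z
      using mult_left_mono[OF M(2)[of z], of "heat s (x - y) * heat t (y - z)"] M(1)
      by (simp add: abs_mult heat_nonneg mult.commute)
    then show "AE p in lborel \<Otimes>\<^sub>M lborel. norm (case p of (y, z) \<Rightarrow> heat s (x - y) * heat t (y - z) * v z)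
        \<le> norm (M * (case p of (y, z) \<Rightarrow> heat s (x - y) * heat t (y - z)))" by auto
  qed measurable
  have "heat_flow s (heat_flow t v) x = (LBINT y. (LBINT z. heat s (x - y) * heat t (y - z) * v z))"
    by (simp add: heat_flow_def mult.assoc)
  also have "\<dots> = (LBINT z. (LBINT y. heat s (x - y) * heat t (y - z) * v z))"
    by (rule lborel_pair.Fubini_integral[OF int, symmetric])
  also have "\<dots> = heat_flow (s + t) v x"
    unfolding heat_flow_def
  proof (rule Bochner_Integration.integral_cong[OF refl])
    fix z
    have "(LBINT y. heat s (x - y) * heat t (y - z)) = (LBINT y. heat s ((x - z) - (y + (- z))) * heat t (y + (- z)))"
      by (simp add: algebra_simps)
    also have "\<dots> = (LBINT y. heat s ((x - z) - y) * heat t y)"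
      by (rule lborel_integral_translate[of "\<lambda>y. heat s ((x - z) - y) * heat t y"]) measurable
    also have "\<dots> = heat (s + t) (x - z)" by (rule heat_semigroup[OF s t])
    finally show "(LBINT y. heat s (x - y) * heat t (y - z) * v z) = heat (s + t) (x - z) * v z" by simp
  qed
  finally show ?thesis .
qed

lemma heat_flow_derivative:
  assumes v: "bounded_L2 v" and i: "i \<in> Basis"
  shows "((\<lambda>h. heat_flow t v (x + h *\<^sub>R i)) has_field_derivative heat_grad i t v x) (at 0)"
proof (cases "t > 0")
  case False
  then show ?thesis by (simp add: heat_flow_def heat_grad_def)
next
  case t: True
  note [measurable] = bounded_L2_measurable[OF v]
  obtain M where M: "M \<ge> 0" "\<And>x. \<bar>v x\<bar> \<le> M" by (rule bounded_L2_bound[OF v]) blast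
  define D where "D = 2 powr (real DIM('a) / 2) / sqrt t * exp (1 / (8 * t)) * 2 powr (real DIM('a) / 2)"
  show ?thesis
    unfolding heat_flow_def heat_grad_def
  proof (rule has_field_derivative_integral[where r = 1 and w = "\<lambda>y. D * heat (4 * t) (x - y) * M"])
    show "integrable lborel (\<lambda>y. heat t (x + h *\<^sub>R i - y) * v y)" for h
      by (rule heat_flow_integrable[OF v])
    show "integrable lborel (\<lambda>y. D * heat (4 * t) (x - y) * M)"
      by (intro integrable_mult_left integrable_mult_right heat_translate_integrable)
    fix y
    have eq: "x + h *\<^sub>R i - y = (x - y) + h *\<^sub>R i" for h by simp
    show "((\<lambda>h. heat t (x + h *\<^sub>R i - y) * v y) has_field_derivative - ((x - y) \<bullet> i) / (2 * t) * heat t (x - y) * v y) (at 0)"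
      using DERIV_cmult_right[OF heat_space_derivative[OF t i, of "x - y" 0], of "v y"] unfolding eq by simp
    fix h :: real assume h: "\<bar>h\<bar> < 1"
    have "\<bar>heat t (x + h *\<^sub>R i - y) * v y - heat t (x + 0 *\<^sub>R i - y) * v y\<bar> =
        \<bar>heat t ((x - y) + h *\<^sub>R i) - heat t (x - y)\<bar> * \<bar>v y\<bar>"
      unfolding eq by (simp add: left_diff_distrib[symmetric] abs_mult)
    also have "\<dots> \<le> (\<bar>h\<bar> * (D * heat (4 * t) (x - y))) * M"
      using heat_space_bound[OF t i, of h "x - y"] h M
      by (intro mult_mono) (auto simp: D_def heat_nonneg)
    finally show "\<bar>heat t (x + h *\<^sub>R i - y) * v y - heat t (x + 0 *\<^sub>R i - y) * v y\<bar> \<le> \<bar>h\<bar> * (D * heat (4 * t) (x - y) * M)"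
      by (simp add: mult_ac)
  qed (auto)
qed

lemma heat_grad_bound:
  assumes v: "bounded_L2 (v :: 'a::euclidean_space \<Rightarrow> real)" and i: "i \<in> Basis" and t: "t > 0"
  shows "integrable lborel (\<lambda>y. - ((x - y) \<bullet> i) / (2 * t) * heat t (x - y) * v y)"
    and "\<bar>heat_grad i t v x\<bar> \<le> 2 powr (real DIM('a) / 2) / sqrt t * heat_flow (2 * t) (\<lambda>y. \<bar>v y\<bar>) x"
proof -
  note [measurable] = bounded_L2_measurable[OF v]
  let ?f = "\<lambda>y. - ((x - y) \<bullet> i) / (2 * t) * heat t (x - y) * v y"
  let ?g = "\<lambda>y. 2 powr (real DIM('a) / 2) / sqrt t * (heat (2 * t) (x - y) * \<bar>v y\<bar>)"
  have g: "integrable lborel ?g"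
    by (intro integrable_mult_right heat_flow_integrable[OF bounded_L2_abs[OF v]])
  have le: "\<bar>?f y\<bar> \<le> ?g y" for y
    using mult_right_mono[OF heat_gradient_bound[OF t i, of "x - y"], of "\<bar>v y\<bar>"] t
    by (simp add: abs_mult heat_nonneg mult_ac)
  show f: "integrable lborel ?f"
    by (rule Bochner_Integration.integrable_bound[OF g]) (use order_trans[OF le abs_ge_self] in auto)
  have "\<bar>heat_grad i t v x\<bar> \<le> (LBINT y. \<bar>?f y\<bar>)"
    unfolding heat_grad_def by (rule integral_abs_bound)
  also have "\<dots> \<le> integral\<^sup>L lborel ?g"
    by (rule integral_mono[OF integrable_abs[OF f] g le])
  finally show "\<bar>heat_grad i t v x\<bar> \<le> 2 powr (real DIM('a) / 2) / sqrt t * heat_flow (2 * t) (\<lambda>y. \<bar>v y\<bar>) x"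
    by (simp add: heat_flow_def)
qed

lemma heat_flow_shift:
  "heat_flow t v (x + a) = heat_flow t (\<lambda>y. v (y + a)) x" if [measurable]: "v \<in> borel_measurable borel"
proof -
  have "heat_flow t v (x + a) = (LBINT y. heat t (x + a - (y + a)) * v (y + a))"
    unfolding heat_flow_def
    by (rule lborel_integral_translate[of "\<lambda>y. heat t (x + a - y) * v y", symmetric]) measurable
  then show ?thesis by (simp add: heat_flow_def)
qed

lemma derivative_bound_of_lipschitz:
  fixes f :: "real \<Rightarrow> real"
  assumes "(f has_field_derivative D) (at 0)" and "\<And>h. \<bar>f h - f 0\<bar> \<le> L * \<bar>h\<bar>"
  shows "\<bar>D\<bar> \<le> L"
proof (rule tendsto_upperbound)
  show "((\<lambda>h. \<bar>(f (0 + h) - f 0) / h\<bar>) \<longlongrightarrow> \<bar>D\<bar>) (at 0)"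
    using assms(1) unfolding DERIV_def by (rule tendsto_rabs)
  have "\<bar>(f (0 + h) - f 0) / h\<bar> \<le> L" if "h \<noteq> 0" for h
    using assms(2)[of h] that by (simp add: field_simps)
  then show "eventually (\<lambda>h. \<bar>(f (0 + h) - f 0) / h\<bar> \<le> L) (at 0)"
    by (auto simp: eventually_at_filter)
qed simp

lemma heat_flow_lipschitz:
  assumes v: "bounded_L2 v" and L: "\<And>y h. \<bar>v (y + h *\<^sub>R i) - v y\<bar> \<le> L * \<bar>h\<bar>"
  shows "\<bar>heat_flow t v (x + h *\<^sub>R i) - heat_flow t v x\<bar> \<le> L * \<bar>h\<bar>"
proof (cases "t > 0")
  case t: True
  note [measurable] = bounded_L2_measurable[OF v]
  obtain M where M: "M \<ge> 0" "\<And>x. \<bar>v x\<bar> \<le> M" by (rule bounded_L2_bound[OF v]) blast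
  have vh: "bounded_L2 (\<lambda>y. v (y + h *\<^sub>R i))"
    using v M lborel_integrable_translate_iff[of "\<lambda>y. (v y)\<^sup>2" "h *\<^sub>R i"]
    by (auto simp: bounded_L2_def)
  have "heat_flow t v (x + h *\<^sub>R i) - heat_flow t v x =
      (LBINT y. heat t (x - y) * (v (y + h *\<^sub>R i) - v y))"
    unfolding heat_flow_shift[OF bounded_L2_measurable[OF v]]
    using heat_flow_integrable[OF v] heat_flow_integrable[OF vh]
    by (simp add: heat_flow_def right_diff_distrib)
  also have "\<bar>\<dots>\<bar> \<le> (LBINT y. \<bar>heat t (x - y) * (v (y + h *\<^sub>R i) - v y)\<bar>)"
    by (rule integral_abs_bound)
  also have "\<dots> \<le> (LBINT y. heat t (x - y) * (L * \<bar>h\<bar>))"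
  proof (rule integral_mono)
    show "integrable lborel (\<lambda>y. \<bar>heat t (x - y) * (v (y + h *\<^sub>R i) - v y)\<bar>)"
      using heat_flow_integrable[OF v] heat_flow_integrable[OF vh] by (simp add: right_diff_distrib)
    show "integrable lborel (\<lambda>y. heat t (x - y) * (L * \<bar>h\<bar>))"
      by (intro integrable_mult_left heat_translate_integrable)
    show "\<bar>heat t (x - y) * (v (y + h *\<^sub>R i) - v y)\<bar> \<le> heat t (x - y) * (L * \<bar>h\<bar>)" for y
      using L[of y h] by (simp add: abs_mult heat_nonneg mult_left_mono)
  qed
  also have "\<dots> = L * \<bar>h\<bar>" using t by (simp add: heat_translate_integral)
  finally show ?thesis .
next
  case False
  have "0 \<le> L * \<bar>h\<bar>" using L[of x h] by linarith
  then show ?thesis using False by (simp add: heat_flow_def)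
qed

text \<open>The flow averages translates and so keeps Lipschitz constants. In contrast with
  \<open>heat_grad_bound\<close> nothing is lost as t tends to 0, and gradients can be integrated
  against any L1 weight in time.\<close>

lemma heat_grad_le_lipschitz:
  assumes v: "bounded_L2 v" and i: "i \<in> Basis" and L: "\<And>y h. \<bar>v (y + h *\<^sub>R i) - v y\<bar> \<le> L * \<bar>h\<bar>"
  shows "\<bar>heat_grad i t v x\<bar> \<le> L"
  by (rule derivative_bound_of_lipschitz[OF heat_flow_derivative[OF v i]])
    (use heat_flow_lipschitz[OF v L] in simp)

section \<open>Commutators of the heat flow with vector fields\<close>

definition dheat :: "'a::euclidean_space \<Rightarrow> real \<Rightarrow> 'a \<Rightarrow> real" where
  "dheat i t z = - (z \<bullet> i) / (2 * t) * heat t z"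

lemma dheat_measurable [measurable (raw)]:
  assumes [measurable]: "f \<in> borel_measurable M" "g \<in> borel_measurable M"
  shows "(\<lambda>x. dheat i (f x) (g x)) \<in> borel_measurable M"
  unfolding dheat_def by measurable

lemma heat_grad_eq: "heat_grad i t v x = (LBINT y. dheat i t (x - y) * v y)"
  by (simp add: heat_grad_def dheat_def)

lemma dheat_minus: "dheat i t (- z) = - dheat i t z"
  by (simp add: dheat_def heat_minus)

lemma dheat_integrable:
  assumes i: "i \<in> Basis"
  shows "integrable lborel (dheat i t)"
proof (cases "t > 0")
  case t: True
  show ?thesis
  proof (rule Bochner_Integration.integrable_bound)
    show "integrable lborel (\<lambda>z::'a. 2 powr (real DIM('a) / 2) * heat (2 * t) z / sqrt t)"
      using heat_integrable[of "2 * t", where 'a = 'a] by simp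
    have le: "\<bar>dheat i t z\<bar> \<le> 2 powr (real DIM('a) / 2) * heat (2 * t) z / sqrt t" for z
      using heat_gradient_bound[OF t i, of z] t by (simp add: dheat_def abs_mult heat_nonneg)
    show "AE z in lborel. norm (dheat i t z) \<le> norm (2 powr (real DIM('a) / 2) * heat (2 * t) z / sqrt t)"
      unfolding real_norm_def by (intro AE_I2 order_trans[OF le abs_ge_self])
  qed measurable
next
  case False
  then have "dheat i t = (\<lambda>z. 0)" by (simp add: dheat_def fun_eq_iff)
  then show ?thesis by simp
qed

text \<open>A factor |z| turns the t^(-1/2) of a gradient into the scale invariant second moment.
  Commutators with Lipschitz functions are therefore bounded uniformly in t.\<close>

lemma norm_dheat_le:
  assumes t: "t > 0" and i: "i \<in> Basis"
  shows "norm z * \<bar>dheat i t (z :: 'a::euclidean_space)\<bar> \<le> 2 * (2 powr (real DIM('a) / 2) * heat (2 * t) z)"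
proof -
  have "norm z * \<bar>dheat i t z\<bar> = norm z * \<bar>z \<bullet> i\<bar> / (2 * t) * heat t z"
    using t by (simp add: dheat_def abs_mult heat_nonneg)
  also have "\<dots> \<le> norm z * norm z / (2 * t) * heat t z"
    using t Basis_le_norm[OF i, of z] by (intro mult_right_mono divide_right_mono mult_left_mono heat_nonneg) auto
  also have "\<dots> = 2 * ((norm z)\<^sup>2 / (4 * t) * heat t z)" by (simp add: power2_eq_square)
  also have "\<dots> \<le> 2 * (2 powr (real DIM('a) / 2) * heat (2 * t) z)"
    by (rule mult_left_mono[OF heat_moment_bound[OF t]]) simp
  finally show ?thesis .
qed

abbreviation lborel2 :: "('a::euclidean_space \<times> 'a) measure" where
  "lborel2 \<equiv> lborel \<Otimes>\<^sub>M lborel"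

definition heat_form :: "real \<Rightarrow> ('a::euclidean_space \<Rightarrow> real) \<Rightarrow> ('a \<Rightarrow> real) \<Rightarrow> real" where
  "heat_form t a b = (\<integral>(x, y). a x * b y * heat t (x - y) \<partial>lborel2)"

text \<open>The bilinear form of the commutator of multiplication by \<open>X\<close> with the
  \<open>i\<close>-th derivative of the heat operator.\<close>

definition commutator_form ::
    "('a::euclidean_space \<Rightarrow> real) \<Rightarrow> 'a \<Rightarrow> real \<Rightarrow> ('a \<Rightarrow> real) \<Rightarrow> ('a \<Rightarrow> real) \<Rightarrow> real" where
  "commutator_form X i t a b = (\<integral>(x, y). a x * b y * ((X x - X y) * dheat i t (x - y)) \<partial>lborel2)"

text \<open>The kernel is z . grad of the heat kernel at z = x - y, which is what
  \<open>commutator_form\<close> becomes for X(x) = x after summation over the coordinates.\<close>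

definition dilation_form :: "real \<Rightarrow> ('a::euclidean_space \<Rightarrow> real) \<Rightarrow> ('a \<Rightarrow> real) \<Rightarrow> real" where
  "dilation_form t a b = (\<integral>(x, y). a x * b y * (- (norm (x - y))\<^sup>2 / (2 * t) * heat t (x - y)) \<partial>lborel2)"

definition energy :: "('a::euclidean_space \<Rightarrow> real) \<Rightarrow> real" where
  "energy a = (LBINT x. (a x)\<^sup>2)"

lemma bounded_L2_square_integrable: "bounded_L2 a \<Longrightarrow> integrable lborel (\<lambda>x. (a x)\<^sup>2)"
  by (simp add: bounded_L2_def)

lemma heat_form_integrable:
  assumes a: "bounded_L2 a" and b: "bounded_L2 b"
  shows "integrable lborel2 (\<lambda>(x, y). a x * b y * heat t (x - y))"
    and "(\<integral>p. \<bar>case p of (x, y) \<Rightarrow> a x * b y * heat t (x - y)\<bar> \<partial>lborel2) \<le> energy a + energy b"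
proof -
  note [measurable] = bounded_L2_measurable[OF a] bounded_L2_measurable[OF b]
  note Y = young_integrable[OF _ _ bounded_L2_square_integrable[OF a] bounded_L2_square_integrable[OF b] heat_integrable[of t]]
  show "integrable lborel2 (\<lambda>(x, y). a x * b y * heat t (x - y))" by (rule Y(1)) measurable
  have e: "0 \<le> energy a + energy b" unfolding energy_def by (intro add_nonneg_nonneg integral_nonneg_AE) auto
  have "(\<integral>p. \<bar>case p of (x, y) \<Rightarrow> a x * b y * heat t (x - y)\<bar> \<partial>lborel2) \<le> (energy a + energy b) * (LBINT x. \<bar>heat t (x::'a)\<bar>)"
    unfolding energy_def by (rule Y(2)) measurable
  also have "(LBINT x. \<bar>heat t (x::'a)\<bar>) \<le> 1"
    using heat_integral[of t, where 'a = 'a] by (cases "t > 0") (auto simp: heat_nonneg)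
  finally show "(\<integral>p. \<bar>case p of (x, y) \<Rightarrow> a x * b y * heat t (x - y)\<bar> \<partial>lborel2) \<le> energy a + energy b"
    using e by (simp add: mult_left_mono)
qed

lemma heat_form_eq:
  assumes a: "bounded_L2 a" and b: "bounded_L2 b"
  shows "heat_form t a b = (LBINT x. a x * heat_flow t b x)"
    and "integrable lborel (\<lambda>x. a x * heat_flow t b x)"
    and "(LBINT x. \<bar>a x * heat_flow t b x\<bar>) \<le> energy a + energy b"
proof -
  have eq: "(LBINT y. a x * b y * heat t (x - y)) = a x * heat_flow t b x" for x
    by (simp add: heat_flow_def mult_ac)
  note I = heat_form_integrable(1)[OF a b, of t]
  show "heat_form t a b = (LBINT x. a x * heat_flow t b x)"
    unfolding heat_form_def lborel_pair.integral_fst[OF I, symmetric] eq ..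
  show int: "integrable lborel (\<lambda>x. a x * heat_flow t b x)"
    using lborel_pair.integrable_fst[OF I] unfolding eq .
  have I': "integrable lborel2 (\<lambda>(x, y). \<bar>a x * b y * heat t (x - y)\<bar>)"
    using integrable_abs[OF I] by (simp add: case_prod_beta')
  have "(LBINT x. \<bar>a x * heat_flow t b x\<bar>) \<le> (LBINT x. (LBINT y. \<bar>a x * b y * heat t (x - y)\<bar>))"
  proof (rule integral_mono)
    show "integrable lborel (\<lambda>x. \<bar>a x * heat_flow t b x\<bar>)" using int by simp
    show "integrable lborel (\<lambda>x. LBINT y. \<bar>a x * b y * heat t (x - y)\<bar>)"
      by (rule lborel_pair.integrable_fst[OF I'])
    show "\<bar>a x * heat_flow t b x\<bar> \<le> (LBINT y. \<bar>a x * b y * heat t (x - y)\<bar>)" for x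
      unfolding eq[symmetric] by (rule integral_abs_bound)
  qed
  also have "\<dots> = (\<integral>p. \<bar>case p of (x, y) \<Rightarrow> a x * b y * heat t (x - y)\<bar> \<partial>lborel2)"
    using lborel_pair.integral_fst[OF I'] by (simp add: case_prod_beta')
  finally show "(LBINT x. \<bar>a x * heat_flow t b x\<bar>) \<le> energy a + energy b"
    using heat_form_integrable(2)[OF a b, of t] by linarith
qed

lemma heat_form_bound:
  assumes "bounded_L2 a" "bounded_L2 b"
  shows "\<bar>heat_form t a b\<bar> \<le> energy a + energy b"
  unfolding heat_form_eq(1)[OF assms] by (rule order_trans[OF integral_abs_bound heat_form_eq(3)[OF assms]])

lemma heat_form_commute:
  assumes a: "bounded_L2 a" and b: "bounded_L2 b"
  shows "heat_form t a b = heat_form t b a"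
proof -
  note [measurable] = bounded_L2_measurable[OF a] bounded_L2_measurable[OF b]
  have "heat_form t b a = (\<integral>(x, y). b y * a x * heat t (y - x) \<partial>lborel2)"
    unfolding heat_form_def
    by (subst lborel_pair.integral_product_swap[symmetric]) (auto simp: case_prod_beta')
  also have "(\<lambda>(x, y). b y * a x * heat t (y - x)) = (\<lambda>(x, y). a x * b y * heat t (x - y))"
    using heat_commute by (auto simp: fun_eq_iff mult_ac)
  finally show ?thesis by (simp add: heat_form_def)
qed

text \<open>The bound on \<open>d\<close> anticipates the Lipschitz constant 2 of the truncated
  field; together with the 2 of \<open>norm_dheat_le\<close> it makes the 4.\<close>

lemma commutator_dominated:
  assumes i: "i \<in> Basis" and X: "\<bar>d\<bar> \<le> 2 * norm (z :: 'a::euclidean_space)"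
  shows "\<bar>p * (d * dheat i t z)\<bar> \<le> \<bar>p * (4 * 2 powr (real DIM('a) / 2)) * heat (2 * t) z\<bar>"
proof (cases "t > 0")
  case t: True
  have "\<bar>d * dheat i t z\<bar> \<le> 2 * (norm z * \<bar>dheat i t z\<bar>)"
    using mult_right_mono[OF X abs_ge_zero[of "dheat i t z"]] by (simp add: abs_mult)
  also have "\<dots> \<le> 2 * (2 * (2 powr (real DIM('a) / 2) * heat (2 * t) z))"
    by (rule mult_left_mono[OF norm_dheat_le[OF t i]]) simp
  also have "\<dots> = 4 * 2 powr (real DIM('a) / 2) * heat (2 * t) z" by simp
  finally have "\<bar>p\<bar> * \<bar>d * dheat i t z\<bar> \<le> \<bar>p\<bar> * (4 * 2 powr (real DIM('a) / 2) * heat (2 * t) z)"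
    by (rule mult_left_mono) simp
  then show ?thesis by (simp add: abs_mult heat_nonneg mult_ac)
qed (simp add: dheat_def)

lemma commutator_form_integrable:
  assumes a: "bounded_L2 a" and b: "bounded_L2 b" and i: "i \<in> Basis"
    and [measurable]: "X \<in> borel_measurable borel"
    and X: "\<And>x y. \<bar>X x - X y\<bar> \<le> 2 * norm (x - y :: 'a::euclidean_space)"
  shows "integrable lborel2 (\<lambda>(x, y). a x * b y * ((X x - X y) * dheat i t (x - y)))"
    and "\<bar>commutator_form X i t a b\<bar> \<le> 4 * 2 powr (real DIM('a) / 2) * (energy a + energy b)"
proof -
  note [measurable] = bounded_L2_measurable[OF a] bounded_L2_measurable[OF b]
  let ?c = "4 * 2 powr (real DIM('a) / 2)"
  let ?f = "\<lambda>(x, y). a x * b y * ((X x - X y) * dheat i t (x - y))"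
  let ?g = "\<lambda>(x, y). a x * b y * heat (2 * t) (x - y)"
  note I = heat_form_integrable[OF a b, of "2 * t"]
  have le: "\<bar>?f p\<bar> \<le> ?c * \<bar>?g p\<bar>" for p
    using commutator_dominated[OF i X, of "a (fst p) * b (snd p)" "fst p" "snd p" t]
    by (cases p) (simp add: abs_mult mult_ac)
  show int: "integrable lborel2 ?f"
  proof (rule Bochner_Integration.integrable_bound)
    show "integrable lborel2 (\<lambda>p. ?c * \<bar>?g p\<bar>)" using I(1) by (intro integrable_mult_right integrable_abs)
    show "AE p in lborel2. norm (?f p) \<le> norm (?c * \<bar>?g p\<bar>)"
      using order_trans[OF le abs_ge_self] by simp
  qed measurable
  have "\<bar>commutator_form X i t a b\<bar> \<le> (\<integral>p. \<bar>?f p\<bar> \<partial>lborel2)"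
    unfolding commutator_form_def by (rule integral_abs_bound)
  also have "\<dots> \<le> (\<integral>p. ?c * \<bar>?g p\<bar> \<partial>lborel2)"
    by (rule integral_mono[OF integrable_abs[OF int] integrable_mult_right[OF integrable_abs[OF I(1)]] le])
  also have "\<dots> \<le> ?c * (energy a + energy b)"
    using I(2) by simp
  finally show "\<bar>commutator_form X i t a b\<bar> \<le> ?c * (energy a + energy b)" .
qed

text \<open>\<open>dheat\<close> is odd, so interchanging x and y in the second integral produces
  the part with -X(y). Boundedness of \<open>X\<close> keeps X a and X b square integrable, so both
  integrals converge absolutely by themselves, which the unbounded field X(x) = x would not
  ensure.\<close>

lemma commutator_form_eq:
  assumes a: "bounded_L2 a" and b: "bounded_L2 b" and i: "i \<in> Basis"
    and [measurable]: "X \<in> borel_measurable borel" and X: "\<And>x. \<bar>X x\<bar> \<le> D"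
  shows "commutator_form X i t a b =
    (LBINT x. X x * a x * heat_grad i t b x) + (LBINT x. X x * b x * heat_grad i t a x)"
proof -
  note [measurable] = bounded_L2_measurable[OF a] bounded_L2_measurable[OF b]
  have sq: "integrable lborel (\<lambda>x. (X x * v x)\<^sup>2)" if "bounded_L2 v" for v
  proof (rule Bochner_Integration.integrable_bound)
    note [measurable] = bounded_L2_measurable[OF that]
    show "integrable lborel (\<lambda>x. D\<^sup>2 * (v x)\<^sup>2)" using that by (simp add: bounded_L2_def)
    have "(X x)\<^sup>2 \<le> D\<^sup>2" for x using X[of x] by (simp add: abs_le_square_iff[symmetric])
    then show "AE x in lborel. norm ((X x * v x)\<^sup>2) \<le> norm (D\<^sup>2 * (v x)\<^sup>2)"
      by (simp add: power_mult_distrib mult_right_mono)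
    show "(\<lambda>x. (X x * v x)\<^sup>2) \<in> borel_measurable lborel" by measurable
  qed
  have I: "integrable lborel2 (\<lambda>(x, y). (X x * v x) * w y * dheat i t (x - y))"
    and T: "(LBINT x. X x * v x * heat_grad i t w x) = (\<integral>(x, y). (X x * v x) * w y * dheat i t (x - y) \<partial>lborel2)"
    if v: "bounded_L2 v" and w: "bounded_L2 w" for v w
  proof -
    note [measurable] = bounded_L2_measurable[OF v] bounded_L2_measurable[OF w]
    show I: "integrable lborel2 (\<lambda>(x, y). (X x * v x) * w y * dheat i t (x - y))"
      by (rule young_integrable(1)[OF _ _ sq[OF v] bounded_L2_square_integrable[OF w] dheat_integrable[OF i]]) measurable
    have "(LBINT y. (X x * v x) * w y * dheat i t (x - y)) = X x * v x * heat_grad i t w x" for x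
      by (simp add: heat_grad_eq mult_ac)
    then show "(LBINT x. X x * v x * heat_grad i t w x) = (\<integral>(x, y). (X x * v x) * w y * dheat i t (x - y) \<partial>lborel2)"
      unfolding lborel_pair.integral_fst[OF I, symmetric] by simp
  qed
  have swap: "(\<integral>(x, y). (X x * b x) * a y * dheat i t (x - y) \<partial>lborel2) = (\<integral>(x, y). (X y * b y) * a x * dheat i t (y - x) \<partial>lborel2)"
    by (subst lborel_pair.integral_product_swap[symmetric]) (auto simp: case_prod_beta')
  have I2: "integrable lborel2 (\<lambda>(x, y). (X y * b y) * a x * dheat i t (y - x))"
    using lborel_pair.integrable_product_swap[OF I[OF b a]] by (simp add: case_prod_beta')
  have "(LBINT x. X x * a x * heat_grad i t b x) + (LBINT x. X x * b x * heat_grad i t a x) =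
    (\<integral>p. (case p of (x, y) \<Rightarrow> (X x * a x) * b y * dheat i t (x - y)) + (case p of (x, y) \<Rightarrow> (X y * b y) * a x * dheat i t (y - x)) \<partial>lborel2)"
    unfolding T[OF a b] T[OF b a] swap by (rule Bochner_Integration.integral_add[OF I[OF a b] I2, symmetric])
  also have "(\<lambda>p. (case p of (x, y) \<Rightarrow> (X x * a x) * b y * dheat i t (x - y)) + (case p of (x, y) \<Rightarrow> (X y * b y) * a x * dheat i t (y - x))) =
    (\<lambda>(x, y). a x * b y * ((X x - X y) * dheat i t (x - y)))"
  proof (rule ext, clarify)
    fix x y
    have "dheat i t (y - x) = - dheat i t (x - y)" using dheat_minus[of i t "x - y"] by simp
    then show "X x * a x * b y * dheat i t (x - y) + X y * b y * a x * dheat i t (y - x) =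
        a x * b y * ((X x - X y) * dheat i t (x - y))" by (simp add: algebra_simps)
  qed
  finally show ?thesis by (simp add: commutator_form_def)
qed

lemma commutator_form_tendsto:
  assumes a: "bounded_L2 a" and b: "bounded_L2 b" and i: "i \<in> Basis"
    and [measurable]: "\<And>m. X m \<in> borel_measurable borel"
    and X: "\<And>m x y. \<bar>X m x - X m y\<bar> \<le> 2 * norm (x - y :: 'a::euclidean_space)"
    and lim: "\<And>x. (\<lambda>m. X m x) \<longlonglongrightarrow> x \<bullet> i"
  shows "(\<lambda>m. commutator_form (X m) i t a b) \<longlonglongrightarrow> commutator_form (\<lambda>x. x \<bullet> i) i t a b"
  unfolding commutator_form_def
proof (rule integral_dominated_convergence[where w = "\<lambda>(x, y). \<bar>a x * b y * (4 * 2 powr (real DIM('a) / 2)) * heat (2 * t) (x - y)\<bar>"])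
  note [measurable] = bounded_L2_measurable[OF a] bounded_L2_measurable[OF b]
  show "(\<lambda>(x, y). a x * b y * ((x \<bullet> i - y \<bullet> i) * dheat i t (x - y))) \<in> borel_measurable lborel2" by measurable
  show "(\<lambda>(x, y). a x * b y * ((X m x - X m y) * dheat i t (x - y))) \<in> borel_measurable lborel2" for m by measurable
  have "integrable lborel2 (\<lambda>p. \<bar>4 * 2 powr (real DIM('a) / 2) * (case p of (x, y) \<Rightarrow> a x * b y * heat (2 * t) (x - y))\<bar>)"
    by (intro integrable_abs integrable_mult_right heat_form_integrable a b)
  then show "integrable lborel2 (\<lambda>(x, y). \<bar>a x * b y * (4 * 2 powr (real DIM('a) / 2)) * heat (2 * t) (x - y)\<bar>)"
    by (simp add: case_prod_beta' mult_ac)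
  show "AE p in lborel2. (\<lambda>m. case p of (x, y) \<Rightarrow> a x * b y * ((X m x - X m y) * dheat i t (x - y))) \<longlonglongrightarrow>
      (case p of (x, y) \<Rightarrow> a x * b y * ((x \<bullet> i - y \<bullet> i) * dheat i t (x - y)))"
    by (rule AE_I2) (auto intro!: tendsto_intros lim)
  show "AE p in lborel2. norm (case p of (x, y) \<Rightarrow> a x * b y * ((X m x - X m y) * dheat i t (x - y)))
      \<le> (case p of (x, y) \<Rightarrow> \<bar>a x * b y * (4 * 2 powr (real DIM('a) / 2)) * heat (2 * t) (x - y)\<bar>)" for m
    using commutator_dominated[OF i X] by (intro AE_I2) (auto simp: case_prod_beta')
qed

lemma commutator_form_sum:
  assumes a: "bounded_L2 a" and b: "bounded_L2 (b :: 'a::euclidean_space \<Rightarrow> real)"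
  shows "(\<Sum>i\<in>Basis. commutator_form (\<lambda>x. x \<bullet> i) i t a b) = dilation_form t a b"
proof -
  note [measurable] = bounded_L2_measurable[OF a] bounded_L2_measurable[OF b]
  have L: "\<bar>x \<bullet> i - y \<bullet> i\<bar> \<le> 2 * norm (x - y)" if "i \<in> Basis" for x y i :: 'a
    using Basis_le_norm[OF that, of "x - y"] norm_ge_zero[of "x - y"] unfolding inner_diff_left by linarith
  have "(\<Sum>i\<in>Basis. commutator_form (\<lambda>x. x \<bullet> i) i t a b) =
    (\<integral>p. (\<Sum>i\<in>Basis. case p of (x, y) \<Rightarrow> a x * b y * ((x \<bullet> i - y \<bullet> i) * dheat i t (x - y))) \<partial>lborel2)"
    unfolding commutator_form_def
    by (rule Bochner_Integration.integral_sum[symmetric], rule commutator_form_integrable(1)[OF a b])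
      (auto intro: L)
  also have "(\<lambda>p. \<Sum>i\<in>Basis. case p of (x, y) \<Rightarrow> a x * b y * ((x \<bullet> i - y \<bullet> i) * dheat i t (x - y))) =
     (\<lambda>(x, y). a x * b y * (- (norm (x - y))\<^sup>2 / (2 * t) * heat t (x - y)))"
  proof (rule ext, clarify)
    fix x y :: 'a
    have n: "(norm (x - y))\<^sup>2 = (\<Sum>i\<in>Basis. (x \<bullet> i - y \<bullet> i) * (x \<bullet> i - y \<bullet> i))"
      by (subst power2_norm_eq_inner, subst euclidean_inner) (simp add: inner_diff_left)
    have "(\<Sum>i\<in>Basis. a x * b y * ((x \<bullet> i - y \<bullet> i) * dheat i t (x - y))) =
        (\<Sum>i\<in>Basis. ((x \<bullet> i - y \<bullet> i) * (x \<bullet> i - y \<bullet> i)) * (- (a x * b y * heat t (x - y)) / (2 * t)))"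
      by (rule sum.cong) (auto simp: dheat_def inner_diff_left simp del: minus_diff_eq)
    also have "\<dots> = a x * b y * (- (norm (x - y))\<^sup>2 / (2 * t) * heat t (x - y))"
      unfolding sum_distrib_right[symmetric] n[symmetric] by simp
    finally show "(\<Sum>i\<in>Basis. a x * b y * ((x \<bullet> i - y \<bullet> i) * dheat i t (x - y))) =
        a x * b y * (- (norm (x - y))\<^sup>2 / (2 * t) * heat t (x - y))" .
  qed
  finally show ?thesis by (simp add: dilation_form_def)
qed

text \<open>The heat kernel is homogeneous of degree -n under z -> c z, t -> c^2 t, so t times its
  time derivative is -(z . grad + n)/2 applied to it. Limits of commutators can therefore be read
  off from derivatives under dilation of time.\<close>

lemma heat_form_derivative:
  assumes a: "bounded_L2 a" and b: "bounded_L2 (b :: 'a::euclidean_space \<Rightarrow> real)" and t: "t > 0"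
  shows "((\<lambda>h. heat_form (t * (1 + h)) a b) has_field_derivative
      - (dilation_form t a b + real DIM('a) * heat_form t a b) / 2) (at 0)"
proof -
  note [measurable] = bounded_L2_measurable[OF a] bounded_L2_measurable[OF b]
  let ?c = "2 * (1 + real DIM('a) / 2) * 8 powr (real DIM('a) / 2)"
  let ?d = "\<lambda>p. case p of (x, y) \<Rightarrow> a x * b y * (((norm (x - y))\<^sup>2 / (4 * t) - real DIM('a) / 2) * heat t (x - y))"
  let ?m = "\<lambda>p. case p of (x, y) \<Rightarrow> a x * b y * (- (norm (x - y))\<^sup>2 / (2 * t) * heat t (x - y))"
  have "((\<lambda>h. heat_form (t * (1 + h)) a b) has_field_derivative (\<integral>p. ?d p \<partial>lborel2)) (at 0)"
    unfolding heat_form_def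
  proof (rule has_field_derivative_integral[where r = "1/2" and w = "\<lambda>p. ?c * \<bar>case p of (x, y) \<Rightarrow> a x * b y * heat (4 * t) (x - y)\<bar>"])
    show "integrable lborel2 (\<lambda>(x, y). a x * b y * heat (t * (1 + h)) (x - y))" for h
      by (rule heat_form_integrable[OF a b])
    show "integrable lborel2 (\<lambda>p. ?c * \<bar>case p of (x, y) \<Rightarrow> a x * b y * heat (4 * t) (x - y)\<bar>)"
      by (intro integrable_mult_right integrable_abs heat_form_integrable a b)
    fix p :: "'a \<times> 'a"
    obtain x y where p: "p = (x, y)" by (cases p)
    have "((\<lambda>s. heat s (x - y)) has_field_derivative ((norm (x - y))\<^sup>2 / (4 * t) - real DIM('a) / 2) / t * heat t (x - y)) (at (t * (1 + 0)))"
      using heat_time_derivative[OF t, of "x - y"] by simp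
    moreover have "((\<lambda>h. t * (1 + h)) has_field_derivative t) (at 0)"
      by (auto intro!: derivative_eq_intros)
    ultimately have "((\<lambda>h. heat (t * (1 + h)) (x - y)) has_field_derivative ((norm (x - y))\<^sup>2 / (4 * t) - real DIM('a) / 2) / t * heat t (x - y) * t) (at 0)"
      by (rule DERIV_chain2[where f = "\<lambda>s. heat s (x - y)" and g = "\<lambda>h. t * (1 + h)"])
    then have "((\<lambda>h. heat (t * (1 + h)) (x - y)) has_field_derivative ((norm (x - y))\<^sup>2 / (4 * t) - real DIM('a) / 2) * heat t (x - y)) (at 0)"
      using t by simp
    then show "((\<lambda>h. case p of (x, y) \<Rightarrow> a x * b y * heat (t * (1 + h)) (x - y)) has_field_derivative ?d p) (at 0)"
      unfolding p prod.case by (rule DERIV_cmult)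
    fix h :: real assume h: "\<bar>h\<bar> < 1 / 2"
    have "\<bar>a x * b y * heat (t * (1 + h)) (x - y) - a x * b y * heat (t * (1 + 0)) (x - y)\<bar> =
        \<bar>a x * b y\<bar> * \<bar>heat (t * (1 + h)) (x - y) - heat t (x - y)\<bar>"
      by (simp add: right_diff_distrib[symmetric] abs_mult)
    also have "\<dots> \<le> \<bar>a x * b y\<bar> * (\<bar>h\<bar> * (?c * heat (4 * t) (x - y)))"
      using heat_time_bound[OF t, of h "x - y"] h by (intro mult_left_mono) auto
    finally show "\<bar>(case p of (x, y) \<Rightarrow> a x * b y * heat (t * (1 + h)) (x - y)) -
        (case p of (x, y) \<Rightarrow> a x * b y * heat (t * (1 + 0)) (x - y))\<bar>
        \<le> \<bar>h\<bar> * (?c * \<bar>case p of (x, y) \<Rightarrow> a x * b y * heat (4 * t) (x - y)\<bar>)"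
      unfolding p prod.case by (simp add: abs_mult heat_nonneg mult_ac)
  qed (auto)
  also have "(\<integral>p. ?d p \<partial>lborel2) = - (dilation_form t a b + real DIM('a) * heat_form t a b) / 2"
  proof -
    have m: "integrable lborel2 ?m"
    proof (rule Bochner_Integration.integrable_bound)
      show "integrable lborel2 (\<lambda>p. 2 * 2 powr (real DIM('a) / 2) * (case p of (x, y) \<Rightarrow> a x * b y * heat (2 * t) (x - y)))"
        by (intro integrable_mult_right heat_form_integrable a b)
      have "\<bar>?m (x, y)\<bar> \<le> \<bar>2 * 2 powr (real DIM('a) / 2) * (a x * b y * heat (2 * t) (x - y))\<bar>" for x y
      proof -
        have "\<bar>?m (x, y)\<bar> = \<bar>a x * b y\<bar> * (2 * ((norm (x - y))\<^sup>2 / (4 * t) * heat t (x - y)))"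
          using t by (simp add: abs_mult heat_nonneg)
        also have "\<dots> \<le> \<bar>a x * b y\<bar> * (2 * (2 powr (real DIM('a) / 2) * heat (2 * t) (x - y)))"
          using heat_moment_bound[OF t, of "x - y"] by (intro mult_left_mono) auto
        finally show ?thesis by (simp add: abs_mult heat_nonneg mult_ac)
      qed
      then show "AE p in lborel2. norm (?m p) \<le> norm (2 * 2 powr (real DIM('a) / 2) * (case p of (x, y) \<Rightarrow> a x * b y * heat (2 * t) (x - y)))"
        by (intro AE_I2) (auto simp: case_prod_beta')
    qed measurable
    have "?d p = - (1 / 2) * ?m p - real DIM('a) / 2 * (case p of (x, y) \<Rightarrow> a x * b y * heat t (x - y))" for p
      by (cases p) (simp add: field_simps)
    then have "(\<integral>p. ?d p \<partial>lborel2) = (\<integral>p. - (1 / 2) * ?m p - real DIM('a) / 2 * (case p of (x, y) \<Rightarrow> a x * b y * heat t (x - y)) \<partial>lborel2)"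
      by (rule Bochner_Integration.integral_cong[OF refl])
    also have "\<dots> = - (1 / 2) * dilation_form t a b - real DIM('a) / 2 * heat_form t a b"
      using m heat_form_integrable(1)[OF a b, of t]
      unfolding dilation_form_def heat_form_def
      by (subst Bochner_Integration.integral_diff) (auto simp del: mult_minus_left)
    finally show ?thesis by simp
  qed
  finally show ?thesis .
qed

lemma heat_form_lipschitz:
  assumes a: "bounded_L2 a" and b: "bounded_L2 (b :: 'a::euclidean_space \<Rightarrow> real)" and h: "\<bar>h\<bar> < 1 / 2" and t: "t > 0"
  shows "\<bar>heat_form (t * (1 + h)) a b - heat_form t a b\<bar> \<le>
    \<bar>h\<bar> * (2 * (1 + real DIM('a) / 2) * 8 powr (real DIM('a) / 2) * (energy a + energy b))"
proof -
  let ?c = "2 * (1 + real DIM('a) / 2) * 8 powr (real DIM('a) / 2)"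
  let ?f = "\<lambda>s p. case p of (x, y) \<Rightarrow> a x * b y * heat s (x - y)"
  have I: "integrable lborel2 (?f s)" for s by (rule heat_form_integrable[OF a b])
  have "\<bar>heat_form (t * (1 + h)) a b - heat_form t a b\<bar> = \<bar>\<integral>p. ?f (t * (1 + h)) p - ?f t p \<partial>lborel2\<bar>"
    unfolding heat_form_def by (subst Bochner_Integration.integral_diff[OF I I]) simp
  also have "\<dots> \<le> (\<integral>p. \<bar>?f (t * (1 + h)) p - ?f t p\<bar> \<partial>lborel2)" by (rule integral_abs_bound)
  also have "\<dots> \<le> (\<integral>p. \<bar>h\<bar> * ?c * \<bar>?f (4 * t) p\<bar> \<partial>lborel2)"
  proof (rule integral_mono)
    show "integrable lborel2 (\<lambda>p. \<bar>?f (t * (1 + h)) p - ?f t p\<bar>)"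
      by (intro integrable_abs Bochner_Integration.integrable_diff I)
    show "integrable lborel2 (\<lambda>p. \<bar>h\<bar> * ?c * \<bar>?f (4 * t) p\<bar>)"
      by (intro integrable_mult_right integrable_abs I)
    fix p :: "'a \<times> 'a"
    obtain x y where p: "p = (x, y)" by (cases p)
    have "\<bar>a x * b y * heat (t * (1 + h)) (x - y) - a x * b y * heat t (x - y)\<bar> =
        \<bar>a x * b y\<bar> * \<bar>heat (t * (1 + h)) (x - y) - heat t (x - y)\<bar>"
      by (simp add: right_diff_distrib[symmetric] abs_mult)
    also have "\<dots> \<le> \<bar>a x * b y\<bar> * (\<bar>h\<bar> * (?c * heat (4 * t) (x - y)))"
      using heat_time_bound[OF t, of h "x - y"] h by (intro mult_left_mono) auto
    finally show "\<bar>?f (t * (1 + h)) p - ?f t p\<bar> \<le> \<bar>h\<bar> * ?c * \<bar>?f (4 * t) p\<bar>"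
      unfolding p prod.case by (simp add: abs_mult heat_nonneg mult_ac)
  qed
  also have "\<dots> = \<bar>h\<bar> * ?c * (\<integral>p. \<bar>?f (4 * t) p\<bar> \<partial>lborel2)" by simp
  also have "\<dots> \<le> \<bar>h\<bar> * ?c * (energy a + energy b)"
    by (intro mult_left_mono heat_form_integrable(2)[OF a b]) auto
  finally show ?thesis by (simp add: mult_ac)
qed

section \<open>The Pohozaev identity for a Riesz potential\<close>

lemma integrable_tensor:
  fixes f :: "'a::euclidean_space \<Rightarrow> real" and h :: "'b::euclidean_space \<Rightarrow> real"
  assumes f: "integrable lborel f" and h: "integrable lborel h"
  shows "integrable (lborel \<Otimes>\<^sub>M lborel) (\<lambda>(x, y). f x * h y)"
proof (rule lborel_pair.Fubini_integrable)
  have [measurable]: "f \<in> borel_measurable borel" "h \<in> borel_measurable borel" using f h by auto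
  show "(\<lambda>(x, y). f x * h y) \<in> borel_measurable (lborel \<Otimes>\<^sub>M lborel)" by measurable
qed (use f h in \<open>auto simp: abs_mult\<close>)

text \<open>Scalar and linear: \<open>u\<close> is the Riesz potential of \<open>g\<close>, written
  through the heat flow. It is applied to one component of the system at a time, and how
  \<open>g\<close> depends on \<open>u\<close> enters only in the final argument.\<close>

locale riesz_pair =
  fixes \<beta> :: real and u g :: "'a::euclidean_space \<Rightarrow> real"
  assumes beta: "1 / 2 < \<beta>" "\<beta> < real DIM('a) / 4"
    and u: "bounded_L2 u" and g: "bounded_L2 g"
    and rep: "\<And>x. u x = frac_int \<beta> (\<lambda>t. heat_flow t g x) 0"
begin

lemmas [measurable] = bounded_L2_measurable[OF u] bounded_L2_measurable[OF g]

lemma beta_pos: "0 < \<beta>" using beta(1) by simp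

lemma flow_decay:
  obtains C where "C \<ge> 0" "\<And>t x. t > 0 \<Longrightarrow> \<bar>heat_flow t g x\<bar> \<le> C * decay (real DIM('a) / 4) t"
    "\<And>t x. t > 0 \<Longrightarrow> heat_flow t (\<lambda>y. \<bar>g y\<bar>) x \<le> C * decay (real DIM('a) / 4) t"
proof -
  obtain C where C: "C \<ge> 0" "\<And>t x. t > 0 \<Longrightarrow> heat_flow t (\<lambda>y. \<bar>g y\<bar>) x \<le> C * decay (real DIM('a) / 4) t"
    using heat_flow_le_decay[OF g] by blast
  show ?thesis
    by (rule that[OF C(1) order_trans[OF heat_flow_abs_le C(2)] C(2)])
qed

text \<open>The heat operators commute with the Riesz potential, so for fixed x the orbit of
  \<open>u\<close> is the fractional integral of the orbit of \<open>g\<close>. This reduces the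
  splitting of the potential to functions of one real variable.\<close>

lemma heat_flow_rep:
  assumes t: "t > 0"
  shows "heat_flow t u x = frac_int \<beta> (\<lambda>s. heat_flow s g x) t"
proof -
  obtain C where C: "C \<ge> 0" "\<And>t x. t > 0 \<Longrightarrow> \<bar>heat_flow t g x\<bar> \<le> C * decay (real DIM('a) / 4) t"
    "\<And>t x. t > 0 \<Longrightarrow> heat_flow t (\<lambda>y. \<bar>g y\<bar>) x \<le> C * decay (real DIM('a) / 4) t"
    by (rule flow_decay) (rule that; assumption)
  have int: "integrable (lborel \<Otimes>\<^sub>M lborel) (\<lambda>(y, s). heat t (x - y) * (frac_kernel \<beta> s * heat_flow s g y))"
  proof (rule Bochner_Integration.integrable_bound)
    show "integrable (lborel \<Otimes>\<^sub>M lborel) (\<lambda>(y, s). heat t (x - y) * (C * (frac_kernel \<beta> s * decay (real DIM('a) / 4) s)))"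
      by (intro integrable_tensor heat_translate_integrable integrable_mult_right frac_kernel_decay_integrable beta_pos beta)
    have "\<bar>heat t (x - y) * (frac_kernel \<beta> s * heat_flow s g y)\<bar> \<le> \<bar>heat t (x - y) * (C * (frac_kernel \<beta> s * decay (real DIM('a) / 4) s))\<bar>" for y s
    proof (cases "s > 0")
      case True
      have "\<bar>frac_kernel \<beta> s * heat_flow s g y\<bar> \<le> \<bar>C * (frac_kernel \<beta> s * decay (real DIM('a) / 4) s)\<bar>"
        using mult_left_mono[OF C(2)[OF True, of y] frac_kernel_nonneg[OF beta_pos, of s]] C(1)
          frac_kernel_nonneg[OF beta_pos, of s] decay_bounds(1)[of "real DIM('a) / 4" s]
        by (simp add: abs_mult mult_ac)
      then show ?thesis by (simp add: abs_mult mult_left_mono)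
    qed (simp add: frac_kernel_def)
    then show "AE p in lborel \<Otimes>\<^sub>M lborel. norm (case p of (y, s) \<Rightarrow> heat t (x - y) * (frac_kernel \<beta> s * heat_flow s g y))
      \<le> norm (case p of (y, s) \<Rightarrow> heat t (x - y) * (C * (frac_kernel \<beta> s * decay (real DIM('a) / 4) s)))"
      by (intro AE_I2) (simp add: case_prod_beta')
  qed measurable
  have "heat_flow t u x = (LBINT y. (LBINT s. heat t (x - y) * (frac_kernel \<beta> s * heat_flow s g y)))"
    by (simp add: heat_flow_def[of t u] rep frac_int_def smear_def)
  also have "\<dots> = (LBINT s. (LBINT y. heat t (x - y) * (frac_kernel \<beta> s * heat_flow s g y)))"
    by (rule lborel_pair.Fubini_integral[OF int, symmetric])
  also have "\<dots> = (LBINT s. frac_kernel \<beta> s * heat_flow (t + s) g x)"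
  proof (rule Bochner_Integration.integral_cong[OF refl])
    fix s
    have "(LBINT y. heat t (x - y) * (frac_kernel \<beta> s * heat_flow s g y)) =
        (LBINT y. frac_kernel \<beta> s * (heat t (x - y) * heat_flow s g y))"
      by (simp add: mult_ac)
    also have "\<dots> = frac_kernel \<beta> s * heat_flow t (heat_flow s g) x"
      unfolding heat_flow_def[of t "heat_flow s g"] by (rule integral_mult_right_zero)
    finally show "(LBINT y. heat t (x - y) * (frac_kernel \<beta> s * heat_flow s g y)) = frac_kernel \<beta> s * heat_flow (t + s) g x"
      using heat_flow_heat_flow[OF g t, of s x] by (cases "s > 0") (auto simp: frac_kernel_def)
  qed
  finally show ?thesis by (simp add: frac_int_def smear_def)
qed

text \<open>Each heat flow of \<open>g\<close> has gradient of size t^(-1/2)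
  \<open>decay (n/4) t\<close>. Against t^(\<beta>-1) this is integrable at 0 exactly because
  \<beta> > 1/2; the quotient of Gamma values in \<open>K\<close> converts t^(-1/2)
  \<open>frac_kernel \<beta>\<close> into \<open>frac_kernel (\<beta> - 1/2)\<close>.\<close>

lemma lipschitz:
  obtains L where "\<And>i x h. i \<in> Basis \<Longrightarrow> \<bar>u (x + h *\<^sub>R i) - u x\<bar> \<le> L * \<bar>h\<bar>"
proof -
  let ?n = "real DIM('a)"
  obtain C where C: "C \<ge> 0" "\<And>t x. t > 0 \<Longrightarrow> \<bar>heat_flow t g x\<bar> \<le> C * decay (?n / 4) t"
    "\<And>t x. t > 0 \<Longrightarrow> heat_flow t (\<lambda>y. \<bar>g y\<bar>) x \<le> C * decay (?n / 4) t"
    by (rule flow_decay) (rule that; assumption)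
  define c where "c = 2 powr (?n / 2) * C"
  have c: "c \<ge> 0" using C by (simp add: c_def)
  have decay2: "decay (?n / 4) (2 * t) \<le> decay (?n / 4) t" if "t > 0" for t
    using decay_antimono[of "?n / 4"] that by (auto simp: monotone_on_def)
  have grad: "\<bar>heat_grad i t g x\<bar> \<le> c * (t powr (- 1/2) * decay (?n / 4) t)" if t: "t > 0" and i: "i \<in> Basis" for i t x
  proof -
    have "\<bar>heat_grad i t g x\<bar> \<le> 2 powr (?n / 2) / sqrt t * heat_flow (2 * t) (\<lambda>y. \<bar>g y\<bar>) x"
      by (rule heat_grad_bound(2)[OF g i t])
    also have "\<dots> \<le> 2 powr (?n / 2) / sqrt t * (C * decay (?n / 4) t)"
      using C(3)[of "2 * t" x] decay2[OF t] t C(1)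
      by (intro mult_left_mono order_trans[OF C(3)]) auto
    also have "\<dots> = c * (t powr (- 1/2) * decay (?n / 4) t)"
      using t by (simp add: c_def powr_minus powr_half_sqrt field_simps)
    finally show ?thesis .
  qed
  have diff: "\<bar>heat_flow t g (x + h *\<^sub>R i) - heat_flow t g x\<bar> \<le> c * (t powr (- 1/2) * decay (?n / 4) t) * \<bar>h\<bar>"
    if t: "t > 0" and i: "i \<in> Basis" for i t x h
  proof -
    have "norm (heat_flow t g (x + h *\<^sub>R i) - heat_flow t g (x + 0 *\<^sub>R i)) \<le> c * (t powr (- 1/2) * decay (?n / 4) t) * norm (h - 0)"
    proof (rule field_differentiable_bound[of UNIV])
      fix s :: real
      have "((\<lambda>h. heat_flow t g ((x + s *\<^sub>R i) + h *\<^sub>R i)) has_field_derivative heat_grad i t g (x + s *\<^sub>R i)) (at 0)"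
        by (rule heat_flow_derivative[OF g i])
      then have "((\<lambda>h. heat_flow t g (x + (s + h) *\<^sub>R i)) has_field_derivative heat_grad i t g (x + s *\<^sub>R i)) (at 0)"
        by (simp add: scaleR_add_left add.assoc)
      then show "((\<lambda>h. heat_flow t g (x + h *\<^sub>R i)) has_field_derivative heat_grad i t g (x + s *\<^sub>R i)) (at s within UNIV)"
        using DERIV_shift[of "\<lambda>h. heat_flow t g (x + h *\<^sub>R i)" _ 0 s] by (simp add: add.commute)
      show "norm (heat_grad i t g (x + s *\<^sub>R i)) \<le> c * (t powr (- 1/2) * decay (?n / 4) t)"
        using grad[OF t i] by simp
    qed auto
    then show ?thesis by simp
  qed
  define K where "K = c * (Gamma (\<beta> - 1/2) / Gamma \<beta>)"
  define L where "L = (LBINT t. K * (frac_kernel (\<beta> - 1/2) t * decay (?n / 4) t))"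
  have intL: "integrable lborel (\<lambda>t. K * (frac_kernel (\<beta> - 1/2) t * decay (?n / 4) t))"
    by (intro integrable_mult_right frac_kernel_decay_integrable) (use beta in auto)
  have intg: "integrable lborel (\<lambda>t. frac_kernel \<beta> t * heat_flow t g x)" for x
  proof (rule integrable_boundI)
    show "integrable lborel (\<lambda>t. C * (frac_kernel \<beta> t * decay (?n / 4) t))"
      by (intro integrable_mult_right frac_kernel_decay_integrable) (use beta in auto)
    show "\<bar>frac_kernel \<beta> t * heat_flow t g x\<bar> \<le> \<bar>C * (frac_kernel \<beta> t * decay (?n / 4) t)\<bar>" for t
    proof (cases "t > 0")
      case True
      then show ?thesis
        using mult_left_mono[OF C(2)[OF True, of x] frac_kernel_nonneg[OF beta_pos, of t]] C(1)
          frac_kernel_nonneg[OF beta_pos, of t] decay_bounds(1)[of "?n / 4" t]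
        by (simp add: abs_mult mult_ac)
    qed (simp add: frac_kernel_def)
  qed measurable
  have "\<bar>u (x + h *\<^sub>R i) - u x\<bar> \<le> L * \<bar>h\<bar>" if i: "i \<in> Basis" for i x h
  proof -
    have "u (x + h *\<^sub>R i) - u x = (LBINT t. frac_kernel \<beta> t * heat_flow t g (x + h *\<^sub>R i) - frac_kernel \<beta> t * heat_flow t g x)"
      by (subst Bochner_Integration.integral_diff[OF intg intg]) (simp add: rep frac_int_def smear_def)
    also have "\<bar>\<dots>\<bar> \<le> (LBINT t. \<bar>frac_kernel \<beta> t * heat_flow t g (x + h *\<^sub>R i) - frac_kernel \<beta> t * heat_flow t g x\<bar>)"
      by (rule integral_abs_bound)
    also have "\<dots> \<le> (LBINT t. K * (frac_kernel (\<beta> - 1/2) t * decay (?n / 4) t) * \<bar>h\<bar>)"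
    proof (rule integral_mono)
      show "integrable lborel (\<lambda>t. \<bar>frac_kernel \<beta> t * heat_flow t g (x + h *\<^sub>R i) - frac_kernel \<beta> t * heat_flow t g x\<bar>)"
        by (intro integrable_abs Bochner_Integration.integrable_diff intg)
      show "integrable lborel (\<lambda>t. K * (frac_kernel (\<beta> - 1/2) t * decay (?n / 4) t) * \<bar>h\<bar>)"
        by (intro integrable_mult_left intL)
      fix t
      show "\<bar>frac_kernel \<beta> t * heat_flow t g (x + h *\<^sub>R i) - frac_kernel \<beta> t * heat_flow t g x\<bar>
          \<le> K * (frac_kernel (\<beta> - 1/2) t * decay (?n / 4) t) * \<bar>h\<bar>"
      proof (cases "t > 0")
        case t: True
        have G: "Gamma \<beta> > 0" "Gamma (\<beta> - 1/2) > 0" using beta by (auto intro: Gamma_real_pos)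
        have "\<bar>frac_kernel \<beta> t * heat_flow t g (x + h *\<^sub>R i) - frac_kernel \<beta> t * heat_flow t g x\<bar> =
            frac_kernel \<beta> t * \<bar>heat_flow t g (x + h *\<^sub>R i) - heat_flow t g x\<bar>"
          using frac_kernel_nonneg[OF beta_pos, of t] by (simp add: right_diff_distrib[symmetric] abs_mult)
        also have "\<dots> \<le> frac_kernel \<beta> t * (c * (t powr (- 1/2) * decay (?n / 4) t) * \<bar>h\<bar>)"
          by (intro mult_left_mono diff t i frac_kernel_nonneg beta_pos)
        also have "\<dots> = c * ((frac_kernel \<beta> t * t powr (- 1/2)) * decay (?n / 4) t) * \<bar>h\<bar>"
          by (simp add: mult_ac)
        also have "frac_kernel \<beta> t * t powr (- 1/2) = Gamma (\<beta> - 1/2) / Gamma \<beta> * frac_kernel (\<beta> - 1/2) t"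
          using t G by (simp add: frac_kernel_def powr_add[symmetric])
        also have "c * ((Gamma (\<beta> - 1/2) / Gamma \<beta> * frac_kernel (\<beta> - 1/2) t) * decay (?n / 4) t) * \<bar>h\<bar> =
            K * (frac_kernel (\<beta> - 1/2) t * decay (?n / 4) t) * \<bar>h\<bar>"
          by (simp add: K_def)
        finally show ?thesis .
      qed (simp add: frac_kernel_def)
    qed
    also have "\<dots> = L * \<bar>h\<bar>" by (simp add: L_def)
    finally show ?thesis .
  qed
  then show ?thesis using that by blast
qed

text \<open>Applied to the orbit t -> P_(\<mu> t) g, \<open>riesz_splitting\<close> gives the same
  three weights at every time scale. Rescaling the fractional integral produces the power of \<mu>;
  this is the form in which the homogeneity of the potential is used for the Pohozaev
  identity.\<close>

lemma splitting:
  obtains b c k where "L1_kernel b" "L1_kernel c" "L1_kernel k"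
    "\<And>\<mu> x. \<mu> > 0 \<Longrightarrow> \<mu> powr (- \<beta>) * u x =
       \<mu> powr (- \<beta>) * (LBINT t. b t * heat_flow (\<mu> * t) u x) + (LBINT t. k t * heat_flow (\<mu> * t) g x)"
    "\<And>\<mu> x. \<mu> > 0 \<Longrightarrow> (LBINT t. b t * heat_flow (\<mu> * t) g x) =
       \<mu> powr (- \<beta>) * (LBINT t. c t * heat_flow (\<mu> * t) u x)"
proof -
  let ?e = "real DIM('a) / 4"
  obtain b c k where b: "L1_kernel b" and c: "L1_kernel c" and k: "L1_kernel k"
    and eq: "\<And>q w C. q \<in> borel_measurable borel \<Longrightarrow> antimono_on {0<..} w \<Longrightarrow> (\<And>t. t > 0 \<Longrightarrow> \<bar>q t\<bar> \<le> w t) \<Longrightarrow>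
       w \<in> borel_measurable borel \<Longrightarrow> (\<And>t. 0 < t \<Longrightarrow> w t \<le> C) \<Longrightarrow>
       integrable lborel (\<lambda>t. frac_kernel \<beta> t * w t) \<Longrightarrow>
       frac_int \<beta> q 0 = smear b (frac_int \<beta> q) 0 + smear k q 0 \<and>
       smear b q 0 = smear c (frac_int \<beta> q) 0"
    using riesz_splitting[OF beta_pos] by blast
  obtain C where C: "C \<ge> 0" "\<And>t x. t > 0 \<Longrightarrow> \<bar>heat_flow t g x\<bar> \<le> C * decay (real DIM('a) / 4) t"
    "\<And>t x. t > 0 \<Longrightarrow> heat_flow t (\<lambda>y. \<bar>g y\<bar>) x \<le> C * decay (real DIM('a) / 4) t"
    by (rule flow_decay) (rule that; assumption)
  have main: "\<mu> powr (- \<beta>) * u x = \<mu> powr (- \<beta>) * (LBINT t. b t * heat_flow (\<mu> * t) u x) + (LBINT t. k t * heat_flow (\<mu> * t) g x) \<and>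
      (LBINT t. b t * heat_flow (\<mu> * t) g x) = \<mu> powr (- \<beta>) * (LBINT t. c t * heat_flow (\<mu> * t) u x)"
    if \<mu>: "\<mu> > 0" for \<mu> x
  proof -
    define q where "q t = heat_flow (\<mu> * t) g x" for t
    define w where "w t = C * decay ?e (\<mu> * t)" for t
    have [measurable]: "q \<in> borel_measurable borel" "w \<in> borel_measurable borel"
      unfolding q_def[abs_def] w_def[abs_def] by measurable
    have w: "antimono_on {0<..} w"
      using decay_antimono[of ?e] C(1) \<mu> by (auto simp: monotone_on_def w_def intro!: mult_left_mono)
    have qw: "\<bar>q t\<bar> \<le> w t" if "t > 0" for t using C(2)[of "\<mu> * t" x] that \<mu> by (simp add: q_def w_def)
    have wC: "w t \<le> C" for t using C(1) decay_bounds(2)[of ?e "\<mu> * t"] by (simp add: w_def mult_left_le)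
    have int: "integrable lborel (\<lambda>t. frac_kernel \<beta> t * w t)"
    proof (rule integrable_boundI)
      \<comment> \<open>Compares the decay at time \<mu> t with that at time t: 1 serves the
        constant branch of the minimum, the power of \<mu> the other one.\<close>
      let ?m = "max 1 (\<mu> powr (- ?e))"
      show "integrable lborel (\<lambda>t. C * ?m * (frac_kernel \<beta> t * decay ?e t))"
        by (intro integrable_mult_right frac_kernel_decay_integrable) (use beta in auto)
      show "\<bar>frac_kernel \<beta> t * w t\<bar> \<le> \<bar>C * ?m * (frac_kernel \<beta> t * decay ?e t)\<bar>" for t
      proof (cases "t > 0")
        case t: True
        have "decay ?e (\<mu> * t) \<le> ?m * decay ?e t"
        proof -
          have "(\<mu> * t) powr - ?e \<le> ?m * t powr - ?e"
            using \<mu> t by (simp add: powr_mult mult_right_mono)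
          moreover have "1 \<le> ?m * 1" by simp
          ultimately show ?thesis unfolding decay_def min_def by (auto simp: split: if_splits)
        qed
        from mult_left_mono[OF mult_left_mono[OF this C(1)] frac_kernel_nonneg[OF beta_pos, of t]]
        show ?thesis using C(1) frac_kernel_nonneg[OF beta_pos, of t] decay_bounds(1)[of ?e]
          by (simp add: w_def abs_mult mult_ac)
      qed (simp add: frac_kernel_def)
    qed measurable
    have scale: "frac_int \<beta> q t = \<mu> powr (- \<beta>) * frac_int \<beta> (\<lambda>s. heat_flow s g x) (\<mu> * t)" for t
    proof -
      have fk: "frac_kernel \<beta> (\<mu> * s) = \<mu> powr (\<beta> - 1) * frac_kernel \<beta> s" for s
        using \<mu> by (auto simp: frac_kernel_def powr_mult zero_less_mult_iff)
      have "frac_int \<beta> (\<lambda>s. heat_flow s g x) (\<mu> * t) = \<mu> * (LBINT s. frac_kernel \<beta> (\<mu> * s) * heat_flow (\<mu> * t + \<mu> * s) g x)"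
        unfolding frac_int_def smear_def using \<mu> by (subst lborel_integral_real_affine[where c = \<mu> and t = 0]) auto
      also have "\<dots> = \<mu> * \<mu> powr (\<beta> - 1) * frac_int \<beta> q t"
        unfolding fk by (simp add: frac_int_def smear_def q_def distrib_left mult.assoc)
      also have "\<mu> * \<mu> powr (\<beta> - 1) = \<mu> powr \<beta>" using \<mu> by (simp add: powr_diff)
      finally show ?thesis using \<mu> by (simp add: powr_minus)
    qed
    have J0: "frac_int \<beta> q 0 = \<mu> powr (- \<beta>) * u x" using scale[of 0] by (simp add: rep)
    have J: "\<phi> t * frac_int \<beta> q (0 + t) = \<mu> powr (- \<beta>) * (\<phi> t * heat_flow (\<mu> * t) u x)" if "L1_kernel \<phi>" for \<phi> t
      using that scale[of t] heat_flow_rep[of "\<mu> * t" x] \<mu> by (cases "t > 0") (auto simp: L1_kernel_def)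
    have sJ: "smear \<phi> (frac_int \<beta> q) 0 = \<mu> powr (- \<beta>) * (LBINT t. \<phi> t * heat_flow (\<mu> * t) u x)" if "L1_kernel \<phi>" for \<phi>
      unfolding smear_def J[OF that] by simp
    have sq: "smear \<phi> q 0 = (LBINT t. \<phi> t * heat_flow (\<mu> * t) g x)" for \<phi>
      by (simp add: smear_def q_def)
    show ?thesis
      using eq[OF _ w qw _ wC int] unfolding J0 sJ[OF b] sJ[OF c] sq by simp
  qed
  show ?thesis by (rule that[OF b c k]) (use main in blast)+
qed

end

section \<open>Mixtures of heat operators under spatial integrals, and their limits and
  dilations\<close>

lemma mixture_form:
  assumes \<phi>: "L1_kernel \<phi>" and a: "bounded_L2 a" and b: "bounded_L2 b"
  shows "(LBINT x. a x * (LBINT t. \<phi> t * heat_flow (\<mu> * t) b x)) = (LBINT t. \<phi> t * heat_form (\<mu> * t) a b)"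
    and "integrable lborel (\<lambda>x. a x * (LBINT t. \<phi> t * heat_flow (\<mu> * t) b x))"
proof -
  note [measurable] = bounded_L2_measurable[OF a] bounded_L2_measurable[OF b] L1_kernel_measurable[OF \<phi>]
  have \<phi>i: "integrable lborel \<phi>" using \<phi> by (simp add: L1_kernel_def)
  have int: "integrable (lborel \<Otimes>\<^sub>M lborel) (\<lambda>(t, x). a x * (\<phi> t * heat_flow (\<mu> * t) b x))"
  proof (rule lborel_pair.Fubini_integrable)
    have eq: "(LBINT x. norm (case (t, x) of (t, x) \<Rightarrow> a x * (\<phi> t * heat_flow (\<mu> * t) b x))) =
        \<bar>\<phi> t\<bar> * (LBINT x. \<bar>a x * heat_flow (\<mu> * t) b x\<bar>)" for t
      by (simp add: abs_mult mult.left_commute)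
    show "integrable lborel (\<lambda>t. LBINT x. norm (case (t, x) of (t, x) \<Rightarrow> a x * (\<phi> t * heat_flow (\<mu> * t) b x)))"
    proof (rule Bochner_Integration.integrable_bound)
      show "integrable lborel (\<lambda>t. \<bar>\<phi> t\<bar> * (energy a + energy b))" using \<phi>i by simp
      have "0 \<le> (LBINT x. \<bar>a x * heat_flow (\<mu> * t) b x\<bar>)" for t by (rule integral_nonneg_AE) simp
      then have "\<bar>\<bar>\<phi> t\<bar> * (LBINT x. \<bar>a x * heat_flow (\<mu> * t) b x\<bar>)\<bar> \<le> \<bar>\<bar>\<phi> t\<bar> * (energy a + energy b)\<bar>" for t
        using heat_form_eq(3)[OF a b, of "\<mu> * t"] by (simp add: abs_mult mult_left_mono)
      then show "AE t in lborel. norm (LBINT x. norm (case (t, x) of (t, x) \<Rightarrow> a x * (\<phi> t * heat_flow (\<mu> * t) b x)))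
          \<le> norm (\<bar>\<phi> t\<bar> * (energy a + energy b))" unfolding eq by simp
    qed measurable
    show "AE t in lborel. integrable lborel (\<lambda>x. case (t, x) of (t, x) \<Rightarrow> a x * (\<phi> t * heat_flow (\<mu> * t) b x))"
    proof (rule AE_I2)
      fix t
      have "integrable lborel (\<lambda>x. \<phi> t * (a x * heat_flow (\<mu> * t) b x))"
        by (rule integrable_mult_right[OF heat_form_eq(2)[OF a b]])
      then show "integrable lborel (\<lambda>x. case (t, x) of (t, x) \<Rightarrow> a x * (\<phi> t * heat_flow (\<mu> * t) b x))"
        by (simp add: mult.left_commute)
    qed
  qed measurable
  have "(LBINT x. (LBINT t. a x * (\<phi> t * heat_flow (\<mu> * t) b x))) = (LBINT t. (LBINT x. a x * (\<phi> t * heat_flow (\<mu> * t) b x)))"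
    by (rule lborel_pair.Fubini_integral[OF int])
  also have "(\<lambda>t. LBINT x. a x * (\<phi> t * heat_flow (\<mu> * t) b x)) = (\<lambda>t. \<phi> t * heat_form (\<mu> * t) a b)"
  proof
    fix t
    have "(LBINT x. a x * (\<phi> t * heat_flow (\<mu> * t) b x)) = (LBINT x. \<phi> t * (a x * heat_flow (\<mu> * t) b x))"
      by (simp add: mult.left_commute)
    then show "(LBINT x. a x * (\<phi> t * heat_flow (\<mu> * t) b x)) = \<phi> t * heat_form (\<mu> * t) a b"
      by (simp add: heat_form_eq(1)[OF a b])
  qed
  finally show "(LBINT x. a x * (LBINT t. \<phi> t * heat_flow (\<mu> * t) b x)) = (LBINT t. \<phi> t * heat_form (\<mu> * t) a b)"
    by simp
  show "integrable lborel (\<lambda>x. a x * (LBINT t. \<phi> t * heat_flow (\<mu> * t) b x))"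
    using lborel_pair.integrable_snd[OF int] by simp
qed

text \<open>\<open>X\<close> is integrable in x, the weight is integrable in t, and the Lipschitz
  bound on \<open>b\<close> controls the gradient for all t, small t included. The product of these
  is the majorant for Fubini.\<close>

lemma mixture_grad:
  assumes \<phi>: "L1_kernel \<phi>" and a: "bounded_L2 a" and b: "bounded_L2 b" and i: "i \<in> Basis"
    and L: "\<And>y h. \<bar>b (y + h *\<^sub>R i) - b y\<bar> \<le> L * \<bar>h\<bar>" and X: "integrable lborel X"
  shows "(LBINT x. X x * a x * (LBINT t. \<phi> t * heat_grad i t b x)) =
      (LBINT t. \<phi> t * (LBINT x. X x * a x * heat_grad i t b x))"
    and "integrable lborel (\<lambda>x. X x * a x * (LBINT t. \<phi> t * heat_grad i t b x))"
    and "integrable lborel (\<lambda>t. \<phi> t * (LBINT x. X x * a x * heat_grad i t b x))"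
proof -
  note [measurable] = bounded_L2_measurable[OF a] bounded_L2_measurable[OF b] L1_kernel_measurable[OF \<phi>]
  have [measurable]: "X \<in> borel_measurable borel" using X by auto
  obtain M where M: "M \<ge> 0" "\<And>x. \<bar>a x\<bar> \<le> M" by (rule bounded_L2_bound[OF a]) blast
  have L0: "0 \<le> L" using order_trans[OF abs_ge_zero L[of _ 1]] by simp
  have \<phi>i: "integrable lborel \<phi>" using \<phi> by (simp add: L1_kernel_def)
  have int: "integrable (lborel \<Otimes>\<^sub>M lborel) (\<lambda>(t, x). X x * a x * (\<phi> t * heat_grad i t b x))"
  proof (rule Bochner_Integration.integrable_bound)
    show "integrable (lborel \<Otimes>\<^sub>M lborel) (\<lambda>p. (M * L) * (case p of (t, x) \<Rightarrow> \<phi> t * X x))"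
      by (intro integrable_mult_right integrable_tensor \<phi>i X)
    have "\<bar>X x * a x * (\<phi> t * heat_grad i t b x)\<bar> \<le> \<bar>(M * L) * (\<phi> t * X x)\<bar>" for t x
    proof -
      have "\<bar>a x\<bar> * \<bar>heat_grad i t b x\<bar> \<le> M * L"
        by (intro mult_mono M heat_grad_le_lipschitz[OF b i L]) auto
      from mult_left_mono[OF this, of "\<bar>\<phi> t * X x\<bar>"] show ?thesis
        using M L0 by (simp add: abs_mult mult_ac)
    qed
    then show "AE p in lborel \<Otimes>\<^sub>M lborel. norm (case p of (t, x) \<Rightarrow> X x * a x * (\<phi> t * heat_grad i t b x))
        \<le> norm ((M * L) * (case p of (t, x) \<Rightarrow> \<phi> t * X x))" by (intro AE_I2) (simp add: case_prod_beta')
  qed measurable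
  have eq: "(LBINT x. X x * a x * (\<phi> t * heat_grad i t b x)) = \<phi> t * (LBINT x. X x * a x * heat_grad i t b x)" for t
  proof -
    have "(LBINT x. X x * a x * (\<phi> t * heat_grad i t b x)) = (LBINT x. \<phi> t * (X x * a x * heat_grad i t b x))"
      by (simp add: mult_ac)
    then show ?thesis by simp
  qed
  show "(LBINT x. X x * a x * (LBINT t. \<phi> t * heat_grad i t b x)) =
      (LBINT t. \<phi> t * (LBINT x. X x * a x * heat_grad i t b x))"
    using lborel_pair.Fubini_integral[OF int] unfolding eq by simp
  show "integrable lborel (\<lambda>x. X x * a x * (LBINT t. \<phi> t * heat_grad i t b x))"
    using lborel_pair.integrable_snd[OF int] by simp
  show "integrable lborel (\<lambda>t. \<phi> t * (LBINT x. X x * a x * heat_grad i t b x))"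
    using lborel_pair.integrable_fst[OF int] unfolding eq .
qed

lemma mixture_integrable:
  assumes \<phi>: "L1_kernel \<phi>" and [measurable]: "f \<in> borel_measurable borel" and M: "\<And>t. t > 0 \<Longrightarrow> \<bar>f t\<bar> \<le> M"
  shows "integrable lborel (\<lambda>t. \<phi> t * f t)"
  using L1_kernel_smear_integrable[OF \<phi>, of f 0 M] M by simp

lemma mixture_derivative:
  assumes \<phi>: "L1_kernel \<phi>" and b: "bounded_L2 b" and i: "i \<in> Basis"
    and L: "\<And>y h. \<bar>b (y + h *\<^sub>R i) - b y\<bar> \<le> L * \<bar>h\<bar>"
  shows "((\<lambda>h. LBINT t. \<phi> t * heat_flow t b (x + h *\<^sub>R i)) has_field_derivative
      (LBINT t. \<phi> t * heat_grad i t b x)) (at 0)"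
proof (rule has_field_derivative_integral[where r = 1 and w = "\<lambda>t. \<bar>\<phi> t\<bar> * L"])
  note [measurable] = bounded_L2_measurable[OF b] L1_kernel_measurable[OF \<phi>]
  obtain M where M: "M \<ge> 0" "\<And>x. \<bar>b x\<bar> \<le> M" by (rule bounded_L2_bound[OF b]) blast
  show "integrable lborel (\<lambda>t. \<phi> t * heat_flow t b (x + h *\<^sub>R i))" for h
    by (rule mixture_integrable[OF \<phi>, where M = M]) (auto intro: heat_flow_bounded[OF b M(2)])
  show "integrable lborel (\<lambda>t. \<bar>\<phi> t\<bar> * L)" using \<phi> by (simp add: L1_kernel_def)
  show "((\<lambda>h. \<phi> t * heat_flow t b (x + h *\<^sub>R i)) has_field_derivative \<phi> t * heat_grad i t b x) (at 0)" for t
    by (intro DERIV_cmult heat_flow_derivative b i)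
  show "\<bar>\<phi> t * heat_flow t b (x + h *\<^sub>R i) - \<phi> t * heat_flow t b (x + 0 *\<^sub>R i)\<bar> \<le> \<bar>h\<bar> * (\<bar>\<phi> t\<bar> * L)" for h t
  proof -
    have "\<bar>\<phi> t * heat_flow t b (x + h *\<^sub>R i) - \<phi> t * heat_flow t b (x + 0 *\<^sub>R i)\<bar> =
        \<bar>\<phi> t\<bar> * \<bar>heat_flow t b (x + h *\<^sub>R i) - heat_flow t b x\<bar>"
      by (simp add: right_diff_distrib[symmetric] abs_mult)
    also have "\<dots> \<le> \<bar>\<phi> t\<bar> * (L * \<bar>h\<bar>)" by (intro mult_left_mono heat_flow_lipschitz[OF b L]) simp
    finally show ?thesis by (simp add: mult_ac)
  qed
  show "(\<lambda>t. \<phi> t * heat_grad i t b x) \<in> borel_measurable lborel" by measurable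
qed simp

lemma commutator_form_measurable:
  fixes a b :: "'a::euclidean_space \<Rightarrow> real"
  assumes [measurable]: "a \<in> borel_measurable borel" "b \<in> borel_measurable borel" "X \<in> borel_measurable borel"
  shows "(\<lambda>t. commutator_form X i t a b) \<in> borel_measurable borel"
  unfolding commutator_form_def
  by (rule lborel_pair.P.borel_measurable_lebesgue_integral) measurable

lemma heat_form_measurable:
  fixes a b :: "'a::euclidean_space \<Rightarrow> real"
  assumes [measurable]: "a \<in> borel_measurable borel" "b \<in> borel_measurable borel"
  shows "(\<lambda>t. heat_form t a b) \<in> borel_measurable borel"
  unfolding heat_form_def
  by (rule lborel_pair.P.borel_measurable_lebesgue_integral) measurable

lemma dilation_form_measurable:
  fixes a b :: "'a::euclidean_space \<Rightarrow> real"
  assumes [measurable]: "a \<in> borel_measurable borel" "b \<in> borel_measurable borel"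
  shows "(\<lambda>t. dilation_form t a b) \<in> borel_measurable borel"
  unfolding dilation_form_def
  by (rule lborel_pair.P.borel_measurable_lebesgue_integral) measurable

text \<open>The bound on \<open>commutator_form\<close> involves neither m nor t, so a multiple of
  the absolute weight dominates and the limit may be taken inside the time integral.\<close>

lemma mixture_commutator_limit:
  fixes a b :: "'a::euclidean_space \<Rightarrow> real"
  assumes \<phi>: "L1_kernel \<phi>" and a: "bounded_L2 a" and b: "bounded_L2 b"
    and [measurable]: "\<And>m i. X m i \<in> borel_measurable borel"
    and X: "\<And>m i x y. i \<in> Basis \<Longrightarrow> \<bar>X m i x - X m i y\<bar> \<le> 2 * norm (x - y)"
    and lim: "\<And>i x. i \<in> Basis \<Longrightarrow> (\<lambda>m. X m i x) \<longlonglongrightarrow> x \<bullet> i"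
  shows "(\<lambda>m. \<Sum>i\<in>Basis. LBINT t. \<phi> t * commutator_form (X m i) i t a b) \<longlonglongrightarrow>
    (LBINT t. \<phi> t * dilation_form t a b)"
proof -
  note [measurable] = bounded_L2_measurable[OF a] bounded_L2_measurable[OF b] L1_kernel_measurable[OF \<phi>]
  note [measurable] = commutator_form_measurable[OF bounded_L2_measurable[OF a] bounded_L2_measurable[OF b]]
  let ?c = "4 * 2 powr (real DIM('a) / 2) * (energy a + energy b)"
  let ?Y = "\<lambda>i x. x \<bullet> i"
  have Y: "\<bar>?Y i x - ?Y i y\<bar> \<le> 2 * norm (x - y)" if "i \<in> Basis" for x y i :: 'a
    using Basis_le_norm[OF that, of "x - y"] norm_ge_zero[of "x - y"] unfolding inner_diff_left by linarith
  have int: "integrable lborel (\<lambda>t. \<phi> t * commutator_form Z i t a b)"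
    if "i \<in> Basis" "Z \<in> borel_measurable borel" "\<And>x y. \<bar>Z x - Z y\<bar> \<le> 2 * norm (x - y)" for Z i
    by (rule mixture_integrable[OF \<phi>, where M = ?c])
      (use that commutator_form_integrable(2)[OF a b] in auto)
  have "(\<lambda>m. LBINT t. \<phi> t * commutator_form (X m i) i t a b) \<longlonglongrightarrow>
      (LBINT t. \<phi> t * commutator_form (?Y i) i t a b)" if i: "i \<in> Basis" for i
  proof (rule integral_dominated_convergence[where w = "\<lambda>t. \<bar>\<phi> t\<bar> * ?c"])
    show "(\<lambda>t. \<phi> t * commutator_form (X m i) i t a b) \<in> borel_measurable lborel" for m by measurable
    show "(\<lambda>t. \<phi> t * commutator_form (?Y i) i t a b) \<in> borel_measurable lborel" by measurable
    show "integrable lborel (\<lambda>t. \<bar>\<phi> t\<bar> * ?c)" using \<phi> by (simp add: L1_kernel_def)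
    show "AE t in lborel. (\<lambda>m. \<phi> t * commutator_form (X m i) i t a b) \<longlonglongrightarrow> \<phi> t * commutator_form (?Y i) i t a b"
      by (intro AE_I2 tendsto_intros commutator_form_tendsto[OF a b i]) (auto intro: X[OF i] lim[OF i])
    show "AE t in lborel. norm (\<phi> t * commutator_form (X m i) i t a b) \<le> \<bar>\<phi> t\<bar> * ?c" for m
      using commutator_form_integrable(2)[OF a b i _ X[OF i]] by (auto simp: abs_mult intro!: AE_I2 mult_left_mono)
  qed
  then have "(\<lambda>m. \<Sum>i\<in>Basis. LBINT t. \<phi> t * commutator_form (X m i) i t a b) \<longlonglongrightarrow>
      (\<Sum>i\<in>Basis. LBINT t. \<phi> t * commutator_form (?Y i) i t a b)" by (rule tendsto_sum)
  also have "(\<Sum>i\<in>Basis. LBINT t. \<phi> t * commutator_form (?Y i) i t a b) =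
      (LBINT t. (\<Sum>i\<in>Basis. \<phi> t * commutator_form (?Y i) i t a b))"
    by (rule Bochner_Integration.integral_sum[symmetric]) (intro int, auto intro: Y)
  also have "\<dots> = (LBINT t. \<phi> t * dilation_form t a b)"
    by (simp add: sum_distrib_left[symmetric] commutator_form_sum[OF a b])
  finally show ?thesis .
qed

lemma dilation_form_bound:
  fixes a b :: "'a::euclidean_space \<Rightarrow> real"
  assumes a: "bounded_L2 a" and b: "bounded_L2 b"
  obtains C where "\<And>t. t > 0 \<Longrightarrow> \<bar>dilation_form t a b\<bar> \<le> C"
proof (rule that)
  fix t :: real
  have Y: "\<bar>x \<bullet> i - y \<bullet> i\<bar> \<le> 2 * norm (x - y)" if "i \<in> Basis" for x y i :: 'a
    using Basis_le_norm[OF that, of "x - y"] norm_ge_zero[of "x - y"] unfolding inner_diff_left by linarith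
  show "\<bar>dilation_form t a b\<bar> \<le> (\<Sum>i\<in>(Basis :: 'a set). 4 * 2 powr (real DIM('a) / 2) * (energy a + energy b))"
    unfolding commutator_form_sum[OF a b, symmetric]
    by (rule order_trans[OF sum_abs sum_mono]) (intro commutator_form_integrable(2)[OF a b], auto intro: Y)
qed

text \<open>Time is dilated and not shifted, so \<open>heat_form_lipschitz\<close> bounds the
  increments by a multiple of |h| uniformly in t, and the weight only has to be integrable.\<close>

lemma mixture_form_derivative:
  fixes a b :: "'a::euclidean_space \<Rightarrow> real"
  assumes \<phi>: "L1_kernel \<phi>" and a: "bounded_L2 a" and b: "bounded_L2 b"
  shows "((\<lambda>h. LBINT t. \<phi> t * heat_form ((1 + h) * t) a b) has_field_derivative
     - ((LBINT t. \<phi> t * dilation_form t a b) + real DIM('a) * (LBINT t. \<phi> t * heat_form t a b)) / 2) (at 0)"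
proof -
  note [measurable] = L1_kernel_measurable[OF \<phi>]
    dilation_form_measurable[OF bounded_L2_measurable[OF a] bounded_L2_measurable[OF b]]
    heat_form_measurable[OF bounded_L2_measurable[OF a] bounded_L2_measurable[OF b]]
  let ?n = "real DIM('a)"
  let ?c = "2 * (1 + ?n / 2) * 8 powr (?n / 2) * (energy a + energy b)"
  let ?d = "\<lambda>t. \<phi> t * (- (dilation_form t a b + ?n * heat_form t a b) / 2)"
  have int: "integrable lborel (\<lambda>t. \<phi> t * heat_form (s * t) a b)" for s
    by (rule mixture_integrable[OF \<phi>, where M = "energy a + energy b"]) (auto intro: heat_form_bound[OF a b])
  obtain C where C: "\<And>t. t > 0 \<Longrightarrow> \<bar>dilation_form t a b\<bar> \<le> C"
    by (rule dilation_form_bound[OF a b]) (rule that; assumption)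
  have intd: "integrable lborel (\<lambda>t. \<phi> t * dilation_form t a b)"
    by (rule mixture_integrable[OF \<phi>, where M = C]) (auto intro: C)
  have "((\<lambda>h. LBINT t. \<phi> t * heat_form ((1 + h) * t) a b) has_field_derivative (LBINT t. ?d t)) (at 0)"
  proof (rule has_field_derivative_integral[where r = "1 / 2" and w = "\<lambda>t. \<bar>\<phi> t\<bar> * ?c"])
    show "integrable lborel (\<lambda>t. \<phi> t * heat_form ((1 + h) * t) a b)" for h by (rule int)
    show "?d \<in> borel_measurable lborel" by measurable
    show "integrable lborel (\<lambda>t. \<bar>\<phi> t\<bar> * ?c)" using \<phi> by (simp add: L1_kernel_def)
    show "((\<lambda>h. \<phi> t * heat_form ((1 + h) * t) a b) has_field_derivative ?d t) (at 0)" for t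
    proof (cases "t > 0")
      case True
      show ?thesis
        by (intro DERIV_cmult) (use heat_form_derivative[OF a b True] in \<open>simp add: mult.commute\<close>)
    next
      case False
      then show ?thesis using \<phi> by (simp add: L1_kernel_def)
    qed
    show "\<bar>\<phi> t * heat_form ((1 + h) * t) a b - \<phi> t * heat_form ((1 + 0) * t) a b\<bar> \<le> \<bar>h\<bar> * (\<bar>\<phi> t\<bar> * ?c)"
      if h: "\<bar>h\<bar> < 1 / 2" for h t
    proof (cases "t > 0")
      case True
      have "\<bar>\<phi> t * heat_form ((1 + h) * t) a b - \<phi> t * heat_form ((1 + 0) * t) a b\<bar> =
          \<bar>\<phi> t\<bar> * \<bar>heat_form (t * (1 + h)) a b - heat_form t a b\<bar>"
        by (simp add: right_diff_distrib[symmetric] abs_mult mult.commute)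
      also have "\<dots> \<le> \<bar>\<phi> t\<bar> * (\<bar>h\<bar> * ?c)" by (intro mult_left_mono heat_form_lipschitz[OF a b h True]) simp
      finally show ?thesis by (simp only: mult_ac)
    next
      case False
      then show ?thesis using \<phi> by (simp add: L1_kernel_def)
    qed
  qed simp
  also have "(LBINT t. ?d t) = - ((LBINT t. \<phi> t * dilation_form t a b) + ?n * (LBINT t. \<phi> t * heat_form t a b)) / 2"
  proof -
    have "?d t = - (1/2) * (\<phi> t * dilation_form t a b) - ?n / 2 * (\<phi> t * heat_form (1 * t) a b)" for t
      by (simp add: field_simps)
    then have "(LBINT t. ?d t) = (LBINT t. - (1/2) * (\<phi> t * dilation_form t a b) - ?n / 2 * (\<phi> t * heat_form (1 * t) a b))"
      by (rule Bochner_Integration.integral_cong[OF refl])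
    also have "\<dots> = - (1/2) * (LBINT t. \<phi> t * dilation_form t a b) - ?n / 2 * (LBINT t. \<phi> t * heat_form (1 * t) a b)"
      by (subst Bochner_Integration.integral_diff[OF integrable_mult_right[OF intd] integrable_mult_right[OF int]])
        (simp only: integral_mult_right_zero)
    finally show ?thesis by simp
  qed
  finally show ?thesis .
qed

context riesz_pair
begin

text \<open>Formally X(x) = x and u = I g with I symmetric and [x . grad, I] = 2 \<beta> I. Then the
  integral of g x . grad u minus that of u x . grad g is 2 \<beta> times the integral of g u, while
  their sum is -n times it; half the sum of the two identities gives \<beta> - n/2. These integrals
  need not converge, so the argument is carried out on the heat mixtures.\<close>

lemma pohozaev_limit:
  fixes X :: "nat \<Rightarrow> 'a \<Rightarrow> 'a \<Rightarrow> real"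
  assumes g_lip: "\<And>i x h. i \<in> Basis \<Longrightarrow> \<bar>g (x + h *\<^sub>R i) - g x\<bar> \<le> Lg * \<bar>h\<bar>"
    and du: "\<And>i x. i \<in> Basis \<Longrightarrow> ((\<lambda>h. u (x + h *\<^sub>R i)) has_field_derivative du i x) (at 0)"
    and X_int: "\<And>m i. integrable lborel (X m i)"
    and X_bd: "\<And>m i x. i \<in> Basis \<Longrightarrow> \<bar>X m i x\<bar> \<le> D m"
    and X_lip: "\<And>m i x y. i \<in> Basis \<Longrightarrow> \<bar>X m i x - X m i y\<bar> \<le> 2 * norm (x - y)"
    and X_lim: "\<And>i x. i \<in> Basis \<Longrightarrow> (\<lambda>m. X m i x) \<longlonglongrightarrow> x \<bullet> i"
  shows "(\<lambda>m. \<Sum>i\<in>Basis. LBINT x. X m i x * g x * du i x) \<longlonglongrightarrow>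
    (\<beta> - real DIM('a) / 2) * (LBINT x. g x * u x)"
proof -
  let ?n = "real DIM('a)"
  have [measurable]: "X m i \<in> borel_measurable borel" for m i using X_int[of m i] by auto
  obtain Lu where u_lip: "\<And>i x h. i \<in> Basis \<Longrightarrow> \<bar>u (x + h *\<^sub>R i) - u x\<bar> \<le> Lu * \<bar>h\<bar>"
    by (rule lipschitz) (rule that; assumption)
  obtain b c k where b: "L1_kernel b" and c: "L1_kernel c" and k: "L1_kernel k"
    and split: "\<And>\<mu> x. \<mu> > 0 \<Longrightarrow> \<mu> powr (- \<beta>) * u x =
       \<mu> powr (- \<beta>) * (LBINT t. b t * heat_flow (\<mu> * t) u x) + (LBINT t. k t * heat_flow (\<mu> * t) g x)"
    and conj: "\<And>\<mu> x. \<mu> > 0 \<Longrightarrow> (LBINT t. b t * heat_flow (\<mu> * t) g x) =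
       \<mu> powr (- \<beta>) * (LBINT t. c t * heat_flow (\<mu> * t) u x)"
    by (rule splitting) (rule that; assumption)
  \<comment> \<open>Derivative of the splitting at \<mu> = 1. The Lipschitz bounds on
    \<open>u\<close> and \<open>g\<close> allow it under the time integrals, and uniqueness
    identifies the result with the given \<open>du\<close>.\<close>
  have du_eq: "du i x = (LBINT t. b t * heat_grad i t u x) + (LBINT t. k t * heat_grad i t g x)"
    if i: "i \<in> Basis" for i x
  proof (rule DERIV_unique[OF du[OF i]])
    have "(\<lambda>h. u (x + h *\<^sub>R i)) = (\<lambda>h. (LBINT t. b t * heat_flow t u (x + h *\<^sub>R i)) + (LBINT t. k t * heat_flow t g (x + h *\<^sub>R i)))"
      using split[of 1] by simp
    then show "((\<lambda>h. u (x + h *\<^sub>R i)) has_field_derivative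
        (LBINT t. b t * heat_grad i t u x) + (LBINT t. k t * heat_grad i t g x)) (at 0)"
      using DERIV_add[OF mixture_derivative[OF b u i u_lip[OF i]] mixture_derivative[OF k g i g_lip[OF i]]] by simp
  qed
  have dg_eq: "(LBINT t. b t * heat_grad i t g x) = (LBINT t. c t * heat_grad i t u x)"
    if i: "i \<in> Basis" for i x
  proof (rule DERIV_unique[OF mixture_derivative[OF b g i g_lip[OF i]]])
    show "((\<lambda>h. LBINT t. b t * heat_flow t g (x + h *\<^sub>R i)) has_field_derivative
        (LBINT t. c t * heat_grad i t u x)) (at 0)"
      using mixture_derivative[OF c u i u_lip[OF i], of x] conj[of 1] by simp
  qed
  define S where "S \<phi> v w m i = (LBINT t. \<phi> t * commutator_form (X m i) i t v w)" for \<phi> v w m i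
  \<comment> \<open>Let T t v w be the integral of X v against the derivative of P_t w. The left
    side is the \<open>b\<close>-mixture of T t g u plus the \<open>k\<close>-mixture of T t g g,
    and the latter is half of \<open>S k g g\<close>. Adding the \<open>b\<close>-mixture of T t u g
    completes \<open>S b g u\<close>; by \<open>dg_eq\<close> this excess is the
    \<open>c\<close>-mixture of T t u u, half of \<open>S c u u\<close>.\<close>
  have T: "(LBINT x. X m i x * g x * du i x) = S b g u m i - S c u u m i / 2 + S k g g m i / 2"
    if i: "i \<in> Basis" for m i
  proof -
    define T where "T t v w = (LBINT x. X m i x * v x * heat_grad i t w x)" for t v w
    note mg = mixture_grad[OF _ _ _ i _ X_int[of m i], folded T_def]
    have ST: "S \<phi> v w m i = (LBINT t. \<phi> t * (T t v w + T t w v))" if "bounded_L2 v" "bounded_L2 w" for \<phi> v w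
      unfolding S_def T_def
      by (subst commutator_form_eq[OF that i _ X_bd[OF i]]) auto
    have 1: "(LBINT x. X m i x * g x * du i x) = (LBINT t. b t * T t g u) + (LBINT t. k t * T t g g)"
      unfolding du_eq[OF i] distrib_left
      using mg[OF b g u u_lip[OF i]] mg[OF k g g g_lip[OF i]]
      by (subst Bochner_Integration.integral_add) auto
    have 2: "S b g u m i = (LBINT t. b t * T t g u) + (LBINT t. b t * T t u g)"
      unfolding ST[OF g u] distrib_left
      using mg(3)[OF b g u u_lip[OF i]] mg(3)[OF b u g g_lip[OF i]]
      by (subst Bochner_Integration.integral_add) auto
    have 3: "(LBINT t. b t * T t u g) = (LBINT t. c t * T t u u)"
      unfolding mg(1)[OF b u g g_lip[OF i], symmetric] mg(1)[OF c u u u_lip[OF i], symmetric] dg_eq[OF i] ..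
    have 4: "S c u u m i = 2 * (LBINT t. c t * T t u u)" "S k g g m i = 2 * (LBINT t. k t * T t g g)"
    proof -
      have dbl: "(LBINT t. \<phi> t * (f t + f t)) = 2 * (LBINT t. \<phi> t * f t)" for \<phi> f :: "real \<Rightarrow> real"
      proof -
        have "(\<lambda>t. \<phi> t * (f t + f t)) = (\<lambda>t. 2 * (\<phi> t * f t))" by (simp add: fun_eq_iff)
        then show ?thesis by (simp only: integral_mult_right_zero)
      qed
      show "S c u u m i = 2 * (LBINT t. c t * T t u u)" "S k g g m i = 2 * (LBINT t. k t * T t g g)"
        unfolding ST[OF u u] ST[OF g g] by (rule dbl)+
    qed
    show ?thesis using 1 2 3 4 by simp
  qed
  define G where "G \<phi> v w = (LBINT t. \<phi> t * dilation_form t v w)" for \<phi> and v w :: "'a \<Rightarrow> real"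
  have lim: "(\<lambda>m. \<Sum>i\<in>Basis. S \<phi> v w m i) \<longlonglongrightarrow> G \<phi> v w" if "L1_kernel \<phi>" "bounded_L2 v" "bounded_L2 w" for \<phi> v w
    unfolding S_def G_def by (rule mixture_commutator_limit[OF that _ X_lip X_lim]) auto
  have "(\<lambda>m. (\<Sum>i\<in>Basis. S b g u m i) - (\<Sum>i\<in>Basis. S c u u m i) / 2 + (\<Sum>i\<in>Basis. S k g g m i) / 2)
      \<longlonglongrightarrow> G b g u - G c u u / 2 + G k g g / 2"
    by (intro tendsto_add tendsto_diff tendsto_divide lim b c k u g tendsto_const) auto
  also have "(\<lambda>m. (\<Sum>i\<in>Basis. S b g u m i) - (\<Sum>i\<in>Basis. S c u u m i) / 2 + (\<Sum>i\<in>Basis. S k g g m i) / 2) =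
      (\<lambda>m. \<Sum>i\<in>Basis. LBINT x. X m i x * g x * du i x)"
    by (simp add: T sum.distrib sum_subtractf sum_divide_distrib)
  finally have main: "(\<lambda>m. \<Sum>i\<in>Basis. LBINT x. X m i x * g x * du i x)
      \<longlonglongrightarrow> G b g u - G c u u / 2 + G k g g / 2" .
  define E where "E = (LBINT x. g x * u x)"
  \<comment> \<open>Each \<open>G\<close> is, up to a multiple of n, the derivative at h = 0 of the
    corresponding mixture with time dilated by 1 + h. The limit found in \<open>main\<close> can
    thus be computed by differentiating the same combination of the \<open>H\<close>.\<close>
  define H where "H \<phi> v w h = (LBINT t. \<phi> t * heat_form ((1 + h) * t) v w)"
    for \<phi> and v w :: "'a \<Rightarrow> real" and h
  have dH: "((\<lambda>h. H \<phi> v w h) has_field_derivative - (G \<phi> v w + ?n * H \<phi> v w 0) / 2) (at 0)"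
    if "L1_kernel \<phi>" "bounded_L2 v" "bounded_L2 w" for \<phi> v w
    using mixture_form_derivative[OF that] by (simp add: H_def G_def)
  have gu: "integrable lborel (\<lambda>x. g x * u x)"
  proof (rule Bochner_Integration.integrable_bound)
    show "integrable lborel (\<lambda>x. (g x)\<^sup>2 + (u x)\<^sup>2)" using g u by (simp add: bounded_L2_def)
    have "\<bar>g x * u x\<bar> \<le> (g x)\<^sup>2 + (u x)\<^sup>2" for x
    proof -
      have "0 \<le> (\<bar>g x\<bar> - \<bar>u x\<bar>)\<^sup>2" by simp
      then have "2 * (\<bar>g x\<bar> * \<bar>u x\<bar>) \<le> (g x)\<^sup>2 + (u x)\<^sup>2" by (simp add: power2_diff algebra_simps)
      moreover have "0 \<le> \<bar>g x\<bar> * \<bar>u x\<bar>" by simp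
      ultimately show ?thesis unfolding abs_mult by linarith
    qed
    then show "AE x in lborel. norm (g x * u x) \<le> norm ((g x)\<^sup>2 + (u x)\<^sup>2)" by simp
  qed measurable
  \<comment> \<open>Pairs the first relation of \<open>splitting\<close> at \<mu> = 1 + h with
    \<open>g\<close>.\<close>
  have HK: "H k g g h = (1 + h) powr (- \<beta>) * (E - H b g u h)" if h: "\<bar>h\<bar> < 1" for h
  proof -
    have \<mu>: "1 + h > 0" using h by simp
    have kq: "(LBINT t. k t * heat_flow ((1 + h) * t) g x) =
        (1 + h) powr (- \<beta>) * (u x - (LBINT t. b t * heat_flow ((1 + h) * t) u x))" for x
      using split[OF \<mu>, of x] by (simp add: right_diff_distrib)
    have alg: "p * (m * (r - q)) = m * (p * r - p * q)" for p m r q :: real by (simp add: algebra_simps)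
    have "H k g g h = (LBINT x. (1 + h) powr (- \<beta>) * (g x * u x - g x * (LBINT t. b t * heat_flow ((1 + h) * t) u x)))"
      unfolding H_def mixture_form(1)[OF k g g, symmetric] kq alg ..
    also have "\<dots> = (1 + h) powr (- \<beta>) * (E - H b g u h)"
      unfolding H_def mixture_form(1)[OF b g u, symmetric] E_def integral_mult_right_zero
      by (subst Bochner_Integration.integral_diff[OF gu mixture_form(2)[OF b g u]]) simp
    finally show ?thesis .
  qed
  \<comment> \<open>Pairs the second relation with \<open>u\<close>, after the symmetry of
    \<open>heat_form\<close> has exchanged \<open>g\<close> and \<open>u\<close>.\<close>
  have HC: "H c u u h = (1 + h) powr \<beta> * H b g u h" if h: "\<bar>h\<bar> < 1" for h
  proof -
    have \<mu>: "1 + h > 0" using h by simp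
    have "H b g u h = H b u g h" unfolding H_def using heat_form_commute[OF g u] by simp
    also have "\<dots> = (LBINT x. (1 + h) powr (- \<beta>) * (u x * (LBINT t. c t * heat_flow ((1 + h) * t) u x)))"
      unfolding H_def mixture_form(1)[OF b u g, symmetric] conj[OF \<mu>]
      by (simp add: mult.left_commute)
    also have "\<dots> = (1 + h) powr (- \<beta>) * H c u u h"
      unfolding H_def mixture_form(1)[OF c u u, symmetric] integral_mult_right_zero ..
    finally show ?thesis using \<mu> by (simp add: powr_minus field_simps)
  qed
  \<comment> \<open>\<open>P h\<close> agrees with \<open>(1 + h) powr (- \<beta>) * E / 2\<close> to first order, so \<open>b, c, k\<close> drop out of the derivative.\<close>
  define P where "P h = H b g u h - H c u u h / 2 + H k g g h / 2" for h
  have P: "P h = (1 + h) powr (- \<beta>) * E / 2 + H b g u h * (1 - (1 + h) powr (- \<beta>) / 2 - (1 + h) powr \<beta> / 2)"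
    if "\<bar>h\<bar> < 1" for h
    unfolding P_def HK[OF that] HC[OF that] by (simp add: field_simps)
  have P0: "P 0 = E / 2" using P[of 0] by simp
  have dP: "(P has_field_derivative - ((G b g u - G c u u / 2 + G k g g / 2) + ?n * P 0) / 2) (at 0)"
  proof -
    have "(P has_field_derivative - (G b g u + ?n * H b g u 0) / 2 - (- (G c u u + ?n * H c u u 0) / 2) / 2
        + (- (G k g g + ?n * H k g g 0) / 2) / 2) (at 0)"
      unfolding P_def by (intro DERIV_add DERIV_diff DERIV_cdivide dH b c k u g)
    then show ?thesis unfolding P_def by (rule DERIV_cong) (simp add: field_simps)
  qed
  have dp: "((\<lambda>h. (1 + h) powr r) has_field_derivative r) (at 0)" for r :: real
    by (auto intro!: derivative_eq_intros)
  have "((\<lambda>h. (1 + h) powr (- \<beta>) * E / 2 + H b g u h * (1 - (1 + h) powr (- \<beta>) / 2 - (1 + h) powr \<beta> / 2))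
      has_field_derivative (- \<beta>) * E / 2 + ((- (G b g u + ?n * H b g u 0) / 2) * (1 - (1 + 0) powr (- \<beta>) / 2 - (1 + 0) powr \<beta> / 2)
        + (0 - (- \<beta>) / 2 - \<beta> / 2) * H b g u 0)) (at 0)"
    by (intro DERIV_add DERIV_mult DERIV_diff DERIV_cdivide DERIV_cmult_right dp dH b g u DERIV_const)
  then have "((\<lambda>h. (1 + h) powr (- \<beta>) * E / 2 + H b g u h * (1 - (1 + h) powr (- \<beta>) / 2 - (1 + h) powr \<beta> / 2))
      has_field_derivative - \<beta> * E / 2) (at 0)" by simp
  then have "(P has_field_derivative - \<beta> * E / 2) (at 0)"
    by (rule has_field_derivative_transform_within_open[where S = "{-1<..<1}"]) (auto simp: P abs_less_iff)
  \<comment> \<open>With P(0) = E/2 the two derivatives give -(limit + n E/2)/2 = -\<beta>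
    E/2.\<close>
  from DERIV_unique[OF dP this] have "G b g u - G c u u / 2 + G k g g / 2 = (\<beta> - ?n / 2) * E"
    unfolding P0 by (simp add: field_simps)
  with main show ?thesis by (simp add: E_def)
qed

end

section \<open>The Liouville theorem\<close>

text \<open>Away from the origin the Gaussian factor beats the power t^(-n/2) as t tends to 0, so
  the kernel is bounded there; at large times the prefactor alone gives the decay.\<close>

lemma heat_unit_decay:
  obtains C where "\<And>t (e :: 'a::euclidean_space). norm e = 1 \<Longrightarrow> heat t e \<le> C * decay (real DIM('a) / 2) t"
proof -
  let ?n = "DIM('a)" and ?Z = "gauss_mass TYPE('a)"
  define C where "C = max 1 ((4 * real ?n) ^ ?n) / ?Z"
  have Z: "?Z > 0" by (rule gauss_mass_pos)
  have C: "1 / ?Z \<le> C" "(4 * real ?n) ^ ?n / ?Z \<le> C" "0 \<le> C"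
    using Z by (auto simp: C_def intro!: divide_right_mono)
  have "heat t e \<le> C * decay (real ?n / 2) t" if e: "norm e = 1" for t and e :: 'a
  proof -
    consider "t \<le> 0" | "0 < t" "t \<le> 1" | "t > 1" by linarith
    then show ?thesis
    proof cases
      case 1
      then show ?thesis using C decay_bounds(1) by simp
    next
      case 2
      let ?X = "1 / (4 * t)"
      \<comment> \<open>From exp X >= (X/n)^n with X = 1/(4t), the Gaussian factor is at most (4n)^n
        t^n, more than enough against t^(-n/2); this is the origin of the constant in
        \<open>C\<close>.\<close>
      have "(?X / real ?n) ^ ?n \<le> (1 + ?X / real ?n) ^ ?n" using 2 by (intro power_mono) auto
      also have "\<dots> \<le> exp ?X"
        by (rule exp_ge_one_plus_x_over_n_power_n, rule order_trans[of _ "0 :: real"]) (use 2 in auto)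
      finally have "exp (- ?X) \<le> (4 * real ?n) ^ ?n * t ^ ?n"
        using 2 by (simp add: exp_minus field_simps)
      then have "t powr (- (real ?n / 2)) * exp (- ?X) \<le> t powr (- (real ?n / 2)) * ((4 * real ?n) ^ ?n * t powr real ?n)"
        using 2 by (intro mult_left_mono) (auto simp: powr_realpow)
      also have "\<dots> = (4 * real ?n) ^ ?n * t powr (real ?n / 2)"
        by (simp add: powr_add[symmetric])
      also have "\<dots> \<le> (4 * real ?n) ^ ?n * 1"
        using 2 by (intro mult_left_mono powr_le1) auto
      finally have "heat t e \<le> (4 * real ?n) ^ ?n / ?Z"
        using 2 e Z by (simp add: heat_def divide_right_mono)
      moreover have "decay (real ?n / 2) t = 1"
        using 2 powr_le1[of "real ?n / 2" t] by (simp add: decay_def powr_minus one_le_inverse)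
      ultimately show ?thesis using C by simp
    next
      case 3
      have "t powr (- (real ?n / 2)) \<le> 1" using 3 by (simp add: powr_minus inverse_le_1_iff ge_one_powr_ge_zero)
      then have "decay (real ?n / 2) t = t powr (- (real ?n / 2))" by (simp add: decay_def)
      moreover have "heat t e \<le> 1 / ?Z * t powr (- (real ?n / 2))" using heat_le[of t e] by simp
      ultimately show ?thesis using mult_right_mono[OF C(1), of "t powr (- (real ?n / 2))"] by simp
    qed
  qed
  then show ?thesis using that by blast
qed

text \<open>The heat kernel depends on z through its norm only, so any unit vector gives the same
  constant. Substituting t -> |z|^2 t extracts the power: the exponents 2, 2 (\<beta> - 1) and -n
  add up to 2 \<beta> - n. The constant is not evaluated; its positivity allows dividing by
  it.\<close>

lemma riesz_kernel:
  assumes \<beta>: "0 < \<beta>" "\<beta> < real DIM('a::euclidean_space) / 2"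
  obtains C where "C > 0"
    "\<And>z :: 'a. z \<noteq> 0 \<Longrightarrow> (LBINT t. frac_kernel \<beta> t * heat t z) = C / norm z powr (real DIM('a) - 2 * \<beta>)"
proof -
  let ?n = "real DIM('a)"
  obtain e :: 'a where "e \<in> Basis" using nonempty_Basis by blast
  then have e: "norm e = 1" by simp
  obtain D where D: "\<And>t (e :: 'a). norm e = 1 \<Longrightarrow> heat t e \<le> D * decay (?n / 2) t"
    by (rule heat_unit_decay) (rule that; assumption)
  define C where "C = (LBINT t. frac_kernel \<beta> t * heat t e)"
  have nonneg: "0 \<le> frac_kernel \<beta> t * heat t e" for t
    by (intro mult_nonneg_nonneg frac_kernel_nonneg heat_nonneg \<beta>)
  have int: "integrable lborel (\<lambda>t. frac_kernel \<beta> t * heat t e)"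
  proof (rule Bochner_Integration.integrable_bound)
    show "integrable lborel (\<lambda>t. D * (frac_kernel \<beta> t * decay (?n / 2) t))"
      by (intro integrable_mult_right frac_kernel_decay_integrable \<beta>)
    have "frac_kernel \<beta> t * heat t e \<le> D * (frac_kernel \<beta> t * decay (?n / 2) t)" for t
      using mult_left_mono[OF D[OF e, of t] frac_kernel_nonneg[OF \<beta>(1), of t]] by (simp add: mult_ac)
    then show "AE t in lborel. norm (frac_kernel \<beta> t * heat t e) \<le> norm (D * (frac_kernel \<beta> t * decay (?n / 2) t))"
      using nonneg by (intro AE_I2) (simp add: abs_of_nonneg order_trans[OF _ abs_ge_self])
  qed measurable
  have "C \<noteq> 0"
  proof
    assume "C = 0"
    then have "AE t in lborel. frac_kernel \<beta> t * heat t e = 0"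
      using integral_nonneg_eq_0_iff_AE[OF int] nonneg by (simp add: C_def)
    then have "AE t in lborel. t \<notin> {0<..<1::real}"
      by eventually_elim
        (use Gamma_real_pos[OF \<beta>(1)] gauss_mass_pos[where 'a = 'a] in \<open>auto simp: frac_kernel_def heat_def\<close>)
    then have "emeasure lborel {0<..<1::real} = 0"
      by (subst (asm) AE_iff_measurable[of "{0<..<1}"]) auto
    then show False by simp
  qed
  moreover have "C \<ge> 0" unfolding C_def using nonneg by (intro integral_nonneg_AE) auto
  ultimately have C: "C > 0" by simp
  have "(LBINT t. frac_kernel \<beta> t * heat t z) = C / norm z powr (?n - 2 * \<beta>)" if z: "z \<noteq> 0" for z :: 'a
  proof -
    define r where "r = norm z"
    have r: "r > 0" using z by (simp add: r_def)
    have sq: "r\<^sup>2 = r powr 2" using r by (simp add: powr_numeral)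
    have pw: "(r\<^sup>2) powr p = r powr (2 * p)" for p unfolding sq by (simp add: powr_powr)
    have eq: "frac_kernel \<beta> (r\<^sup>2 * t) * heat (r\<^sup>2 * t) z =
        (r powr (2 * (\<beta> - 1)) * r powr (- ?n)) * (frac_kernel \<beta> t * heat t e)" for t
    proof (cases "t > 0")
      case True
      then show ?thesis
        using r e by (simp add: frac_kernel_def heat_def powr_mult pw r_def[symmetric] divide_simps)
    next
      case False
      then have "\<not> r\<^sup>2 * t > 0" using r by (simp add: zero_less_mult_iff)
      then show ?thesis using False by (simp add: frac_kernel_def)
    qed
    have "(LBINT t. frac_kernel \<beta> t * heat t z) = r\<^sup>2 * (LBINT t. frac_kernel \<beta> (r\<^sup>2 * t) * heat (r\<^sup>2 * t) z)"
      using r by (subst lborel_integral_real_affine[where c = "r\<^sup>2" and t = 0]) auto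
    also have "\<dots> = r\<^sup>2 * ((r powr (2 * (\<beta> - 1)) * r powr (- ?n)) * C)"
      unfolding eq integral_mult_right_zero C_def ..
    also have "\<dots> = (r powr 2 * (r powr (2 * (\<beta> - 1)) * r powr (- ?n))) * C"
      unfolding sq by (simp only: mult.assoc)
    also have "r powr 2 * (r powr (2 * (\<beta> - 1)) * r powr (- ?n)) = r powr (- (?n - 2 * \<beta>))"
      unfolding powr_add[symmetric] by (simp add: algebra_simps)
    also have "r powr (- (?n - 2 * \<beta>)) * C = C / r powr (?n - 2 * \<beta>)"
      unfolding powr_minus_divide by simp
    finally show ?thesis by (simp only: r_def)
  qed
  with C show ?thesis using that by blast
qed

text \<open>Absolute convergence is checked with time outermost, where the decay of the heat flow of
  |v| suffices. The kernel formula fails only at y = x, a null set.\<close>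

lemma frac_int_heat_flow:
  assumes \<beta>: "0 < \<beta>" "\<beta> < real DIM('a::euclidean_space) / 4" and v: "bounded_L2 (v :: 'a \<Rightarrow> real)"
    and C: "\<And>z :: 'a. z \<noteq> 0 \<Longrightarrow> (LBINT t. frac_kernel \<beta> t * heat t z) = C / norm z powr (real DIM('a) - 2 * \<beta>)"
  shows "frac_int \<beta> (\<lambda>t. heat_flow t v x) 0 = C * (LBINT y. v y / norm (x - y) powr (real DIM('a) - 2 * \<beta>))"
proof -
  let ?n = "real DIM('a)"
  note [measurable] = bounded_L2_measurable[OF v]
  obtain D where D: "D \<ge> 0" "\<And>t x. t > 0 \<Longrightarrow> heat_flow t (\<lambda>y. \<bar>v y\<bar>) x \<le> D * decay (?n / 4) t"
    by (rule heat_flow_le_decay[OF v]) (rule that; assumption)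
  have int: "integrable (lborel \<Otimes>\<^sub>M lborel) (\<lambda>(t, y). frac_kernel \<beta> t * (heat t (x - y) * v y))"
  proof (rule lborel_pair.Fubini_integrable)
    have eq: "(LBINT y. norm (case (t, y) of (t, y) \<Rightarrow> frac_kernel \<beta> t * (heat t (x - y) * v y))) =
        frac_kernel \<beta> t * heat_flow t (\<lambda>y. \<bar>v y\<bar>) x" for t
      using frac_kernel_nonneg[OF \<beta>(1), of t] by (simp add: abs_mult heat_nonneg heat_flow_def)
    show "integrable lborel (\<lambda>t. LBINT y. norm (case (t, y) of (t, y) \<Rightarrow> frac_kernel \<beta> t * (heat t (x - y) * v y)))"
      unfolding eq
    proof (rule integrable_boundI)
      show "integrable lborel (\<lambda>t. D * (frac_kernel \<beta> t * decay (?n / 4) t))"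
        by (intro integrable_mult_right frac_kernel_decay_integrable \<beta>)
      show "\<bar>frac_kernel \<beta> t * heat_flow t (\<lambda>y. \<bar>v y\<bar>) x\<bar> \<le> \<bar>D * (frac_kernel \<beta> t * decay (?n / 4) t)\<bar>" for t
      proof (cases "t > 0")
        case True
        have "0 \<le> heat_flow t (\<lambda>y. \<bar>v y\<bar>) x" by (rule order_trans[OF abs_ge_zero heat_flow_abs_le])
        then show ?thesis
          using mult_left_mono[OF D(2)[OF True, of x] frac_kernel_nonneg[OF \<beta>(1), of t]] D(1)
            frac_kernel_nonneg[OF \<beta>(1), of t] decay_bounds(1)[of "?n / 4" t]
          by (simp add: abs_mult mult_ac)
      qed (simp add: frac_kernel_def)
    qed measurable
    show "AE t in lborel. integrable lborel (\<lambda>y. case (t, y) of (t, y) \<Rightarrow> frac_kernel \<beta> t * (heat t (x - y) * v y))"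
      using heat_flow_integrable[OF v] by (intro AE_I2) simp
  qed measurable
  have "frac_int \<beta> (\<lambda>t. heat_flow t v x) 0 = (LBINT t. (LBINT y. frac_kernel \<beta> t * (heat t (x - y) * v y)))"
    by (simp add: frac_int_def smear_def heat_flow_def)
  also have "\<dots> = (LBINT y. (LBINT t. frac_kernel \<beta> t * (heat t (x - y) * v y)))"
    by (rule lborel_pair.Fubini_integral[OF int, symmetric])
  also have "\<dots> = (LBINT y. C * (v y / norm (x - y) powr (?n - 2 * \<beta>)))"
  proof (rule integral_cong_AE)
    show "(\<lambda>y. LBINT t. frac_kernel \<beta> t * (heat t (x - y) * v y)) \<in> borel_measurable lborel" by measurable
    show "(\<lambda>y. C * (v y / norm (x - y) powr (?n - 2 * \<beta>))) \<in> borel_measurable lborel" by measurable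
    show "AE y in lborel. (LBINT t. frac_kernel \<beta> t * (heat t (x - y) * v y)) = C * (v y / norm (x - y) powr (?n - 2 * \<beta>))"
      using AE_lborel_singleton[of x]
    proof eventually_elim
      case (elim y)
      then show ?case using C[of "x - y"] by (simp add: mult.assoc[symmetric])
    qed
  qed
  finally show ?thesis by (simp only: integral_mult_right_zero)
qed

section \<open>The truncated radial field and its divergence\<close>

definition cutoff :: "real \<Rightarrow> 'a::euclidean_space \<Rightarrow> 'a \<Rightarrow> real" where
  "cutoff d i x = (x \<bullet> i) * exp (- d * (norm x)\<^sup>2)"

lemma cutoff_measurable [measurable]: "cutoff d i \<in> borel_measurable borel"
  unfolding cutoff_def[abs_def] by measurable

text \<open>Half of the Gaussian absorbs the linear growth: s <= 1 + s^2 <= (1 + 2/d) exp (d s^2 /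
  2). What is left is an integrable Gaussian.\<close>

lemma cutoff_bound:
  assumes d: "d > 0" and i: "i \<in> Basis"
  shows "\<bar>cutoff d i x\<bar> \<le> (1 + 2 / d) * exp (- (d / 2) * (norm x)\<^sup>2)"
proof -
  define s where "s = norm x"
  have s: "s \<ge> 0" by (simp add: s_def)
  define Y where "Y = d / 2 * s\<^sup>2"
  have Y: "Y \<ge> 0" "s\<^sup>2 = 2 / d * Y" using d by (auto simp: Y_def)
  have "1 + Y \<le> exp Y" by (rule exp_ge_add_one_self)
  then have E: "1 \<le> exp Y" "Y \<le> exp Y" using Y(1) by linarith+
  have "0 \<le> (s - 1)\<^sup>2" by simp
  then have "s \<le> 1 + s\<^sup>2" using s by (simp add: power2_diff)
  also have "\<dots> \<le> exp Y + 2 / d * exp Y"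
    unfolding Y(2) using E Y(1) d by (intro add_mono mult_left_mono) auto
  finally have "s \<le> exp (d / 2 * s\<^sup>2) + 2 / d * exp (d / 2 * s\<^sup>2)" unfolding Y_def .
  then have "s \<le> (1 + 2 / d) * exp (d / 2 * s\<^sup>2)" by (simp add: distrib_right)
  then have "s * exp (- d * s\<^sup>2) \<le> (1 + 2 / d) * exp (d / 2 * s\<^sup>2) * exp (- d * s\<^sup>2)"
    by (rule mult_right_mono) simp
  also have "\<dots> = (1 + 2 / d) * exp (- (d / 2) * s\<^sup>2)"
    unfolding mult.assoc exp_add[symmetric] by simp
  finally have "norm x * exp (- d * (norm x)\<^sup>2) \<le> (1 + 2 / d) * exp (- (d / 2) * (norm x)\<^sup>2)"
    by (simp add: s_def)
  moreover have "\<bar>cutoff d i x\<bar> \<le> norm x * exp (- d * (norm x)\<^sup>2)"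
    using Basis_le_norm[OF i, of x] by (simp add: cutoff_def abs_mult)
  ultimately show ?thesis by linarith
qed

lemma cutoff_integrable:
  assumes d: "d > 0" and i: "i \<in> Basis"
  shows "integrable lborel (cutoff d i)"
proof (rule Bochner_Integration.integrable_bound)
  show "integrable lborel (\<lambda>x::'a. (1 + 2 / d) * exp (- (d / 2) * (norm x)\<^sup>2))"
    using d by (intro integrable_mult_right gaussian_integrable) simp
  show "AE x in lborel. norm (cutoff d i x) \<le> norm ((1 + 2 / d) * exp (- (d / 2) * (norm x)\<^sup>2))"
    unfolding real_norm_def by (intro AE_I2 order_trans[OF cutoff_bound[OF d i] abs_ge_self])
qed measurable

lemma cutoff_bounded:
  assumes d: "d > 0" and i: "i \<in> Basis"
  shows "\<bar>cutoff d i x\<bar> \<le> 1 + 2 / d"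
proof -
  have "(1 + 2 / d) * exp (- (d / 2) * (norm x)\<^sup>2) \<le> (1 + 2 / d) * 1"
    using d by (intro mult_left_mono) auto
  from order_trans[OF cutoff_bound[OF d i] this] show ?thesis by simp
qed

lemma cutoff_derivative:
  "((\<lambda>h. cutoff d i (x + h *\<^sub>R w)) has_field_derivative
    ((w \<bullet> i) - 2 * d * ((x + h *\<^sub>R w) \<bullet> w) * ((x + h *\<^sub>R w) \<bullet> i)) * exp (- d * (norm (x + h *\<^sub>R w))\<^sup>2)) (at h)"
proof -
  have sq: "(norm (x + h *\<^sub>R w))\<^sup>2 = (norm x)\<^sup>2 + 2 * h * (x \<bullet> w) + h\<^sup>2 * (w \<bullet> w)" for h
    unfolding power2_norm_eq_inner by (simp add: inner_add inner_commute power2_eq_square)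
  have eq: "(\<lambda>h. cutoff d i (x + h *\<^sub>R w)) = (\<lambda>h. (x \<bullet> i + h * (w \<bullet> i)) *
      exp (- d * ((norm x)\<^sup>2 + 2 * h * (x \<bullet> w) + h\<^sup>2 * (w \<bullet> w))))"
    by (simp add: cutoff_def sq inner_add_left fun_eq_iff)
  have "((\<lambda>h. - d * ((norm x)\<^sup>2 + 2 * h * (x \<bullet> w) + h\<^sup>2 * (w \<bullet> w))) has_field_derivative - d * (2 * (x \<bullet> w) + 2 * h * (w \<bullet> w))) (at h)"
    by (auto intro!: derivative_eq_intros)
  note E = DERIV_fun_exp[OF this]
  have L: "((\<lambda>h. x \<bullet> i + h * (w \<bullet> i)) has_field_derivative w \<bullet> i) (at h)"
    by (auto intro!: derivative_eq_intros)
  show ?thesis unfolding eq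
    by (rule DERIV_cong[OF DERIV_mult[OF L E]])
      (simp only: sq inner_add_left inner_scaleR_left, simp add: algebra_simps)
qed

text \<open>With Y = d |z|^2 the derivative along w is at most (1 + 2Y) exp (-Y) |w|, and 1 + 2Y <=
  2 exp Y. Only the combination Y contains d, so the constant survives the limit d -> 0.\<close>

lemma cutoff_lipschitz:
  assumes d: "d > 0" and i: "i \<in> Basis"
  shows "\<bar>cutoff d i x - cutoff d i y\<bar> \<le> 2 * norm (x - y)"
proof -
  let ?w = "x - y"
  have "norm (cutoff d i (y + 1 *\<^sub>R ?w) - cutoff d i (y + 0 *\<^sub>R ?w)) \<le> (2 * norm ?w) * norm (1 - 0 :: real)"
  proof (rule field_differentiable_bound[of UNIV])
    fix h :: real
    let ?z = "y + h *\<^sub>R ?w"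
    let ?D = "((?w \<bullet> i) - 2 * d * (?z \<bullet> ?w) * (?z \<bullet> i)) * exp (- d * (norm ?z)\<^sup>2)"
    show "((\<lambda>h. cutoff d i (y + h *\<^sub>R ?w)) has_field_derivative ?D) (at h within UNIV)"
      using cutoff_derivative[of d i y ?w h] by simp
    have 1: "\<bar>?w \<bullet> i\<bar> \<le> norm ?w" by (rule Basis_le_norm[OF i])
    have "\<bar>?z \<bullet> ?w\<bar> * \<bar>?z \<bullet> i\<bar> \<le> (norm ?z * norm ?w) * norm ?z"
      by (intro mult_mono Cauchy_Schwarz_ineq2 Basis_le_norm[OF i]) auto
    then have 2: "\<bar>2 * d * (?z \<bullet> ?w) * (?z \<bullet> i)\<bar> \<le> 2 * (d * (norm ?z)\<^sup>2) * norm ?w"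
      using d by (simp add: abs_mult power2_eq_square mult_ac)
    have "\<bar>(?w \<bullet> i) - 2 * d * (?z \<bullet> ?w) * (?z \<bullet> i)\<bar> \<le> norm ?w + 2 * (d * (norm ?z)\<^sup>2) * norm ?w"
      using 1 2 by linarith
    also have "\<dots> = (1 + 2 * (d * (norm ?z)\<^sup>2)) * norm ?w" by (simp add: distrib_right)
    also have "\<dots> \<le> (2 * exp (d * (norm ?z)\<^sup>2)) * norm ?w"
    proof -
      have "1 + 2 * Y \<le> 2 * exp Y" for Y :: real using exp_ge_add_one_self[of Y] by linarith
      then show ?thesis by (rule mult_right_mono) simp
    qed
    finally have "\<bar>(?w \<bullet> i) - 2 * d * (?z \<bullet> ?w) * (?z \<bullet> i)\<bar> * exp (- d * (norm ?z)\<^sup>2) \<le>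
        (2 * exp (d * (norm ?z)\<^sup>2)) * norm ?w * exp (- d * (norm ?z)\<^sup>2)"
      by (rule mult_right_mono) simp
    also have "\<dots> = 2 * norm ?w * (exp (d * (norm ?z)\<^sup>2) * exp (- d * (norm ?z)\<^sup>2))" by (simp only: mult_ac)
    also have "\<dots> = 2 * norm ?w" unfolding exp_add[symmetric] by simp
    finally show "norm ?D \<le> 2 * norm ?w" by (simp add: abs_mult)
  qed auto
  then show ?thesis by simp
qed

text \<open>Both sides are the derivative at h = 0 of one function of h, the integral of X(x) F(x +
  h i), which translation turns into that of X(x - h i) F(x). No boundary terms occur and
  \<open>dF\<close> need not be continuous.\<close>

lemma cutoff_integration_by_parts:
  fixes F :: "'a::euclidean_space \<Rightarrow> real"
  assumes d: "d > 0" and i: "i \<in> Basis"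
    and F: "integrable lborel F" and [measurable]: "dF \<in> borel_measurable borel"
    and dF: "\<And>x. ((\<lambda>h. F (x + h *\<^sub>R i)) has_field_derivative dF x) (at 0)"
    and F_lip: "\<And>x h. \<bar>F (x + h *\<^sub>R i) - F x\<bar> \<le> L * \<bar>h\<bar>"
  shows "(LBINT x. cutoff d i x * dF x) =
    - (LBINT x. (1 - 2 * d * (x \<bullet> i)\<^sup>2) * exp (- d * (norm x)\<^sup>2) * F x)"
proof -
  have [measurable]: "F \<in> borel_measurable borel" using F by auto
  have X: "integrable lborel (cutoff d i)" by (rule cutoff_integrable[OF d i])
  have Fs: "integrable lborel (\<lambda>x. F (x + a))" for a using F by (simp add: lborel_integrable_translate_iff)
  have XF: "integrable lborel (\<lambda>x. cutoff d i (x + a) * F x)" for a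
  proof (rule integrable_boundI)
    show "integrable lborel (\<lambda>x. (1 + 2 / d) * F x)" using F by simp
    show "\<bar>cutoff d i (x + a) * F x\<bar> \<le> \<bar>(1 + 2 / d) * F x\<bar>" for x
      using mult_right_mono[OF cutoff_bounded[OF d i, of "x + a"] abs_ge_zero[of "F x"]] d
      by (simp add: abs_mult)
  qed measurable
  have eq: "(LBINT x. cutoff d i x * F (x + h *\<^sub>R i)) = (LBINT x. cutoff d i (x + (- h) *\<^sub>R i) * F x)" for h
    using lborel_integral_translate[of "\<lambda>x. cutoff d i (x + (- h) *\<^sub>R i) * F x" "h *\<^sub>R i"] by simp
  have 1: "((\<lambda>h. LBINT x. cutoff d i x * F (x + h *\<^sub>R i)) has_field_derivative (LBINT x. cutoff d i x * dF x)) (at 0)"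
  proof (rule has_field_derivative_integral[where r = 1 and w = "\<lambda>x. \<bar>cutoff d i x\<bar> * L"])
    show "integrable lborel (\<lambda>x. cutoff d i x * F (x + h *\<^sub>R i))" for h
      using XF[of "(- h) *\<^sub>R i"]
        lborel_integrable_translate_iff[of "\<lambda>x. cutoff d i (x + (- h) *\<^sub>R i) * F x" "h *\<^sub>R i"] by simp
    show "integrable lborel (\<lambda>x. \<bar>cutoff d i x\<bar> * L)" using X by simp
    show "((\<lambda>h. cutoff d i x * F (x + h *\<^sub>R i)) has_field_derivative cutoff d i x * dF x) (at 0)" for x
      by (intro DERIV_cmult dF)
    show "\<bar>cutoff d i x * F (x + h *\<^sub>R i) - cutoff d i x * F (x + 0 *\<^sub>R i)\<bar> \<le> \<bar>h\<bar> * (\<bar>cutoff d i x\<bar> * L)" for h x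
    proof -
      have "cutoff d i x * F (x + h *\<^sub>R i) - cutoff d i x * F (x + 0 *\<^sub>R i) = cutoff d i x * (F (x + h *\<^sub>R i) - F x)"
        by (simp add: right_diff_distrib)
      then show ?thesis
        using mult_left_mono[OF F_lip[of x h] abs_ge_zero[of "cutoff d i x"]] by (simp only: abs_mult mult_ac)
    qed
    show "(\<lambda>x. cutoff d i x * dF x) \<in> borel_measurable lborel" by measurable
  qed simp
  let ?Y = "\<lambda>x. (1 - 2 * d * (x \<bullet> i)\<^sup>2) * exp (- d * (norm x)\<^sup>2)"
  have 2: "((\<lambda>h. LBINT x. cutoff d i (x + (- h) *\<^sub>R i) * F x) has_field_derivative (LBINT x. - (?Y x * F x))) (at 0)"
  proof (rule has_field_derivative_integral[where r = 1 and w = "\<lambda>x. 2 * \<bar>F x\<bar>"])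
    show "integrable lborel (\<lambda>x. cutoff d i (x + (- h) *\<^sub>R i) * F x)" for h by (rule XF)
    show "integrable lborel (\<lambda>x. 2 * \<bar>F x\<bar>)" using F by simp
    show "((\<lambda>h. cutoff d i (x + (- h) *\<^sub>R i) * F x) has_field_derivative - (?Y x * F x)) (at 0)" for x
    proof -
      have "((\<lambda>h. cutoff d i (x + h *\<^sub>R (- i))) has_field_derivative
          ((- i) \<bullet> i - 2 * d * ((x + 0 *\<^sub>R (- i)) \<bullet> (- i)) * ((x + 0 *\<^sub>R (- i)) \<bullet> i)) * exp (- d * (norm (x + 0 *\<^sub>R (- i)))\<^sup>2)) (at 0)"
        by (rule cutoff_derivative)
      then have "((\<lambda>h. cutoff d i (x + (- h) *\<^sub>R i)) has_field_derivative - ?Y x) (at 0)"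
        using i by (simp add: power2_eq_square left_diff_distrib mult.assoc)
      from DERIV_cmult_right[OF this, of "F x"] show ?thesis by (simp add: mult.assoc)
    qed
    show "\<bar>cutoff d i (x + (- h) *\<^sub>R i) * F x - cutoff d i (x + (- 0) *\<^sub>R i) * F x\<bar> \<le> \<bar>h\<bar> * (2 * \<bar>F x\<bar>)" for h x
    proof -
      have "\<bar>cutoff d i (x + (- h) *\<^sub>R i) - cutoff d i x\<bar> \<le> 2 * \<bar>h\<bar>"
        using cutoff_lipschitz[OF d i, of "x + (- h) *\<^sub>R i" x] i by simp
      moreover have "cutoff d i (x + (- h) *\<^sub>R i) * F x - cutoff d i (x + (- 0) *\<^sub>R i) * F x =
          (cutoff d i (x + (- h) *\<^sub>R i) - cutoff d i x) * F x"
        by (simp add: left_diff_distrib)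
      ultimately show ?thesis
        using mult_right_mono[OF _ abs_ge_zero[of "F x"], of "\<bar>cutoff d i (x + (- h) *\<^sub>R i) - cutoff d i x\<bar>" "2 * \<bar>h\<bar>"]
        by (simp only: abs_mult mult_ac)
    qed
    show "(\<lambda>x. - (?Y x * F x)) \<in> borel_measurable lborel" by measurable
  qed simp
  show ?thesis using DERIV_unique[OF 1 2[folded eq]] by simp
qed

text \<open>The derivative of the \<open>i\<close>-th component along \<open>i\<close> tends to 1.
  With Y = d |x|^2 the polynomial factor is at most 1 + 2Y <= 3 exp Y, whence the majorant 3
  |F|.\<close>

lemma cutoff_divergence_limit:
  fixes F :: "'a::euclidean_space \<Rightarrow> real"
  assumes F: "integrable lborel F" and i: "i \<in> Basis" and d: "\<And>m. d m > 0" "d \<longlonglongrightarrow> 0"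
  shows "(\<lambda>m. LBINT x. (1 - 2 * d m * (x \<bullet> i)\<^sup>2) * exp (- d m * (norm x)\<^sup>2) * F x) \<longlonglongrightarrow> (LBINT x. F x)"
proof (rule integral_dominated_convergence[where w = "\<lambda>x. 3 * \<bar>F x\<bar>"])
  have [measurable]: "F \<in> borel_measurable borel" using F by auto
  show "F \<in> borel_measurable lborel" by simp
  show "(\<lambda>x. (1 - 2 * d m * (x \<bullet> i)\<^sup>2) * exp (- d m * (norm x)\<^sup>2) * F x) \<in> borel_measurable lborel" for m by measurable
  show "integrable lborel (\<lambda>x. 3 * \<bar>F x\<bar>)" using F by simp
  show "AE x in lborel. (\<lambda>m. (1 - 2 * d m * (x \<bullet> i)\<^sup>2) * exp (- d m * (norm x)\<^sup>2) * F x) \<longlonglongrightarrow> F x"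
  proof (rule AE_I2)
    fix x :: 'a
    have "(\<lambda>m. (1 - 2 * d m * (x \<bullet> i)\<^sup>2) * exp (- d m * (norm x)\<^sup>2) * F x) \<longlonglongrightarrow>
        (1 - 2 * 0 * (x \<bullet> i)\<^sup>2) * exp (- 0 * (norm x)\<^sup>2) * F x"
      by (intro tendsto_intros d(2))
    then show "(\<lambda>m. (1 - 2 * d m * (x \<bullet> i)\<^sup>2) * exp (- d m * (norm x)\<^sup>2) * F x) \<longlonglongrightarrow> F x" by simp
  qed
  show "AE x in lborel. norm ((1 - 2 * d m * (x \<bullet> i)\<^sup>2) * exp (- d m * (norm x)\<^sup>2) * F x) \<le> 3 * \<bar>F x\<bar>" for m
  proof (rule AE_I2)
    fix x :: 'a
    define Y where "Y = d m * (norm x)\<^sup>2"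
    have Y: "Y \<ge> 0" "1 + Y \<le> exp Y" using d(1)[of m] exp_ge_add_one_self[of Y] by (auto simp: Y_def)
    have "(x \<bullet> i)\<^sup>2 \<le> (norm x)\<^sup>2"
      using Basis_le_norm[OF i, of x] by (simp add: abs_le_square_iff[symmetric])
    then have "0 \<le> d m * (x \<bullet> i)\<^sup>2" "d m * (x \<bullet> i)\<^sup>2 \<le> Y" using d(1)[of m] by (auto simp: Y_def mult_left_mono)
    then have "\<bar>1 - 2 * d m * (x \<bullet> i)\<^sup>2\<bar> \<le> 3 * exp Y" using Y by linarith
    then have "\<bar>1 - 2 * d m * (x \<bullet> i)\<^sup>2\<bar> * exp (- Y) \<le> 3 * exp Y * exp (- Y)" by (rule mult_right_mono) simp
    also have "3 * exp Y * exp (- Y) = 3" by (simp add: exp_minus)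
    finally have "\<bar>1 - 2 * d m * (x \<bullet> i)\<^sup>2\<bar> * exp (- Y) * \<bar>F x\<bar> \<le> 3 * \<bar>F x\<bar>" by (rule mult_right_mono) simp
    then show "norm ((1 - 2 * d m * (x \<bullet> i)\<^sup>2) * exp (- d m * (norm x)\<^sup>2) * F x) \<le> 3 * \<bar>F x\<bar>"
      by (simp add: abs_mult Y_def)
  qed
qed

text \<open>The nonlinearity is a gradient: \<Phi> = |u|^2/2 - |u|^4/4 is a potential for v . du.
  The limit of the integrals of X . (v . du) thus has two values, -n times the integral of \<Phi> by
  integration by parts, and the one from \<open>pohozaev_limit\<close> summed over components.
  Equating them leaves two nonnegative terms with sum 0.\<close>

theorem ginzburg_landau_liouville:
  fixes u :: "'a::euclidean_space \<Rightarrow> 'b::euclidean_space" and \<alpha> :: real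
  assumes \<alpha>: "1 < \<alpha>" "\<alpha> < real DIM('a) / 2"
    and bdd: "bounded (range u)"
    and diff: "\<And>x. u differentiable (at x)"
    and eq: "\<And>x. has_bochner_integral lborel
               (\<lambda>y. ((1 - (norm (u y))\<^sup>2) / norm (x - y) powr (real DIM('a) - \<alpha>)) *\<^sub>R u y) (u x)"
    and L2: "integrable lborel (\<lambda>x. (norm (u x))\<^sup>2)"
  shows "u x = 0"
proof -
  let ?n = "real DIM('a)"
  define \<beta> where "\<beta> = \<alpha> / 2"
  have \<beta>: "1 / 2 < \<beta>" "\<beta> < ?n / 4" "0 < \<beta>" "\<beta> < ?n / 2" "\<alpha> = 2 * \<beta>" using \<alpha> by (auto simp: \<beta>_def)
  obtain M where M: "\<And>x. norm (u x) \<le> M" using bdd by (auto simp: bounded_iff)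
  have M0: "M \<ge> 0" using order_trans[OF norm_ge_zero M] .
  have "continuous_on UNIV u"
    using diff by (simp add: continuous_on_eq_continuous_at differentiable_imp_continuous_within)
  then have [measurable]: "u \<in> borel_measurable borel" by (rule borel_measurable_continuous_onI)
  define v where "v j x = (1 - (norm (u x))\<^sup>2) * (u x \<bullet> j)" for j x
  have [measurable]: "v j \<in> borel_measurable borel" for j unfolding v_def[abs_def] by measurable
  have uj: "\<bar>u x \<bullet> j\<bar> \<le> norm (u x)" if "j \<in> Basis" for x j by (rule Basis_le_norm[OF that])
  have N2: "(norm (u x))\<^sup>2 \<le> M\<^sup>2" for x using M[of x] by (simp add: power_mono)
  have factor: "\<bar>1 - (norm (u x))\<^sup>2\<bar> \<le> 1 + M\<^sup>2" for x using N2[of x] zero_le_power2[of "norm (u x)"] by linarith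
  have bL_u: "bounded_L2 (\<lambda>x. u x \<bullet> j)" if j: "j \<in> Basis" for j
  proof -
    have "integrable lborel (\<lambda>x. (u x \<bullet> j)\<^sup>2)"
      by (rule Bochner_Integration.integrable_bound[OF L2])
        (use uj[OF j] in \<open>auto simp: abs_le_square_iff[symmetric]\<close>)
    moreover have "\<bar>u x \<bullet> j\<bar> \<le> M" for x using uj[OF j, of x] M[of x] by linarith
    ultimately show ?thesis by (auto simp: bounded_L2_def)
  qed
  have v_le: "\<bar>v j x\<bar> \<le> (1 + M\<^sup>2) * \<bar>u x \<bullet> j\<bar>" for j x
    unfolding v_def abs_mult by (intro mult_right_mono factor) simp
  have bL_v: "bounded_L2 (v j)" if j: "j \<in> Basis" for j
  proof -
    have "integrable lborel (\<lambda>x. (v j x)\<^sup>2)"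
    proof (rule Bochner_Integration.integrable_bound)
      show "integrable lborel (\<lambda>x. (1 + M\<^sup>2)\<^sup>2 * (u x \<bullet> j)\<^sup>2)" using bL_u[OF j] by (simp add: bounded_L2_def)
      have "(v j x)\<^sup>2 \<le> (1 + M\<^sup>2)\<^sup>2 * (u x \<bullet> j)\<^sup>2" for x
        using power_mono[OF v_le[of j x], of 2] by (simp add: power_mult_distrib)
      then show "AE x in lborel. norm ((v j x)\<^sup>2) \<le> norm ((1 + M\<^sup>2)\<^sup>2 * (u x \<bullet> j)\<^sup>2)" by simp
    qed measurable
    moreover have "\<bar>v j x\<bar> \<le> (1 + M\<^sup>2) * M" for x
    proof -
      have "\<bar>u x \<bullet> j\<bar> \<le> M" using uj[OF j, of x] M[of x] by linarith
      then show ?thesis by (intro order_trans[OF v_le] mult_left_mono) auto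
    qed
    ultimately show ?thesis by (auto simp: bounded_L2_def)
  qed
  obtain C where C: "C > 0"
    "\<And>z :: 'a. z \<noteq> 0 \<Longrightarrow> (LBINT t. frac_kernel \<beta> t * heat t z) = C / norm z powr (?n - 2 * \<beta>)"
    by (rule riesz_kernel[OF \<beta>(3,4)]) (rule that; assumption)
  \<comment> \<open>Dividing by the constant of the Riesz kernel makes each component of
    \<open>u\<close> the fractional integral of the heat flow of \<open>g j\<close>, as
    \<open>riesz_pair\<close> asks.\<close>
  define g where "g j x = (1 / C) * v j x" for j x
  have bL_g: "bounded_L2 (g j)" if "j \<in> Basis" for j
    unfolding g_def[abs_def] by (rule bounded_L2_cmult[OF bL_v[OF that]])
  have RP: "riesz_pair \<beta> (\<lambda>x. u x \<bullet> j) (g j)" if j: "j \<in> Basis" for j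
  proof
    fix x
    have "has_bochner_integral lborel (\<lambda>y. (((1 - (norm (u y))\<^sup>2) / norm (x - y) powr (?n - \<alpha>)) *\<^sub>R u y) \<bullet> j) (u x \<bullet> j)"
      by (rule has_bochner_integral_inner_left[OF eq])
    then have "u x \<bullet> j = (LBINT y. v j y / norm (x - y) powr (?n - 2 * \<beta>))"
      by (simp add: has_bochner_integral_iff v_def \<beta>(5))
    also have "\<dots> = (LBINT y. C * (g j y / norm (x - y) powr (?n - 2 * \<beta>)))"
      using C(1) by (simp add: g_def)
    also have "\<dots> = C * (LBINT y. g j y / norm (x - y) powr (?n - 2 * \<beta>))"
      by (rule integral_mult_right_zero)
    also have "\<dots> = frac_int \<beta> (\<lambda>t. heat_flow t (g j) x) 0"
      by (rule frac_int_heat_flow[OF \<beta>(3,2) bL_g[OF j] C(2), symmetric])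
    finally show "u x \<bullet> j = frac_int \<beta> (\<lambda>t. heat_flow t (g j) x) 0" .
  qed (use \<beta> bL_u[OF j] bL_g[OF j] in auto)
  have "\<exists>L. \<forall>i\<in>Basis. \<forall>x h. \<bar>u (x + h *\<^sub>R i) \<bullet> j - u x \<bullet> j\<bar> \<le> L * \<bar>h\<bar>" if j: "j \<in> Basis" for j
    by (rule riesz_pair.lipschitz[OF RP[OF j]]) blast
  then obtain Lj where Lj: "\<And>j i x h. j \<in> Basis \<Longrightarrow> i \<in> Basis \<Longrightarrow> \<bar>u (x + h *\<^sub>R i) \<bullet> j - u x \<bullet> j\<bar> \<le> Lj j * \<bar>h\<bar>"
    by metis
  define L where "L = (\<Sum>j\<in>Basis. Lj j)"
  have lip: "norm (u (x + h *\<^sub>R i) - u x) \<le> L * \<bar>h\<bar>" if i: "i \<in> Basis" for i x h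
  proof -
    have "norm (u (x + h *\<^sub>R i) - u x) \<le> (\<Sum>j\<in>Basis. \<bar>(u (x + h *\<^sub>R i) - u x) \<bullet> j\<bar>)" by (rule norm_le_l1)
    also have "\<dots> \<le> (\<Sum>j\<in>Basis. Lj j * \<bar>h\<bar>)" by (rule sum_mono) (use Lj[OF _ i] in \<open>simp add: inner_diff_left\<close>)
    finally show ?thesis by (simp add: L_def sum_distrib_right)
  qed
  have sq_lip: "\<bar>(norm (u (x + h *\<^sub>R i)))\<^sup>2 - (norm (u x))\<^sup>2\<bar> \<le> 2 * M * (L * \<bar>h\<bar>)" if i: "i \<in> Basis" for i x h
  proof -
    have "\<bar>(norm (u (x + h *\<^sub>R i)))\<^sup>2 - (norm (u x))\<^sup>2\<bar> =
        (norm (u (x + h *\<^sub>R i)) + norm (u x)) * \<bar>norm (u (x + h *\<^sub>R i)) - norm (u x)\<bar>"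
      by (simp add: power2_eq_square square_diff_square_factored abs_mult)
    also have "\<dots> \<le> (2 * M) * (L * \<bar>h\<bar>)"
      using M[of x] M[of "x + h *\<^sub>R i"] M0 lip[OF i, of x h] norm_triangle_ineq3[of "u (x + h *\<^sub>R i)" "u x"]
      by (intro mult_mono) auto
    finally show ?thesis by simp
  qed
  have v_lip: "\<bar>v j (x + h *\<^sub>R i) - v j x\<bar> \<le> ((1 + M\<^sup>2) * L + M * (2 * M * L)) * \<bar>h\<bar>"
    if i: "i \<in> Basis" and j: "j \<in> Basis" for i j x h
  proof -
    let ?y = "x + h *\<^sub>R i"
    have "v j ?y - v j x = (1 - (norm (u ?y))\<^sup>2) * ((u ?y - u x) \<bullet> j) - ((norm (u ?y))\<^sup>2 - (norm (u x))\<^sup>2) * (u x \<bullet> j)"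
      by (simp add: v_def inner_diff_left algebra_simps)
    also have "\<bar>\<dots>\<bar> \<le> \<bar>1 - (norm (u ?y))\<^sup>2\<bar> * \<bar>(u ?y - u x) \<bullet> j\<bar> + \<bar>(norm (u ?y))\<^sup>2 - (norm (u x))\<^sup>2\<bar> * \<bar>u x \<bullet> j\<bar>"
      unfolding abs_mult[symmetric] by (rule abs_triangle_ineq4)
    also have "\<dots> \<le> (1 + M\<^sup>2) * (L * \<bar>h\<bar>) + (2 * M * (L * \<bar>h\<bar>)) * M"
      using uj[OF j, of x] M[of x] Basis_le_norm[OF j, of "u ?y - u x"] lip[OF i, of x h] M0
        order_trans[OF abs_ge_zero sq_lip[OF i, of x h]]
      by (intro add_mono mult_mono factor sq_lip[OF i]) auto
    finally show ?thesis by (simp add: algebra_simps)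
  qed
  define du where "du j i x = frechet_derivative u (at x) i \<bullet> j" for j i x
  have du: "((\<lambda>h. u (x + h *\<^sub>R i) \<bullet> j) has_field_derivative du j i x) (at 0)" for i j x
  proof -
    have "(u has_derivative frechet_derivative u (at x)) (at (x + 0 *\<^sub>R i))"
      using diff[of x] by (simp add: frechet_derivative_works)
    moreover have "((\<lambda>h. x + h *\<^sub>R i) has_derivative (\<lambda>h. h *\<^sub>R i)) (at (0::real))"
      by (auto intro!: derivative_eq_intros)
    ultimately have "((\<lambda>h. u (x + h *\<^sub>R i)) has_derivative (\<lambda>h. frechet_derivative u (at x) (h *\<^sub>R i))) (at 0)"
      by (rule has_derivative_compose[rotated])
    then have "((\<lambda>h. u (x + h *\<^sub>R i) \<bullet> j) has_derivative (\<lambda>h. frechet_derivative u (at x) (h *\<^sub>R i) \<bullet> j)) (at 0)"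
      by (rule has_derivative_inner_left)
    moreover have "frechet_derivative u (at x) (h *\<^sub>R i) \<bullet> j = h * du j i x" for h
      using linear_frechet_derivative[OF diff[of x]] by (simp add: du_def linear_cmul)
    ultimately show ?thesis by (simp add: has_field_derivative_def mult.commute[of _ "du j i x"] fun_eq_iff)
  qed
  have du_le: "\<bar>du j i x\<bar> \<le> L" if i: "i \<in> Basis" and j: "j \<in> Basis" for i j x
  proof (rule derivative_bound_of_lipschitz[OF du])
    fix h
    show "\<bar>u (x + h *\<^sub>R i) \<bullet> j - u (x + 0 *\<^sub>R i) \<bullet> j\<bar> \<le> L * \<bar>h\<bar>"
      using Basis_le_norm[OF j, of "u (x + h *\<^sub>R i) - u x"] lip[OF i, of x h] by (simp add: inner_diff_left)
  qed
  \<comment> \<open>Continuity of the derivative is not assumed; measurability comes from difference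
    quotients along h = 1/(n+1).\<close>
  have [measurable]: "du j i \<in> borel_measurable borel" for i j
  proof (rule borel_measurable_LIMSEQ_real)
    show "(\<lambda>n. (u (x + (1 / real (Suc n)) *\<^sub>R i) \<bullet> j - u x \<bullet> j) / (1 / real (Suc n))) \<longlonglongrightarrow> du j i x" for x
    proof -
      have "((\<lambda>h. (u (x + h *\<^sub>R i) \<bullet> j - u x \<bullet> j) / h) \<longlongrightarrow> du j i x) (at 0)"
        using du[of x i j] by (simp add: DERIV_def)
      moreover have "filterlim (\<lambda>n. 1 / real (Suc n)) (at 0) sequentially"
        unfolding filterlim_at using LIMSEQ_inverse_real_of_nat by (simp add: inverse_eq_divide)
      ultimately show ?thesis by (rule filterlim_compose)
    qed
  qed measurable
  define N where "N x = (norm (u x))\<^sup>2" for x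
  define \<Phi> where "\<Phi> x = N x / 2 - (N x)\<^sup>2 / 4" for x
  have [measurable]: "N \<in> borel_measurable borel" unfolding N_def[abs_def] by measurable
  have [measurable]: "\<Phi> \<in> borel_measurable borel" unfolding \<Phi>_def[abs_def] by measurable
  have N_nonneg: "0 \<le> N x" and N_le: "N x \<le> M\<^sup>2" for x using N2 by (auto simp: N_def)
  have N_int: "integrable lborel N" using L2 by (simp add: N_def[abs_def])
  have N_sq_int: "integrable lborel (\<lambda>x. (N x)\<^sup>2)"
  proof (rule Bochner_Integration.integrable_bound)
    show "integrable lborel (\<lambda>x. M\<^sup>2 * N x)" using N_int by simp
    show "AE x in lborel. norm ((N x)\<^sup>2) \<le> norm (M\<^sup>2 * N x)"
      using N_nonneg N_le by (intro AE_I2) (auto simp: power2_eq_square[of "N _"] intro!: mult_right_mono)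
  qed measurable
  have \<Phi>_int: "integrable lborel \<Phi>" unfolding \<Phi>_def[abs_def] using N_int N_sq_int by simp
  define d\<Phi> where "d\<Phi> i x = (\<Sum>j\<in>Basis. v j x * du j i x)" for i x
  have [measurable]: "d\<Phi> i \<in> borel_measurable borel" for i unfolding d\<Phi>_def[abs_def] by measurable
  have d\<Phi>: "((\<lambda>h. \<Phi> (x + h *\<^sub>R i)) has_field_derivative d\<Phi> i x) (at 0)" for i x
  proof -
    have N_eq: "N y = (\<Sum>j\<in>Basis. (u y \<bullet> j) * (u y \<bullet> j))" for y
      unfolding N_def by (subst power2_norm_eq_inner, rule euclidean_inner)
    have "((\<lambda>h. N (x + h *\<^sub>R i)) has_field_derivative
        (\<Sum>j\<in>Basis. du j i x * (u (x + 0 *\<^sub>R i) \<bullet> j) + du j i x * (u (x + 0 *\<^sub>R i) \<bullet> j))) (at 0)"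
      unfolding N_eq by (intro DERIV_sum DERIV_mult du)
    also have "(\<Sum>j\<in>Basis. du j i x * (u (x + 0 *\<^sub>R i) \<bullet> j) + du j i x * (u (x + 0 *\<^sub>R i) \<bullet> j)) =
        (\<Sum>j\<in>Basis. 2 * du j i x * (u x \<bullet> j))"
      by (rule sum.cong) auto
    finally have dN: "((\<lambda>h. N (x + h *\<^sub>R i)) has_field_derivative (\<Sum>j\<in>Basis. 2 * du j i x * (u x \<bullet> j))) (at 0)" .
    let ?s = "\<Sum>j\<in>Basis. 2 * du j i x * (u x \<bullet> j)"
    have "((\<lambda>h. \<Phi> (x + h *\<^sub>R i)) has_field_derivative ?s / 2 - (?s * N (x + 0 *\<^sub>R i) + ?s * N (x + 0 *\<^sub>R i)) / 4) (at 0)"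
      unfolding \<Phi>_def power2_eq_square by (intro DERIV_diff DERIV_cdivide DERIV_mult dN)
    also have "?s / 2 - (?s * N (x + 0 *\<^sub>R i) + ?s * N (x + 0 *\<^sub>R i)) / 4 = ?s * ((1 - N x) / 2)"
      by (simp add: field_simps)
    also have "\<dots> = d\<Phi> i x"
      unfolding d\<Phi>_def sum_distrib_right by (rule sum.cong) (auto simp: v_def N_def)
    finally show ?thesis .
  qed
  have \<Phi>_lip: "\<bar>\<Phi> (x + h *\<^sub>R i) - \<Phi> x\<bar> \<le> ((1 / 2 + M\<^sup>2 / 2) * (2 * M * L)) * \<bar>h\<bar>" if i: "i \<in> Basis" for i x h
  proof -
    let ?y = "x + h *\<^sub>R i"
    have "\<Phi> ?y - \<Phi> x = (1 / 2 - (N ?y + N x) / 4) * (N ?y - N x)"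
      by (simp add: \<Phi>_def field_simps power2_eq_square)
    also have "\<bar>\<dots>\<bar> = \<bar>1 / 2 - (N ?y + N x) / 4\<bar> * \<bar>N ?y - N x\<bar>" by (rule abs_mult)
    also have "\<dots> \<le> (1 / 2 + M\<^sup>2 / 2) * (2 * M * (L * \<bar>h\<bar>))"
    proof (rule mult_mono)
      show "\<bar>1 / 2 - (N ?y + N x) / 4\<bar> \<le> 1 / 2 + M\<^sup>2 / 2"
        using N_nonneg[of x] N_nonneg[of ?y] N_le[of x] N_le[of ?y] by (simp add: abs_le_iff field_simps)
      show "\<bar>N ?y - N x\<bar> \<le> 2 * M * (L * \<bar>h\<bar>)" using sq_lip[OF i] by (simp add: N_def)
    qed auto
    finally show ?thesis by (simp add: mult_ac)
  qed
  define d where "d m = 1 / real (Suc m)" for m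
  have d: "d m > 0" "d \<longlonglongrightarrow> 0" for m
    using LIMSEQ_inverse_real_of_nat by (auto simp: d_def[abs_def] inverse_eq_divide)
  \<comment> \<open>\<open>pohozaev_limit\<close> wants integrability for every \<open>i\<close>;
    outside the basis the field is therefore set to 0.\<close>
  define X where "X m i = (if i \<in> Basis then cutoff (d m) i else (\<lambda>x. 0))" for m and i :: 'a
  have X: "X m i = cutoff (d m) i" if "i \<in> Basis" for m i using that by (simp add: X_def)
  have X_int: "integrable lborel (X m i)" for m i
    by (auto simp: X_def intro: cutoff_integrable d)
  have X_lim: "(\<lambda>m. X m i x) \<longlonglongrightarrow> x \<bullet> i" if i: "i \<in> Basis" for i x
  proof -
    have "(\<lambda>m. (x \<bullet> i) * exp (- d m * (norm x)\<^sup>2)) \<longlonglongrightarrow> (x \<bullet> i) * exp (- 0 * (norm x)\<^sup>2)"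
      by (intro tendsto_intros d(2))
    then show ?thesis by (simp add: X[OF i] cutoff_def)
  qed
  have g_lip: "\<bar>g j (x + h *\<^sub>R i) - g j x\<bar> \<le> (((1 + M\<^sup>2) * L + M * (2 * M * L)) / C) * \<bar>h\<bar>"
    if "i \<in> Basis" "j \<in> Basis" for i j x h
    using divide_right_mono[OF v_lip[OF that, of x h], of C] C(1)
    by (simp add: g_def diff_divide_distrib[symmetric] abs_divide)
  have lim: "(\<lambda>m. \<Sum>i\<in>Basis. LBINT x. X m i x * g j x * du j i x) \<longlonglongrightarrow>
      (\<beta> - ?n / 2) * (LBINT x. g j x * (u x \<bullet> j))" if j: "j \<in> Basis" for j
    by (rule riesz_pair.pohozaev_limit[OF RP[OF j] g_lip[OF _ j] du X_int _ _ X_lim])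
      (auto simp: X intro: cutoff_bounded[OF d(1)] cutoff_lipschitz[OF d(1)])
  \<comment> \<open>Both sides are linear in \<open>g\<close>, so multiplying by \<open>C\<close>
    returns to \<open>v\<close>.\<close>
  have lim_v: "(\<lambda>m. \<Sum>j\<in>Basis. \<Sum>i\<in>Basis. LBINT x. X m i x * v j x * du j i x) \<longlonglongrightarrow>
      (\<Sum>j\<in>Basis. (\<beta> - ?n / 2) * (LBINT x. v j x * (u x \<bullet> j)))"
  proof (rule tendsto_sum)
    fix j :: 'b assume j: "j \<in> Basis"
    have "(LBINT x. X m i x * v j x * du j i x) = C * (LBINT x. X m i x * g j x * du j i x)" for m i
      using C(1) by (simp add: g_def)
    moreover have "(LBINT x. v j x * (u x \<bullet> j)) = C * (LBINT x. g j x * (u x \<bullet> j))"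
      using C(1) by (simp add: g_def)
    ultimately show "(\<lambda>m. \<Sum>i\<in>Basis. LBINT x. X m i x * v j x * du j i x) \<longlonglongrightarrow>
        (\<beta> - ?n / 2) * (LBINT x. v j x * (u x \<bullet> j))"
      using tendsto_mult_left[OF lim[OF j], of C] by (simp add: sum_distrib_left mult.left_commute)
  qed
  have Xv_int: "integrable lborel (\<lambda>x. X m i x * v j x * du j i x)" if i: "i \<in> Basis" and j: "j \<in> Basis" for m i j
  proof -
    obtain V where V: "V \<ge> 0" "\<And>x. \<bar>v j x\<bar> \<le> V" by (rule bounded_L2_bound[OF bL_v[OF j]]) blast
    have [measurable]: "X m i \<in> borel_measurable borel" using X_int[of m i] by auto
    show ?thesis
    proof (rule integrable_boundI)
      show "integrable lborel (\<lambda>x. (V * L) * X m i x)" using X_int by simp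
      show "\<bar>X m i x * v j x * du j i x\<bar> \<le> \<bar>(V * L) * X m i x\<bar>" for x
      proof -
        have "\<bar>v j x\<bar> * \<bar>du j i x\<bar> \<le> V * L" using V du_le[OF i j, of x] by (intro mult_mono) auto
        from mult_left_mono[OF this abs_ge_zero[of "X m i x"]] show ?thesis
          using V(1) order_trans[OF abs_ge_zero du_le[OF i j, of x]] by (simp add: abs_mult mult_ac)
      qed
    qed measurable
  qed
  \<comment> \<open>The sum over the components of \<open>u\<close> has to come inside the integral
    before integrating by parts, because only \<open>d\<Phi>\<close>, and not a single summand, is
    an exact derivative.\<close>
  have ibp: "(\<Sum>j\<in>Basis. \<Sum>i\<in>Basis. LBINT x. X m i x * v j x * du j i x) =
      (\<Sum>i\<in>Basis. - (LBINT x. (1 - 2 * d m * (x \<bullet> i)\<^sup>2) * exp (- d m * (norm x)\<^sup>2) * \<Phi> x))" for m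
  proof -
    have "(\<Sum>j\<in>Basis. LBINT x. X m i x * v j x * du j i x) =
        - (LBINT x. (1 - 2 * d m * (x \<bullet> i)\<^sup>2) * exp (- d m * (norm x)\<^sup>2) * \<Phi> x)" if i: "i \<in> Basis" for i
    proof -
      have "(\<Sum>j\<in>Basis. LBINT x. X m i x * v j x * du j i x) = (LBINT x. (\<Sum>j\<in>Basis. X m i x * v j x * du j i x))"
        by (rule Bochner_Integration.integral_sum[symmetric]) (rule Xv_int[OF i])
      also have "\<dots> = (LBINT x. cutoff (d m) i x * d\<Phi> i x)"
        by (simp add: X[OF i] d\<Phi>_def sum_distrib_left mult.assoc)
      also have "\<dots> = - (LBINT x. (1 - 2 * d m * (x \<bullet> i)\<^sup>2) * exp (- d m * (norm x)\<^sup>2) * \<Phi> x)"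
        by (rule cutoff_integration_by_parts[OF d(1) i \<Phi>_int _ d\<Phi> \<Phi>_lip[OF i]]) measurable
      finally show ?thesis .
    qed
    then show ?thesis by (subst sum.swap) simp
  qed
  have "(\<lambda>m. \<Sum>j\<in>Basis. \<Sum>i\<in>Basis. LBINT x. X m i x * v j x * du j i x) \<longlonglongrightarrow>
      (\<Sum>i\<in>(Basis :: 'a set). - (LBINT x. \<Phi> x))"
    unfolding ibp by (intro tendsto_sum tendsto_minus cutoff_divergence_limit[OF \<Phi>_int _ d])
  from LIMSEQ_unique[OF this lim_v]
  have "- (?n * (LBINT x. \<Phi> x)) = (\<beta> - ?n / 2) * (\<Sum>j\<in>Basis. LBINT x. v j x * (u x \<bullet> j))"
    by (simp add: sum_distrib_left)
  moreover have "(\<Sum>j\<in>Basis. LBINT x. v j x * (u x \<bullet> j)) = (LBINT x. N x) - (LBINT x. (N x)\<^sup>2)"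
  proof -
    have int: "integrable lborel (\<lambda>x. v j x * (u x \<bullet> j))" if j: "j \<in> Basis" for j
    proof (rule integrable_boundI)
      show "integrable lborel (\<lambda>x. (1 + M\<^sup>2) * (u x \<bullet> j)\<^sup>2)" using bL_u[OF j] by (simp add: bounded_L2_def)
      show "\<bar>v j x * (u x \<bullet> j)\<bar> \<le> \<bar>(1 + M\<^sup>2) * (u x \<bullet> j)\<^sup>2\<bar>" for x
        using mult_right_mono[OF v_le[of j x] abs_ge_zero[of "u x \<bullet> j"]] by (simp add: abs_mult power2_eq_square)
    qed measurable
    have "(\<Sum>j\<in>Basis. v j x * (u x \<bullet> j)) = N x - (N x)\<^sup>2" for x
    proof -
      have "N x = (\<Sum>j\<in>Basis. (u x \<bullet> j) * (u x \<bullet> j))"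
        unfolding N_def by (subst power2_norm_eq_inner, rule euclidean_inner)
      moreover have "(\<Sum>j\<in>Basis. v j x * (u x \<bullet> j)) = (1 - N x) * (\<Sum>j\<in>Basis. (u x \<bullet> j) * (u x \<bullet> j))"
        by (simp add: v_def N_def sum_distrib_left mult.assoc)
      ultimately show ?thesis by (simp add: power2_eq_square left_diff_distrib)
    qed
    then show ?thesis
      using N_int N_sq_int int by (simp add: Bochner_Integration.integral_sum[symmetric])
  qed
  moreover have "(LBINT x. \<Phi> x) = (LBINT x. N x) / 2 - (LBINT x. (N x)\<^sup>2) / 4"
    unfolding \<Phi>_def using N_int N_sq_int by simp
  \<comment> \<open>With A and B the integrals of N and N^2, the two values of the limit read -n
    (A/2 - B/4) = (\<beta> - n/2) (A - B).\<close>
  ultimately have "\<beta> * (LBINT x. N x) + (?n / 4 - \<beta>) * (LBINT x. (N x)\<^sup>2) = 0"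
    by (simp add: algebra_simps)
  moreover have "0 \<le> (?n / 4 - \<beta>) * (LBINT x. (N x)\<^sup>2)"
    using \<beta>(2) by (intro mult_nonneg_nonneg integral_nonneg_AE) auto
  moreover have "0 \<le> (LBINT x. N x)" using N_nonneg by (intro integral_nonneg_AE) auto
  ultimately have "integral\<^sup>L lborel N = 0"
    using \<beta>(3) by (smt (verit) mult_pos_pos)
  then have "AE y in lborel. N y = 0"
    using integral_nonneg_eq_0_iff_AE[OF N_int] N_nonneg by simp
  then have "AE y in lborel. u y = 0" by (simp add: N_def)
  \<comment> \<open>Vanishing almost everywhere makes the right side of the integral equation 0 at
    every x, so the equation itself gives the pointwise statement.\<close>
  then have "AE y in lborel. ((1 - (norm (u y))\<^sup>2) / norm (x - y) powr (?n - \<alpha>)) *\<^sub>R u y = 0"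
    by eventually_elim simp
  then have "(LBINT y. ((1 - (norm (u y))\<^sup>2) / norm (x - y) powr (?n - \<alpha>)) *\<^sub>R u y) = 0"
    by (rule integral_eq_zero_AE)
  then show "u x = 0" using eq[of x] by (simp add: has_bochner_integral_iff)
qed

theorem theorem1:
  fixes u :: "real ^ 'n \<Rightarrow> real ^ 'k" and \<alpha> :: real
  assumes "CARD('n) \<ge> 3"
    and "1 < \<alpha>" and "\<alpha> < real CARD('n) / 2"
    and "bounded (range u)"
    and "\<And>x. u differentiable (at x)"
    and "\<And>x. has_bochner_integral lborel
               (\<lambda>y. ((1 - (norm (u y))\<^sup>2) / norm (x - y) powr (real CARD('n) - \<alpha>)) *\<^sub>R u y)
               (u x)"
    and "integrable lborel (\<lambda>x. (norm (u x))\<^sup>2)"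
  shows "\<forall>x. u x = 0"
  using ginzburg_landau_liouville[of \<alpha> u] assms(2-) by simp

end
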